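(* Let $\mathcal{F}$ be a downwardly stable subset of $\mathcal{SVT}$ such that there is a fully polynomial almost uniform sampler (FPAUS) for $\mathcal{F}$. Then there is a fully polynomial randomized approximation scheme (FPRAS) that computes $f^{\lambda,N,S}$ for $(\lambda,N,S)\in\mathcal{F}$.
   Context: Partitions and tableaux. A partition is a finite weakly decreasing sequence of positive integers, identified with its Young diagram $\{(r,c):1\le c\le\lambda_r\}$ (rows from the top, columns from the left); $|\lambda|$ is the number of boxes. For $N\ge|\lambda|$, an $N$-standard set-valued tableau of shape $\lambda$ assigns to each box $(r,c)$ a nonempty set $T(r,c)\subseteq\{1,\ldots,N\}$ such that each value in $\{1,\ldots,N\}$ appears exactly once and, whenever one value is selected from each box, the filling increases down columns and weakly increases along rows. $\mathsf{SVT}(\lambda,N)$ is the set of these. Pre-tableaux. For $0\le k\le N$, an $N\langle k\rangle$-standard set-valued pre-tableau of shape $\lambda$ assigns a (possibly empty) subset of $\{k+1,\ldots,N\}$ to each box of $\lambda$ such that: (i) each value in $\{k+1,\ldots,N\}$ appears exactly once; (ii) if $T(r,c)\ne\emptyset$, then $(r+1,c)\in\lambda$ implies $T(r+1,c)\neq\emptyset$ and $(r,c+1)\in\lambda$ implies $T(r,c+1)\ne\emptyset$; (iii) if $T(r,c)\neq\emptyset$, then $(r+1,c)\in\lambda$ implies $\max T(r,c)<\min T(r+1,c)$ and $(r,c+1)\in\lambda$ implies $\max T(r,c)<\min T(r,c+1)$; (iv) at most $k$ boxes have $T(r,c)=\emptyset$. For such an $S$, $\mathsf{SVT}(\lambda,N,S)$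 is the set of $T\in\mathsf{SVT}(\lambda,N)$ with $S\subseteq T$, meaning $S(r,c)\subseteq T(r,c)$ for all boxes; $f^{\lambda,N,S}=|\mathsf{SVT}(\lambda,N,S)|$; and $\lambda\setminus S=\{(r,c)\in\lambda:S(r,c)=\emptyset\}$. $\mathcal{SVT}$ is the set of all triples $(\lambda,N,S)$ with $\lambda$ a partition, $N\ge|\lambda|$, and $S$ an $N\langle k\rangle$-standard set-valued pre-tableau of shape $\lambda$ for some $0\le k\le N$ ($k$ always denotes the integer associated with $S$). A subset $\mathcal{F}\subseteq\mathcal{SVT}$ is downwardly stable if for all $(\lambda,N,S)\in\mathcal{F}$ and every $N\langle k'\rangle$-standard set-valued pre-tableau $S'$ of shape $\lambda$ (for some $0\le k'\le N$) with $S\subseteq S'$ (i.e. $S(r,c)\subseteq S'(r,c)$ for all boxes), also $(\lambda,N,S')\in\mathcal{F}$. FPAUS. With $d_{\mathsf{TV}}(\mu,\nu)=\max_{A}|\mu(A)-\nu(A)|$, a FPAUS for $\mathcal{F}\subseteq\mathcal{SVT}$ is a randomized algorithm that, given $(\lambda,N,S)\in\mathcal{F}$ and a bias parameter $\delta$, outputs a random $T\in\mathsf{SVT}(\lambda,N,S)$ from a distribution $\Gamma$ with $d_{\mathsf{TV}}(\Gamma,U)\le\delta$, where $U$ is uniform on $\mathsf{SVT}(\lambda,N,S)$, in time polynomial in $k$, $|\lambda\setminus S|$ and $\log\delta^{-1}$. FPRAS. A FPRAS for $f^{\lambda,N,S}$ on $\mathcal{F}$ is a randomized algorithm that, given $(\lambda,N,S)\in\mathcal{F}$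 and an error parameter $\epsilon\in(0,1]$, computes an approximation $A$ such that $P\big((1-\epsilon)f^{\lambda,N,S}\le A\le(1+\epsilon)f^{\lambda,N,S}\big)\ge\frac34$, in time polynomial in $|\lambda\setminus S|$, $k$ and $\frac1\epsilon$. (The confidence $\frac34$ may be boosted to $1-\delta$ by taking the median of $O(\ln\delta^{-1})$ trials.) *)

theory Defs
  imports "HOL-Probability.Probability"
begin

section \<open>Set-valued tableaux\<close>

text \<open>Boxes are pairs (row, column), both counted from 1.\<close>

definition partition :: "nat list \<Rightarrow> bool" where
  "partition lam \<longleftrightarrow> sorted_wrt (\<ge>) lam \<and> (\<forall>x\<in>set lam. 0 < x)"

definition diagram :: "nat list \<Rightarrow> (nat \<times> nat) set" where
  "diagram lam = {(r, c). 1 \<le> r \<and> r \<le> length lam \<and> 1 \<le> c \<and> c \<le> lam ! (r - 1)}"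

text \<open>
  A filling of the boxes of a shape is a function on all pairs of numbers. The value outside the
  diagram is fixed to be the empty set, so that fillings of the shape and such functions are in
  bijection; this matters for counting.
\<close>

type_synonym filling = "nat \<times> nat \<Rightarrow> nat set"

definition SVT :: "nat list \<Rightarrow> nat \<Rightarrow> filling set" where
  "SVT lam N = {T.
     (\<forall>b. b \<notin> diagram lam \<longrightarrow> T b = {}) \<and>
     (\<forall>b\<in>diagram lam. T b \<noteq> {} \<and> T b \<subseteq> {1..N}) \<and>
     (\<forall>v\<in>{1..N}. \<exists>!b. b \<in> diagram lam \<and> v \<in> T b) \<and>
     (\<forall>g. (\<forall>b\<in>diagram lam. g b \<in> T b) \<longrightarrow>
        (\<forall>r r' c. (r, c) \<in> diagram lam \<and> (r', c) \<in> diagram lam \<and> r < r'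
            \<longrightarrow> g (r, c) < g (r', c)) \<and>
        (\<forall>r c c'. (r, c) \<in> diagram lam \<and> (r, c') \<in> diagram lam \<and> c < c'
            \<longrightarrow> g (r, c) \<le> g (r, c')))}"

definition pretableau :: "nat list \<Rightarrow> nat \<Rightarrow> nat \<Rightarrow> filling \<Rightarrow> bool" where
  "pretableau lam N k S \<longleftrightarrow>
     (\<forall>b. b \<notin> diagram lam \<longrightarrow> S b = {}) \<and>
     (\<forall>b\<in>diagram lam. S b \<subseteq> {k+1..N}) \<and>
     (\<forall>v\<in>{k+1..N}. \<exists>!b. b \<in> diagram lam \<and> v \<in> S b) \<and>
     (\<forall>(r, c)\<in>diagram lam. S (r, c) \<noteq> {} \<longrightarrow>
        ((r + 1, c) \<in> diagram lam \<longrightarrow> S (r + 1, c) \<noteq> {}) \<and>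
        ((r, c + 1) \<in> diagram lam \<longrightarrow> S (r, c + 1) \<noteq> {})) \<and>
     (\<forall>(r, c)\<in>diagram lam. S (r, c) \<noteq> {} \<longrightarrow>
        ((r + 1, c) \<in> diagram lam \<longrightarrow> Max (S (r, c)) < Min (S (r + 1, c))) \<and>
        ((r, c + 1) \<in> diagram lam \<longrightarrow> Max (S (r, c)) < Min (S (r, c + 1)))) \<and>
     card {b \<in> diagram lam. S b = {}} \<le> k"

definition le_filling :: "nat list \<Rightarrow> filling \<Rightarrow> filling \<Rightarrow> bool" where
  "le_filling lam S T \<longleftrightarrow> (\<forall>b\<in>diagram lam. S b \<subseteq> T b)"

definition SVT_ext :: "nat list \<Rightarrow> nat \<Rightarrow> filling \<Rightarrow> filling set" where
  "SVT_ext lam N S = {T \<in> SVT lam N. le_filling lam S T}"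

definition num_SVT :: "nat list \<Rightarrow> nat \<Rightarrow> filling \<Rightarrow> nat" where
  "num_SVT lam N S = card (SVT_ext lam N S)"

definition empty_boxes :: "nat list \<Rightarrow> filling \<Rightarrow> (nat \<times> nat) set" where
  "empty_boxes lam S = {b \<in> diagram lam. S b = {}}"

type_synonym inst = "nat list \<times> nat \<times> filling"

definition SVT_triples :: "inst set" where
  "SVT_triples = {(lam, N, S). partition lam \<and> card (diagram lam) \<le> N \<and>
     (\<exists>k\<le>N. pretableau lam N k S)}"

definition downwardly_stable :: "inst set \<Rightarrow> bool" where
  "downwardly_stable F \<longleftrightarrow> (\<forall>(lam, N, S)\<in>F. \<forall>k'\<le>N. \<forall>S'.
     pretableau lam N k' S' \<and> le_filling lam S S' \<longrightarrow> (lam, N, S') \<in> F)"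


section \<open>Randomized algorithms and their running time\<close>

text \<open>
  The required time bounds depend neither on N nor on the size of the shape, so an algorithm cannot
  even read all of its input or write all of its output afresh. The machine model is therefore a
  pointer model: a small programming language on immutable binary trees with natural numbers at the
  leaves. Every elementary step has unit cost: taking or joining components of a pair (which
  amounts to handling references to shared data), addition and truncated subtraction of numbers,
  testing for 0, and tossing a fair coin. Multiplication is deliberately not elementary: as for the
  unit-cost RAM with addition and subtraction only, numbers grow by at most one bit per step, so
  that polynomial time here is the usual polynomial time, with numbers in the input being handled
  as words.
\<close>

datatype val = Num nat | Cell val val

fun fst_val :: "val \<Rightarrow> val" where
  "fst_val (Cell x y) = x"
| "fst_val (Num n) = Num 0"

fun snd_val :: "val \<Rightarrow> val" where
  "snd_val (Cell x y) = y"
| "snd_val (Num n) = Num 0"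

fun num_of :: "val \<Rightarrow> nat" where
  "num_of (Num n) = n"
| "num_of (Cell x y) = 0"

text \<open>
  A program maps an input value to an output value. In \<open>Cond\<close> and \<open>While\<close>, the first program is the
  test; \<open>Num 0\<close> means false and every other value means true. The binary arithmetic operations
  expect a pair of numbers.
\<close>

datatype prog =
    Skip
  | Const val
  | Fst
  | Snd
  | Fork prog prog
  | Seq prog prog
  | Cond prog prog prog
  | While prog prog
  | Add
  | Sub
  | Coin

text \<open>
  The semantics yields the joint distribution of the output and the number of steps. Mass missing
  from the subprobability distribution is the probability of non-termination.
\<close>

partial_function (spmf) loop ::
  "(val \<Rightarrow> (val \<times> nat) spmf) \<Rightarrow> (val \<Rightarrow> (val \<times> nat) spmf) \<Rightarrow> val \<Rightarrow> (val \<times> nat) spmf" where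
  "loop B C v = bind_spmf (B v) (\<lambda>(x, s).
     if x = Num 0 then return_spmf (v, s + 1)
     else bind_spmf (C v) (\<lambda>(w, t).
       bind_spmf (loop B C w) (\<lambda>(u, r). return_spmf (u, s + t + r + 1))))"

primrec run :: "prog \<Rightarrow> val \<Rightarrow> (val \<times> nat) spmf" where
  "run Skip v = return_spmf (v, 1)"
| "run (Const x) v = return_spmf (x, 1)"
| "run Fst v = return_spmf (fst_val v, 1)"
| "run Snd v = return_spmf (snd_val v, 1)"
| "run (Fork p q) v = bind_spmf (run p v) (\<lambda>(x, s). bind_spmf (run q v) (\<lambda>(y, t).
     return_spmf (Cell x y, s + t + 1)))"
| "run (Seq p q) v = bind_spmf (run p v) (\<lambda>(x, s). bind_spmf (run q x) (\<lambda>(y, t).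
     return_spmf (y, s + t + 1)))"
| "run (Cond b p q) v = bind_spmf (run b v) (\<lambda>(x, s).
     bind_spmf (if x = Num 0 then run q v else run p v) (\<lambda>(y, t). return_spmf (y, s + t + 1)))"
| "run (While b p) v = loop (run b) (run p) v"
| "run Add v = return_spmf (Num (num_of (fst_val v) + num_of (snd_val v)), 1)"
| "run Sub v = return_spmf (Num (num_of (fst_val v) - num_of (snd_val v)), 1)"
| "run Coin v = map_spmf (\<lambda>b. (Num (if b then 1 else 0), 1)) coin_spmf"

definition output_dist :: "prog \<Rightarrow> val \<Rightarrow> val spmf" where
  "output_dist p v = map_spmf fst (run p v)"

text \<open>Worst-case running time, over all outcomes of the coin tosses.\<close>

definition runs_within :: "prog \<Rightarrow> val \<Rightarrow> real \<Rightarrow> bool" where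
  "runs_within p v B \<longleftrightarrow> lossless_spmf (run p v) \<and> (\<forall>(y, t)\<in>set_spmf (run p v). real t \<le> B)"

text \<open>
  The value at (x, y, z) of the polynomial in three variables with coefficients \<open>a i j l\<close>, of
  degree at most n in each variable.
\<close>

definition poly3 :: "(nat \<Rightarrow> nat \<Rightarrow> nat \<Rightarrow> real) \<Rightarrow> nat \<Rightarrow> real \<Rightarrow> real \<Rightarrow> real \<Rightarrow> real" where
  "poly3 a n x y z = (\<Sum>i\<le>n. \<Sum>j\<le>n. \<Sum>l\<le>n. a i j l * x ^ i * y ^ j * z ^ l)"


section \<open>Encoding of inputs and outputs\<close>

definition enc_list :: "val list \<Rightarrow> val" where
  "enc_list xs = foldr Cell xs (Num 0)"

text \<open>
  A filling is the list of its rows, a row is the list of its boxes, a box is the increasing list of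
  its elements.
\<close>

definition enc_filling :: "nat list \<Rightarrow> filling \<Rightarrow> val" where
  "enc_filling lam T =
     enc_list (map (\<lambda>r.
       enc_list (map (\<lambda>c.
         enc_list (map Num (sorted_list_of_set (T (r, c)))))
       [1..<Suc (lam ! (r - 1))]))
     [1..<Suc (length lam)])"

fun enc_inst :: "inst \<Rightarrow> val" where
  "enc_inst (lam, N, S) = Cell (enc_list (map Num lam)) (Cell (Num N) (enc_filling lam S))"

text \<open>A rational number is represented by a fraction, not necessarily in lowest terms.\<close>

definition represents :: "val \<Rightarrow> real \<Rightarrow> bool" where
  "represents v x \<longleftrightarrow> (\<exists>a b. 0 < b \<and> v = Cell (Num a) (Num b) \<and> x = real a / real b)"


section \<open>Samplers and approximation schemes\<close>

definition tv_dist :: "'a pmf \<Rightarrow> 'a pmf \<Rightarrow> real" where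
  "tv_dist p q = (SUP A. \<bar>measure_pmf.prob p A - measure_pmf.prob q A\<bar>)"

text \<open>
  In the following two definitions, k is the integer associated with S; it is determined by S, since
  the elements of the boxes of S are exactly the numbers from k+1 to N. It is not part of the input.

  If the shape is empty and N is positive, there are no tableaux at all, and the uniform
  distribution does not exist. A sampler is not required to do anything on such an instance.
\<close>

definition is_FPAUS :: "prog \<Rightarrow> inst set \<Rightarrow> bool" where
  "is_FPAUS p F \<longleftrightarrow> (\<exists>a n. \<forall>(lam, N, S)\<in>F. \<forall>k\<le>N. pretableau lam N k S \<longrightarrow>
     SVT_ext lam N S \<noteq> {} \<longrightarrow>
     (\<forall>\<delta> d. 0 < \<delta> \<and> \<delta> < 1 \<and> represents d \<delta> \<longrightarrow>
        runs_within p (Cell (enc_inst (lam, N, S)) d)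
          (poly3 a n (real k) (real (card (empty_boxes lam S))) (ln (1 / \<delta>))) \<and>
        (\<exists>\<Gamma>. set_pmf \<Gamma> \<subseteq> SVT_ext lam N S \<and>
           tv_dist \<Gamma> (pmf_of_set (SVT_ext lam N S)) \<le> \<delta> \<and>
           output_dist p (Cell (enc_inst (lam, N, S)) d) =
             spmf_of_pmf (map_pmf (enc_filling lam) \<Gamma>))))"

definition is_FPRAS :: "prog \<Rightarrow> inst set \<Rightarrow> bool" where
  "is_FPRAS p F \<longleftrightarrow> (\<exists>a n. \<forall>(lam, N, S)\<in>F. \<forall>k\<le>N. pretableau lam N k S \<longrightarrow>
     (\<forall>\<epsilon> e. 0 < \<epsilon> \<and> \<epsilon> \<le> 1 \<and> represents e \<epsilon> \<longrightarrow>
        runs_within p (Cell (enc_inst (lam, N, S)) e)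
          (poly3 a n (real (card (empty_boxes lam S))) (real k) (1 / \<epsilon>)) \<and>
        (\<forall>y\<in>set_spmf (output_dist p (Cell (enc_inst (lam, N, S)) e)). \<exists>A. represents y A) \<and>
        measure (measure_spmf (output_dist p (Cell (enc_inst (lam, N, S)) e)))
          {y. \<exists>A. represents y A \<and>
             (1 - \<epsilon>) * real (num_SVT lam N S) \<le> A \<and> A \<le> (1 + \<epsilon>) * real (num_SVT lam N S)}
          \<ge> 3 / 4))"

end

theory Submission
  imports Defs
begin

text \<open>
  Counting reduces to sampling by self-reducibility. If \<open>S\<close> is a pre-tableau with integer \<open>k \<ge> 1\<close> and
  \<open>T\<close> is a tableau extending it, then putting \<open>k\<close> into the box that it occupies in \<open>T\<close> yields a
  pre-tableau \<open>S'\<close> with integer \<open>k - 1\<close>, and the number of extensions of \<open>S'\<close> divided by that of \<open>S\<close> is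
  the probability that \<open>k\<close> occupies this box in a uniform extension of \<open>S\<close>. After \<open>k\<close> steps exactly one
  extension remains, so that the number of extensions is the reciprocal of a product of \<open>k\<close> such
  probabilities. In every step one sample determines the box, and its probability is estimated from
  \<open>t = 2^17 k^9 \<lceil>1/\<epsilon>\<rceil>^2\<close> further samples with bias \<open>1/t\<close>. The box of \<open>k\<close> has row and column at most
  \<open>k\<close>, so it is unlikely that a box of probability less than \<open>1/(16 k^3)\<close> is selected; for any other
  box, Hoeffding's inequality bounds the relative error of the estimate by \<open>\<epsilon>/(2k)\<close>, up to a failure
  probability that sums to at most \<open>1/4\<close> over all steps.

  The algorithm never reads the whole input: the integer \<open>k\<close> is found by looking for \<open>1, 2, \<dots>\<close> in the
  top left corner of \<open>S\<close>, because \<open>k + 1\<close> occurs in a row and a column of index at most \<open>k + 1\<close>.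
\<close>

section \<open>Costs of programs\<close>

text \<open>The sampler is called on a new instance in every stage, so what it is promised has to be
  re-established each time: downward stability keeps the instance in \<open>F\<close>, and an
  extension remains because the box is read off an actual extension. This holds for every outcome of
  the coins. An unlucky stage therefore spoils only the accuracy, never the running time or the form
  of the output, which are required without exception.

  The estimated probabilities end up in a denominator, so every counter starts at 1 instead of 0;
  the resulting shift by 1/t belongs to the error budget, next to the bias 1/t. The sample size is
  computed once, from the initial \<open>k\<close>, and serves all stages.

  The result is kept as an unreduced fraction whose two numbers become very large. Multiplication is
  repeated addition, with a cost that depends on one factor only; in the stages this factor is
  always t or a count. Costs of programs are worst-case, so the analysis carries an exact output
  distribution together with a bound on the whole support.\<close>

definition realizes :: "prog \<Rightarrow> val \<Rightarrow> val pmf \<Rightarrow> nat \<Rightarrow> bool" where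
  "realizes p v D B \<longleftrightarrow>
     (\<exists>R. run p v = spmf_of_pmf R \<and> map_pmf fst R = D \<and> (\<forall>x\<in>set_pmf R. snd x \<le> B))"

abbreviation computes :: "prog \<Rightarrow> val \<Rightarrow> val \<Rightarrow> nat \<Rightarrow> bool" where
  "computes p v w B \<equiv> realizes p v (return_pmf w) B"

lemma realizes_weaken: "realizes p v D B \<Longrightarrow> D = D' \<Longrightarrow> B \<le> B' \<Longrightarrow> realizes p v D' B'"
  unfolding realizes_def using order_trans by blast

lemma computes_weaken: "computes p v w B \<Longrightarrow> w = w' \<Longrightarrow> B \<le> B' \<Longrightarrow> computes p v w' B'"
  by (rule realizes_weaken) auto

text \<open>The common shape of all sequential constructs.\<close>

lemma realizes_bind:
  assumes p: "realizes p v D B"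
    and q: "\<And>x. x \<in> set_pmf D \<Longrightarrow> \<exists>R. K x = spmf_of_pmf R \<and> map_pmf fst R = E x \<and> (\<forall>y\<in>set_pmf R. snd y \<le> C)"
    and f: "\<And>x s y t. s \<le> B \<Longrightarrow> t \<le> C \<Longrightarrow> x \<in> set_pmf D \<Longrightarrow> y \<in> set_pmf (E x) \<Longrightarrow> h x s y t = (f x y, c s t) \<and> c s t \<le> T"
    and r: "run r u = bind_spmf (run p v) (\<lambda>(x, s). bind_spmf (K x) (\<lambda>(y, t). return_spmf (h x s y t)))"
  shows "realizes r u (bind_pmf D (\<lambda>x. map_pmf (f x) (E x))) T"
proof -
  obtain R where R: "run p v = spmf_of_pmf R" "map_pmf fst R = D" "\<forall>x\<in>set_pmf R. snd x \<le> B"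
    using p unfolding realizes_def by blast
  obtain Q where Q: "\<And>x. x \<in> set_pmf D \<Longrightarrow> K x = spmf_of_pmf (Q x) \<and> map_pmf fst (Q x) = E x \<and> (\<forall>y\<in>set_pmf (Q x). snd y \<le> C)"
    using q by metis
  let ?g = "\<lambda>z. map_pmf (\<lambda>y. h (fst z) (snd z) (fst y) (snd y)) (Q (fst z))"
  let ?R = "bind_pmf R ?g"
  have "run r u = bind_pmf R (\<lambda>z. bind_spmf (K (fst z)) (\<lambda>y. return_spmf (h (fst z) (snd z) (fst y) (snd y))))"
    unfolding r R(1) by (simp add: case_prod_unfold)
  also have "\<dots> = bind_pmf R (\<lambda>z. spmf_of_pmf (?g z))"
  proof (rule bind_pmf_cong[OF refl])
    fix z assume "z \<in> set_pmf R"
    then have "fst z \<in> set_pmf D" using R(2) by auto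
    with Q show "bind_spmf (K (fst z)) (\<lambda>y. return_spmf (h (fst z) (snd z) (fst y) (snd y))) = spmf_of_pmf (?g z)"
      by (simp add: bind_pmf_return_spmf)
  qed
  finally have run: "run r u = spmf_of_pmf ?R" by (simp add: spmf_of_pmf_bind)
  have hh: "h (fst z) (snd z) (fst y) (snd y) = (f (fst z) (fst y), c (snd z) (snd y)) \<and> c (snd z) (snd y) \<le> T"
    if "z \<in> set_pmf R" "y \<in> set_pmf (Q (fst z))" for z y
  proof (rule f)
    show zD: "fst z \<in> set_pmf D" using R(2) that(1) by auto
    show "snd z \<le> B" using R(3) that(1) by auto
    show "snd y \<le> C" using Q[OF zD] that(2) by auto
    show "fst y \<in> set_pmf (E (fst z))" using Q[OF zD] that(2) by (metis image_eqI pmf.set_map)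
  qed
  have "map_pmf fst ?R = bind_pmf R (\<lambda>z. map_pmf (f (fst z)) (E (fst z)))"
    unfolding map_bind_pmf
  proof (rule bind_pmf_cong[OF refl])
    fix z assume z: "z \<in> set_pmf R"
    then have zD: "fst z \<in> set_pmf D" using R(2) by auto
    have "map_pmf fst (?g z) = map_pmf (\<lambda>y. f (fst z) (fst y)) (Q (fst z))"
      unfolding pmf.map_comp by (rule map_pmf_cong) (use hh[OF z] in auto)
    also have "\<dots> = map_pmf (f (fst z)) (map_pmf fst (Q (fst z)))"
      by (simp add: pmf.map_comp comp_def)
    finally show "map_pmf fst (?g z) = map_pmf (f (fst z)) (E (fst z))"
      using Q[OF zD] by simp
  qed
  also have "\<dots> = bind_pmf D (\<lambda>x. map_pmf (f x) (E x))"
    unfolding R(2)[symmetric] by (simp add: bind_map_pmf)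
  finally have "map_pmf fst ?R = bind_pmf D (\<lambda>x. map_pmf (f x) (E x))" .
  moreover have "\<forall>x\<in>set_pmf ?R. snd x \<le> T" using hh by auto
  ultimately show ?thesis unfolding realizes_def using run by blast
qed

lemma realizes_Seq:
  assumes "realizes p v D B" "\<And>x. x \<in> set_pmf D \<Longrightarrow> realizes q x (E x) C"
  shows "realizes (Seq p q) v (bind_pmf D E) (B + C + 1)"
proof -
  have "realizes (Seq p q) v (bind_pmf D (\<lambda>x. map_pmf (\<lambda>y. y) (E x))) (B + C + 1)"
    by (rule realizes_bind[OF assms(1), where K = "run q" and h = "\<lambda>x s y t. (y, s + t + 1)"
          and c = "\<lambda>s t. s + t + 1" and C = C])
       (use assms(2) in \<open>auto simp: realizes_def\<close>)
  then show ?thesis by simp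
qed

lemma realizes_Fork:
  assumes "realizes p v D B" "realizes q v E C"
  shows "realizes (Fork p q) v (bind_pmf D (\<lambda>x. map_pmf (Cell x) E)) (B + C + 1)"
  by (rule realizes_bind[OF assms(1), where K = "\<lambda>_. run q v" and h = "\<lambda>x s y t. (Cell x y, s + t + 1)"
          and c = "\<lambda>s t. s + t + 1" and C = C])
     (use assms(2) in \<open>auto simp: realizes_def\<close>)

lemma realizes_Cond:
  assumes "computes b v x B" "realizes (if x = Num 0 then q else p) v D C"
  shows "realizes (Cond b p q) v D (B + C + 1)"
proof -
  have "realizes (Cond b p q) v (bind_pmf (return_pmf x) (\<lambda>x. map_pmf (\<lambda>y. y) D)) (B + C + 1)"
    by (rule realizes_bind[OF assms(1), where K = "\<lambda>x. if x = Num 0 then run q v else run p v"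
          and h = "\<lambda>x s y t. (y, s + t + 1)"
          and c = "\<lambda>s t. s + t + 1" and C = C])
       (use assms(2) in \<open>auto simp: realizes_def split: if_splits\<close>)
  then show ?thesis by (simp add: bind_return_pmf)
qed

lemma computes_Skip: "computes Skip v v 1"
  and computes_Const: "computes (Const x) v x 1"
  and computes_Fst: "computes Fst (Cell x y) x 1"
  and computes_Snd: "computes Snd (Cell x y) y 1"
  and computes_Fst_val: "computes Fst v (fst_val v) 1"
  and computes_Snd_val: "computes Snd v (snd_val v) 1"
  and computes_Add: "computes Add (Cell (Num a) (Num b)) (Num (a + b)) 1"
  and computes_Sub: "computes Sub (Cell (Num a) (Num b)) (Num (a - b)) 1"
  and computes_Sub_val: "computes Sub (Cell x y) (Num (num_of x - num_of y)) 1"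
  unfolding realizes_def by (auto intro!: exI[of _ "return_pmf _"])

lemma computes_Seq: "computes p v x B \<Longrightarrow> realizes q x D C \<Longrightarrow> realizes (Seq p q) v D (B + C + 1)"
  using realizes_Seq[of p v "return_pmf x" B q "\<lambda>_. D" C] by (simp add: bind_return_pmf)

lemma computes_Fork: "computes p v x B \<Longrightarrow> computes q v y C \<Longrightarrow> computes (Fork p q) v (Cell x y) (B + C + 1)"
  using realizes_Fork[of p v "return_pmf x" B q "return_pmf y" C] by (simp add: bind_return_pmf)

lemma computes_Cond:
  assumes "computes b v x B" "x \<noteq> Num 0 \<Longrightarrow> computes p v y C" "x = Num 0 \<Longrightarrow> computes q v z C'"
  shows "computes (Cond b p q) v (if x = Num 0 then z else y) (B + (C + C') + 1)"
  by (rule realizes_Cond[OF assms(1)]) (use assms(2,3) in \<open>auto intro: computes_weaken\<close>)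

text \<open>These rules execute a program symbolically: once \<open>computes_weaken\<close> has made
  output and cost schematic, applying them repeatedly walks through the program and leaves an
  equation for the output and an inequality for the cost. The second program in
  \<open>computes_Seq\<close> may be randomized, so they also run the deterministic prefix of a
  random program.\<close>

lemmas computes_intros = computes_Skip computes_Const computes_Fst computes_Snd computes_Add computes_Sub
  computes_Seq computes_Fork

section \<open>Loops\<close>

lemma realizes_While_stop:
  assumes "computes b v (Num 0) B"
  shows "computes (While b p) v v (B + 1)"
proof -
  obtain R where R: "run b v = spmf_of_pmf R" "map_pmf fst R = return_pmf (Num 0)" "\<forall>x\<in>set_pmf R. snd x \<le> B"
    using assms unfolding realizes_def by blast
  have f: "fst z = Num 0" if "z \<in> set_pmf R" for z
    using R(2) that by (metis pmf.set_map image_eqI set_return_pmf singletonD)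
  have "run (While b p) v = bind_pmf R (\<lambda>(x, s). return_spmf (v, s + 1))"
    by (simp, subst loop.simps) (auto simp: R(1) intro!: bind_pmf_cong dest: f)
  also have "\<dots> = spmf_of_pmf (map_pmf (\<lambda>z. (v, snd z + 1)) R)"
    by (simp add: case_prod_unfold bind_pmf_return_spmf)
  finally show ?thesis
    unfolding realizes_def using R(3) by (auto intro!: exI[of _ "map_pmf (\<lambda>z. (v, snd z + 1)) R"] simp: pmf.map_comp comp_def)
qed

lemma realizes_While_step:
  assumes b: "computes b v x B" and x: "x \<noteq> Num 0"
    and p: "realizes p v D C" and rest: "\<And>w. w \<in> set_pmf D \<Longrightarrow> realizes (While b p) w (E w) T"
  shows "realizes (While b p) v (bind_pmf D E) (B + C + T + 1)"
proof -
  \<comment> \<open>One unfolding of the loop runs the body and then the loop, as \<open>Seq\<close>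
    does, but without the unit that \<open>Seq\<close> charges. Hence the continuation
    \<open>?K\<close> is the run of this sequence with 1 subtracted from its cost.\<close>
  have *: "realizes (Seq p (While b p)) v (bind_pmf D E) (C + T + 1)"
    by (rule realizes_Seq[OF p rest])
  let ?K = "\<lambda>_::val. bind_spmf (run p v) (\<lambda>(w, t). bind_spmf (loop (run b) (run p) w) (\<lambda>(u, r). return_spmf (u, t + r)))"
  have K: "realizes (Seq p (While b p)) v (bind_pmf D E) (C + T + 1) \<Longrightarrow>
     \<exists>R. ?K x = spmf_of_pmf R \<and> map_pmf fst R = bind_pmf D E \<and> (\<forall>y\<in>set_pmf R. snd y \<le> C + T)"
  proof -
    assume "realizes (Seq p (While b p)) v (bind_pmf D E) (C + T + 1)"
    then obtain R where R: "run (Seq p (While b p)) v = spmf_of_pmf R" "map_pmf fst R = bind_pmf D E"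
      "\<forall>y\<in>set_pmf R. snd y \<le> C + T + 1"
      unfolding realizes_def by blast
    have "?K x = map_spmf (\<lambda>z. (fst z, snd z - 1)) (run (Seq p (While b p)) v)"
      by (simp add: map_spmf_conv_bind_spmf case_prod_unfold)
    also have "\<dots> = spmf_of_pmf (map_pmf (\<lambda>z. (fst z, snd z - 1)) R)"
      using R(1) by simp
    finally show ?thesis
      using R(2,3) by (intro exI[of _ "map_pmf (\<lambda>z. (fst z, snd z - 1)) R"]) (auto simp: pmf.map_comp comp_def)
  qed
  have r: "run (While b p) v = bind_spmf (run b v) (\<lambda>(y, s). bind_spmf (if y = Num 0 then return_spmf (v, 0) else ?K y) (\<lambda>(u, r). return_spmf (u, s + r + 1)))"
    apply (simp, subst loop.simps)
    apply (rule bind_spmf_cong[OF refl])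
    apply (auto simp: case_prod_unfold algebra_simps)
    done
  have "realizes (While b p) v (bind_pmf (return_pmf x) (\<lambda>x. map_pmf (\<lambda>y. y) (bind_pmf D E))) (B + C + T + 1)"
    by (rule realizes_bind[OF b, where C = "C + T" and c = "\<lambda>s t. s + t + 1",
          where K = "\<lambda>y. if y = Num 0 then return_spmf (v, 0) else ?K y"
          and h = "\<lambda>y s u r. (u, s + r + 1)"])
       (use K[OF *] x r in auto)
  then show ?thesis by (simp add: bind_return_pmf)
qed

lemma computes_While:
  assumes "\<And>i. i < n \<Longrightarrow> computes b (s i) (x i) B" "\<And>i. i < n \<Longrightarrow> x i \<noteq> Num 0"
    and "\<And>i. i < n \<Longrightarrow> computes p (s i) (s (Suc i)) C"
    and "computes b (s n) (Num 0) B"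
  shows "computes (While b p) (s 0) (s n) (n * (B + C + 1) + B + 1)"
proof -
  have "computes (While b p) (s i) (s n) ((n - i) * (B + C + 1) + B + 1)" if "i \<le> n" for i
    using that
  proof (induction rule: inc_induct)
    case base
    show ?case by (rule computes_weaken[OF realizes_While_stop[OF assms(4)]]) auto
  next
    case (step i)
    have "realizes (While b p) (s i) (bind_pmf (return_pmf (s (Suc i))) (\<lambda>_. return_pmf (s n)))
      (B + C + ((n - Suc i) * (B + C + 1) + B + 1) + 1)"
      by (rule realizes_While_step[OF assms(1,2,3)]) (use step in auto)
    moreover have "n - i = Suc (n - Suc i)" using step by simp
    ultimately show ?case by (elim realizes_weaken) (auto simp: bind_return_pmf algebra_simps)
  qed
  from this[of 0] show ?thesis by simp
qed

text \<open>
  \<open>For p\<close> maps \<open>Cell (Num n) s\<close> to \<open>Cell (Num 0) s'\<close>, where the body \<open>p\<close> is applied for the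
  indices \<open>n - 1\<close> down to \<open>0\<close> and sees the index in front of the state.
\<close>

definition For :: "prog \<Rightarrow> prog" where
  "For p = While Fst (Seq (Fork (Seq (Fork Fst (Const (Num 1))) Sub) Snd) (Fork Fst p))"

lemma realizes_For_0: "computes (For p) (Cell (Num 0) s) (Cell (Num 0) s) 2"
  unfolding For_def by (rule computes_weaken[OF realizes_While_stop]) (rule computes_intros | simp)+

lemma realizes_Fork_det:
  assumes "computes p v x B" "realizes q v D C"
  shows "realizes (Fork p q) v (map_pmf (Cell x) D) (B + C + 1)"
  using realizes_Fork[OF assms] by (simp add: bind_return_pmf)

lemma realizes_For_Suc:
  assumes p: "realizes p (Cell (Num n) s) D B"
    and rest: "\<And>s'. s' \<in> set_pmf D \<Longrightarrow> realizes (For p) (Cell (Num n) s') (E s') R"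
  shows "realizes (For p) (Cell (Num (Suc n)) s) (bind_pmf D E) (B + R + 12)"
proof -
  have "realizes (For p) (Cell (Num (Suc n)) s) (bind_pmf (map_pmf (Cell (Num n)) D) (\<lambda>w. E (snd_val w)))
    (1 + (7 + (1 + B + 1) + 1) + R + 1)"
    unfolding For_def
  proof (rule realizes_While_step, rule computes_Fst)
    show "Num (Suc n) \<noteq> Num 0" by simp
    show "realizes (Seq (Fork (Seq (Fork Fst (Const (Num 1))) Sub) Snd) (Fork Fst p)) (Cell (Num (Suc n)) s)
      (map_pmf (Cell (Num n)) D) (7 + (1 + B + 1) + 1)"
      by (rule computes_Seq[OF computes_weaken realizes_Fork_det[OF _ p]]) (rule computes_intros | simp)+
  qed (use rest in \<open>auto simp: For_def\<close>)
  then show ?thesis by (rule realizes_weaken) (auto simp: bind_map_pmf)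
qed

lemma computes_For:
  assumes "\<And>i. i < n \<Longrightarrow> computes p (Cell (Num i) (s (Suc i))) (s i) B"
  shows "computes (For p) (Cell (Num n) (s n)) (Cell (Num 0) (s 0)) (n * (B + 12) + 2)"
  using assms
proof (induction n)
  case 0
  show ?case by (rule computes_weaken[OF realizes_For_0]) auto
next
  case (Suc n)
  have "realizes (For p) (Cell (Num (Suc n)) (s (Suc n)))
    (bind_pmf (return_pmf (s n)) (\<lambda>_. return_pmf (Cell (Num 0) (s 0)))) (B + (n * (B + 12) + 2) + 12)"
    by (rule realizes_For_Suc) (use Suc in auto)
  then show ?case by (rule realizes_weaken) (auto simp: bind_return_pmf)
qed

text \<open>Together with \<open>runs_within_of_realizes\<close> this translates between the
  official cost notion and \<open>realizes\<close>: a run that comes from a \<open>pmf\<close> is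
  lossless, and a bound on its whole support is a worst-case bound. The polynomial bound is real,
  whereas costs in \<open>realizes\<close> are natural numbers, hence
  \<open>r \<le> real B\<close>.\<close>

lemma realizes_of_runs_within:
  assumes "runs_within p v r" "output_dist p v = spmf_of_pmf D" "r \<le> real B"
  shows "realizes p v D B"
proof -
  obtain R where R: "run p v = spmf_of_pmf R"
    using assms(1) by (auto simp: runs_within_def lossless_spmf_conv_spmf_of_pmf)
  have "spmf_of_pmf (map_pmf fst R) = spmf_of_pmf D"
    using assms(2) by (simp add: output_dist_def R)
  then have "map_pmf fst R = D" by (metis pmf_eqI spmf_spmf_of_pmf)
  moreover have "snd x \<le> B" if "x \<in> set_pmf R" for x
  proof -
    have "real (snd x) \<le> r" using assms(1) that by (auto simp: runs_within_def R)
    then show ?thesis using assms(3) by linarith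
  qed
  ultimately show ?thesis unfolding realizes_def using R by blast
qed

lemma runs_within_of_realizes:
  assumes "realizes p v D B" "real B \<le> r"
  shows "runs_within p v r" "output_dist p v = spmf_of_pmf D"
proof -
  obtain R where R: "run p v = spmf_of_pmf R" "map_pmf fst R = D" "\<forall>x\<in>set_pmf R. snd x \<le> B"
    using assms(1) unfolding realizes_def by blast
  have "real t \<le> r" if "(y, t) \<in> set_pmf R" for y t
    using R(3) that assms(2) by (force intro: order_trans[of _ "real B"])
  then show "runs_within p v r" by (auto simp: runs_within_def R(1))
  show "output_dist p v = spmf_of_pmf D" by (simp add: output_dist_def R(1) R(2)[symmetric])
qed

section \<open>Deterministic subprograms\<close>

definition Drop :: prog where
  "Drop = Seq (For (Seq Snd Snd)) Snd"

definition Nth :: prog where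
  "Nth = Seq Drop Fst"

text \<open>Since \<open>snd_val\<close> and \<open>fst_val\<close> send a number to
  \<open>Num 0\<close>, reading past the end of a list is harmless and yields \<open>Num 0\<close>.
  The programs rely on this instead of testing lengths.\<close>

definition drop_val :: "nat \<Rightarrow> val \<Rightarrow> val" where
  "drop_val i v = (snd_val ^^ i) v"

definition nth_val :: "nat \<Rightarrow> val \<Rightarrow> val" where
  "nth_val i v = fst_val (drop_val i v)"

lemma computes_Drop: "computes Drop (Cell (Num i) v) (drop_val i v) (i * 15 + 4)"
proof -
  have "computes (For (Seq Snd Snd)) (Cell (Num i) (drop_val (i - i) v)) (Cell (Num 0) (drop_val (i - 0) v)) (i * (3 + 12) + 2)"
  proof (rule computes_For[where s = "\<lambda>j. drop_val (i - j) v"])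
    fix j assume "j < i"
    then have "i - j = Suc (i - Suc j)" by simp
    then have "snd_val (drop_val (i - Suc j) v) = drop_val (i - j) v"
      by (simp add: drop_val_def)
    moreover have "computes (Seq Snd Snd) (Cell (Num j) (drop_val (i - Suc j) v)) (snd_val (drop_val (i - Suc j) v)) 3"
      by (rule computes_weaken, (rule computes_Snd computes_Seq computes_Snd_val)+, simp_all)
    ultimately show "computes (Seq Snd Snd) (Cell (Num j) (drop_val (i - Suc j) v)) (drop_val (i - j) v) 3"
      by simp
  qed
  then have "computes (For (Seq Snd Snd)) (Cell (Num i) v) (Cell (Num 0) (drop_val i v)) (i * (3 + 12) + 2)"
    by (simp add: drop_val_def)
  from computes_Seq[OF this computes_Snd] show ?thesis
    unfolding Drop_def by (rule computes_weaken) auto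
qed

lemma computes_Nth: "computes Nth (Cell (Num i) v) (nth_val i v) (i * 15 + 6)"
  unfolding Nth_def nth_val_def
  by (rule computes_weaken[OF computes_Seq[OF computes_Drop computes_Fst_val]]) auto

section \<open>Bounded search in a filling\<close>

definition Search :: "prog \<Rightarrow> prog" where
  "Search p = Seq (Fork Fst (Fork Snd (Const (Num 0))))
     (Seq (For (Fork (Seq Snd Fst)
        (Seq (Fork (Seq (Fork Fst (Seq Snd Fst)) p) (Seq Snd Snd)) (Cond Fst Fst Snd))))
     (Seq Snd Snd))"

text \<open>All indices are scanned downwards without early exit, and a nonzero answer overwrites
  the result so far; \<open>r i\<close> is the result after the indices from \<open>i\<close> on.
  All nonzero answers are the same value \<open>w\<close>, so the order of the scan does not
  influence the outcome.\<close>

lemma computes_Search: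
  assumes p: "\<And>i. i < n \<Longrightarrow> computes p (Cell (Num i) v) (g i) B"
    and g: "\<And>i. i < n \<Longrightarrow> g i = Num 0 \<or> g i = w"
  shows "computes (Search p) (Cell (Num n) v) (if \<exists>i<n. g i = w then w else Num 0) (n * (B + 34) + 18)"
proof -
  define r where "r i = (if \<exists>j. i \<le> j \<and> j < n \<and> g j = w then w else Num 0)" for i
  let ?body = "Fork (Seq Snd Fst)
        (Seq (Fork (Seq (Fork Fst (Seq Snd Fst)) p) (Seq Snd Snd)) (Cond Fst Fst Snd))"
  have body: "computes ?body (Cell (Num i) (Cell v (r (Suc i)))) (Cell v (r i)) (B + 22)" if i: "i < n" for i
  proof -
    have r: "r i = (if g i = Num 0 then r (Suc i) else g i)"
    proof -
      have "(\<exists>j. i \<le> j \<and> j < n \<and> g j = w) \<longleftrightarrow> g i = w \<or> (\<exists>j. Suc i \<le> j \<and> j < n \<and> g j = w)"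
        using i by (metis Suc_leD le_eq_less_or_eq Suc_leI order_refl)
      then show ?thesis using g[OF i] by (auto simp: r_def)
    qed
    have "computes (Seq (Fork (Seq (Fork Fst (Seq Snd Fst)) p) (Seq Snd Snd)) (Cond Fst Fst Snd))
      (Cell (Num i) (Cell v (r (Suc i)))) (if g i = Num 0 then r (Suc i) else g i)
      ((((1 + (1 + 1 + 1) + 1) + B + 1) + (1 + 1 + 1) + 1) + (1 + (1 + 1) + 1) + 1)"
      by (rule p[OF i] computes_Cond computes_intros)+
    then have "computes (Seq (Fork (Seq (Fork Fst (Seq Snd Fst)) p) (Seq Snd Snd)) (Cond Fst Fst Snd))
      (Cell (Num i) (Cell v (r (Suc i)))) (r i) (B + 16)"
      by (rule computes_weaken) (auto simp: r)
    note R = this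
    show ?thesis by (rule computes_weaken, (rule R computes_intros)+) auto
  qed
  have "computes (For ?body) (Cell (Num n) (Cell v (r n))) (Cell (Num 0) (Cell v (r 0))) (n * (B + 22 + 12) + 2)"
    by (rule computes_For[where s = "\<lambda>i. Cell v (r i)"]) (rule body)
  moreover have "r n = Num 0" by (auto simp: r_def)
  ultimately have F: "computes (For ?body) (Cell (Num n) (Cell v (Num 0))) (Cell (Num 0) (Cell v (r 0))) (n * (B + 22 + 12) + 2)"
    by simp
  show ?thesis
    unfolding Search_def
    by (rule computes_weaken, (rule F computes_intros)+) (auto simp: r_def algebra_simps)
qed

text \<open>Subtraction is truncated, so it is taken in both directions; the sum vanishes exactly
  for equal numbers.\<close>

definition Neq :: prog where
  "Neq = Seq (Fork Sub (Seq (Fork Snd Fst) Sub)) Add"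

lemma computes_Neq: "computes Neq (Cell x (Num b)) (Num ((num_of x - b) + (b - num_of x))) 9"
  unfolding Neq_def
  by (rule computes_weaken, (rule computes_Sub_val computes_intros)+) auto

text \<open>Only the first \<open>j\<close> entries are inspected. In an increasing list of positive
  numbers the entry at index \<open>i\<close> exceeds \<open>i\<close>, so \<open>j\<close> cannot
  occur later, and the cost does not depend on the size of the box.\<close>

definition Has :: prog where
  "Has = Seq (Fork Fst Skip) (Search (Cond
     (Seq (Fork (Seq (Fork Fst (Seq Snd Snd)) Nth) (Seq Snd Fst)) Neq) (Const (Num 0)) (Const (Num 1))))"

lemma computes_Has:
  "computes Has (Cell (Num j) v) (if \<exists>i<j. num_of (nth_val i v) = j then Num 1 else Num 0)
     (j * (15 * j + 80) + 30)"
proof -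
  let ?g = "\<lambda>i. if num_of (nth_val i v) = j then Num 1 else Num 0"
  have "computes (Search (Cond
     (Seq (Fork (Seq (Fork Fst (Seq Snd Snd)) Nth) (Seq Snd Fst)) Neq) (Const (Num 0)) (Const (Num 1))))
     (Cell (Num j) (Cell (Num j) v)) (if \<exists>i<j. ?g i = Num 1 then Num 1 else Num 0) (j * (15 * j + 40 + 34) + 18)"
  proof (rule computes_Search)
    fix i assume "i < j"
    show "computes (Cond (Seq (Fork (Seq (Fork Fst (Seq Snd Snd)) Nth) (Seq Snd Fst)) Neq) (Const (Num 0)) (Const (Num 1)))
      (Cell (Num i) (Cell (Num j) v)) (?g i) (15 * j + 40)"
      by (rule computes_weaken, (rule computes_Cond computes_Nth computes_Neq computes_intros)+)
         (use \<open>i < j\<close> in auto)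
  qed auto
  note S = this
  show ?thesis
    unfolding Has_def by (rule computes_weaken, (rule S computes_intros)+) (auto simp: algebra_simps)
qed

definition Member :: prog where
  "Member = Seq (Fork (Seq Snd Fst) (Seq (Fork (Seq Fst Snd) (Seq (Fork (Seq Fst Fst) (Seq Snd Snd)) Nth)) Nth)) Has"

text \<open>Rows and columns are counted from 0 here, so that the box is \<open>(r + 1, c + 1)\<close>.\<close>

definition member_val :: "nat \<Rightarrow> val \<Rightarrow> nat \<Rightarrow> nat \<Rightarrow> bool" where
  "member_val j v r c \<longleftrightarrow> (\<exists>i<j. num_of (nth_val i (nth_val c (nth_val r v))) = j)"

lemma computes_Member:
  assumes "r \<le> m" "c \<le> m" "j \<le> m" "1 \<le> m"
  shows "computes Member (Cell (Cell (Num r) (Num c)) (Cell (Num j) v))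
    (if member_val j v r c then Num 1 else Num 0) (200 * m ^ 2)"
proof -
  define M where "M = m ^ 2"
  have "j * j \<le> M" "m \<le> M" "1 \<le> M"
    using assms by (auto simp: M_def power2_eq_square intro: mult_le_mono)
  note le = this
  show ?thesis
    unfolding Member_def member_val_def M_def[symmetric]
    by (rule computes_weaken, (rule computes_Nth computes_Has computes_intros)+)
       (use assms le in \<open>auto simp: algebra_simps\<close>)
qed

definition Find :: prog where
  "Find = Seq (Fork Fst Skip) (Search (Seq (Fork (Seq Snd Fst) Skip) (Search
     (Cond (Seq (Fork (Fork (Seq Snd Fst) Fst) (Seq Snd Snd)) Member) (Fork (Seq Snd Fst) Fst) (Const (Num 0))))))"

text \<open>The search covers only the \<open>j\<close> by \<open>j\<close> corner, where a tableau
  must have its value \<open>j\<close> (see \<open>SVT_box_le\<close>). The candidate box may fail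
  to be in the corner or to contain \<open>j\<close>; the answer \<open>Num 0\<close> in that case
  is what \<open>FindK\<close> uses to recognize a missing value.\<close>

lemma computes_Find:
  assumes j: "j \<le> m" and m: "1 \<le> m"
    and unique: "\<And>r c. r < j \<Longrightarrow> c < j \<Longrightarrow> r \<noteq> r0 \<or> c \<noteq> c0 \<Longrightarrow> \<not> member_val j v r c"
  shows "computes Find (Cell (Num j) v)
    (if r0 < j \<and> c0 < j \<and> member_val j v r0 c0 then Cell (Num r0) (Num c0) else Num 0) (400 * m ^ 4)"
proof -
  let ?w = "Cell (Num r0) (Num c0)"
  let ?g = "\<lambda>r c. if member_val j v r c then Cell (Num r) (Num c) else Num 0"
  define h where "h r = (if \<exists>c<j. ?g r c = ?w then ?w else Num 0)" for r
  have g: "?g r c = Num 0 \<or> ?g r c = ?w" if "r < j" "c < j" for r c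
    using unique[OF that] by auto
  have h: "h r = Num 0 \<or> h r = ?w" for r
    by (simp add: h_def)
  have "h r = ?w \<longleftrightarrow> r = r0 \<and> c0 < j \<and> member_val j v r0 c0" for r
    unfolding h_def by (auto split: if_splits)
  then have res: "(\<exists>r<j. h r = ?w) \<longleftrightarrow> r0 < j \<and> c0 < j \<and> member_val j v r0 c0"
    by auto
  let ?check = "Cond (Seq (Fork (Fork (Seq Snd Fst) Fst) (Seq Snd Snd)) Member) (Fork (Seq Snd Fst) Fst) (Const (Num 0))"
  have cell: "computes ?check (Cell (Num c) (Cell (Num r) (Cell (Num j) v))) (?g r c) (200 * m ^ 2 + 30)"
    if "r < j" "c < j" for r c
  proof -
    have M: "computes Member (Cell (Cell (Num r) (Num c)) (Cell (Num j) v))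
      (if member_val j v r c then Num 1 else Num 0) (200 * m ^ 2)"
      by (rule computes_Member) (use that j m in auto)
    show ?thesis
      by (rule computes_weaken, (rule M computes_Cond computes_intros)+) auto
  qed
  have row: "computes (Seq (Fork (Seq Snd Fst) Skip) (Search ?check)) (Cell (Num r) (Cell (Num j) v)) (h r)
     (10 + (j * ((200 * m ^ 2 + 30) + 34) + 18))" if "r < j" for r
  proof -
    have "computes (Search ?check) (Cell (Num j) (Cell (Num r) (Cell (Num j) v))) (h r) (j * ((200 * m ^ 2 + 30) + 34) + 18)"
      unfolding h_def by (rule computes_Search[OF cell g]) (use that in auto)
    note S = this
    show ?thesis
      by (rule computes_weaken, (rule S computes_intros)+, rule refl, simp)
  qed
  let ?T = "j * ((10 + (j * ((200 * m ^ 2 + 30) + 34) + 18)) + 34) + 18"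
  have S: "computes (Search (Seq (Fork (Seq Snd Fst) Skip) (Search ?check))) (Cell (Num j) (Cell (Num j) v))
      (if \<exists>r<j. h r = ?w then ?w else Num 0) ?T"
    by (rule computes_Search[OF row h])
  have "?T \<le> m * ((10 + (m * ((200 * m ^ 2 + 30) + 34) + 18)) + 34) + 18"
    using j by (intro add_mono mult_le_mono order_refl)
  also have "\<dots> = 200 * m ^ 4 + 64 * m ^ 2 + 62 * m + 18"
    by (simp add: algebra_simps power4_eq_xxxx power2_eq_square)
  also have "64 * m ^ 2 \<le> 64 * m ^ 4" "62 * m \<le> 62 * m ^ 4" "18 \<le> 18 * m ^ 4"
    using m by (auto intro!: power_increasing self_le_power)
  then have "200 * m ^ 4 + 64 * m ^ 2 + 62 * m + 18 \<le> 344 * m ^ 4" by linarith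
  finally have "?T \<le> 344 * m ^ 4" .
  moreover have "10 \<le> 10 * m ^ 4" using m by auto
  ultimately have T: "1 + 1 + 1 + ?T + 1 \<le> 400 * m ^ 4" by linarith
  show ?thesis
    unfolding Find_def
    by (rule computes_weaken, (rule S computes_intros)+, simp only: res, rule T)
qed

section \<open>Updating immutable lists\<close>

definition Put :: prog where
  "Put = Seq (Fork Fst (Fork (Seq Snd Fst) (Fork (Seq Snd Snd) (Seq (Seq (Fork Fst (Seq Snd Fst)) Drop) Snd))))
     (Seq (For (Fork (Seq Snd Fst) (Fork (Seq (Fork Fst (Seq Snd Fst)) Nth) (Seq Snd Snd)))) (Seq Snd Snd))"

fun put_val :: "nat \<Rightarrow> val \<Rightarrow> val \<Rightarrow> val" where
  "put_val 0 v x = Cell x (snd_val v)"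
| "put_val (Suc i) v x = Cell (fst_val v) (put_val i (snd_val v) x)"

lemma drop_val_Suc: "drop_val (Suc i) v = snd_val (drop_val i v)" "drop_val (Suc i) v = drop_val i (snd_val v)"
  by (auto simp: drop_val_def funpow_swap1)

lemma put_val_drop:
  "i < r \<Longrightarrow> put_val (r - i) (drop_val i v) x = Cell (nth_val i v) (put_val (r - Suc i) (drop_val (Suc i) v) x)"
  using put_val.simps(2)[of "r - Suc i"] by (simp add: nth_val_def drop_val_Suc(1) Suc_diff_Suc)

text \<open>Trees are immutable: the tail behind position \<open>r\<close> is shared, and only the
  \<open>r\<close> cells in front of it are rebuilt, from the last to the first. The cost is
  quadratic in \<open>r\<close> because each entry is fetched by walking from the start, but it is
  independent of the length of the list.\<close>

lemma computes_Put: "computes Put (Cell (Num r) (Cell v x)) (put_val r v x) (50 * (r + 1) ^ 2)"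
proof -
  let ?body = "Fork (Seq Snd Fst) (Fork (Seq (Fork Fst (Seq Snd Fst)) Nth) (Seq Snd Snd))"
  let ?s = "\<lambda>i. Cell v (put_val (r - i) (drop_val i v) x)"
  have body: "computes ?body (Cell (Num i) (?s (Suc i))) (?s i) (15 * r + 25)" if "i < r" for i
    unfolding put_val_drop[OF that]
    by (rule computes_weaken, (rule computes_Nth computes_intros)+)
       (use that in auto)
  have "computes (For ?body) (Cell (Num r) (?s r)) (Cell (Num 0) (?s 0)) (r * (15 * r + 25 + 12) + 2)"
    by (rule computes_For) (rule body)
  then have F: "computes (For ?body) (Cell (Num r) (Cell v (Cell x (snd_val (drop_val r v)))))
    (Cell (Num 0) (Cell v (put_val r v x))) (r * (15 * r + 25 + 12) + 2)"
    by (simp add: drop_val_def)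
  have D: "computes (Seq (Fork Fst (Seq Snd Fst)) Drop) (Cell (Num r) (Cell v x)) (drop_val r v) (5 + (r * 15 + 4) + 1)"
    by (rule computes_weaken, (rule computes_Drop computes_intros)+) auto
  show ?thesis
    unfolding Put_def
    by (rule computes_weaken, (rule F D computes_intros computes_Snd_val)+) (auto simp: power2_eq_square algebra_simps)
qed

text \<open>The new value is put at the head of the list of its box. It will be smaller than every
  value present, so the list stays increasing without any comparison.\<close>

definition Insert :: prog where
  "Insert = Seq (Fork Skip (Seq (Fork (Seq Fst Fst) (Seq Snd Snd)) Nth))
     (Seq (Fork (Seq Fst (Seq Fst Fst)) (Fork (Seq Fst (Seq Snd Snd))
       (Seq (Fork (Seq Fst (Seq Fst Snd)) (Fork Snd (Fork (Seq Fst (Seq Snd Fst)) (Seq (Fork (Seq Fst (Seq Fst Snd)) Snd) Nth)))) Put)))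
     Put)"

definition insert_val :: "nat \<Rightarrow> nat \<Rightarrow> nat \<Rightarrow> val \<Rightarrow> val" where
  "insert_val r c k v = put_val r v (put_val c (nth_val r v) (Cell (Num k) (nth_val c (nth_val r v))))"

lemma computes_Insert:
  assumes "r < m" "c < m"
  shows "computes Insert (Cell (Cell (Num r) (Num c)) (Cell (Num k) v)) (insert_val r c k v) (300 * m ^ 2)"
proof -
  have "(r + 1) ^ 2 \<le> m ^ 2" "(c + 1) ^ 2 \<le> m ^ 2" "m \<le> m ^ 2" "1 \<le> m ^ 2"
    using assms by (auto intro!: power_mono simp: self_le_power)
  note le = this
  show ?thesis
    unfolding Insert_def insert_val_def
    by (rule computes_weaken, (rule computes_Nth computes_Put computes_intros)+, rule refl)
       (use assms le in linarith)
qed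

section \<open>Arithmetic by repeated addition and subtraction\<close>

definition Mul :: prog where
  "Mul = Seq (Fork Fst (Fork Snd (Const (Num 0)))) (Seq (For (Fork (Seq Snd Fst) (Seq Snd Add))) (Seq Snd Snd))"

text \<open>The cost depends on the first factor alone. Every use puts the controlled number there,
  so that the second one may be arbitrarily large.\<close>

lemma computes_Mul: "computes Mul (Cell (Num x) (Num y)) (Num (x * y)) (x * 20 + 14)"
proof -
  have F: "computes (For (Fork (Seq Snd Fst) (Seq Snd Add))) (Cell (Num x) (Cell (Num y) (Num 0)))
    (Cell (Num 0) (Cell (Num y) (Num (x * y)))) (x * (7 + 12) + 2)"
  proof -
    have "computes (For (Fork (Seq Snd Fst) (Seq Snd Add))) (Cell (Num x) (Cell (Num y) (Num ((x - x) * y))))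
    (Cell (Num 0) (Cell (Num y) (Num ((x - 0) * y)))) (x * (7 + 12) + 2)"
    proof (rule computes_For[where s = "\<lambda>i. Cell (Num y) (Num ((x - i) * y))"])
      fix i assume "i < x"
      then have "x - i = Suc (x - Suc i)" by simp
      note eq = this
      show "computes (Fork (Seq Snd Fst) (Seq Snd Add)) (Cell (Num i) (Cell (Num y) (Num ((x - Suc i) * y))))
         (Cell (Num y) (Num ((x - i) * y))) 7"
        by (rule computes_weaken, (rule computes_intros)+) (auto simp: eq)
    qed
    then show ?thesis by simp
  qed
  show ?thesis
    unfolding Mul_def
    by (rule computes_weaken, (rule F computes_intros)+) auto
qed

definition CeilDiv :: prog where
  "CeilDiv = Seq (Fork Snd (Fork Fst (Const (Num 0)))) (Seq
     (While Fst (Fork (Seq (Fork Fst (Seq Snd Fst)) Sub) (Fork (Seq Snd Fst) (Seq (Fork (Seq Snd Snd) (Const (Num 1))) Add))))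
     (Seq Snd Snd))"

text \<open>The two inequalities say that \<open>e\<close> is b/a rounded up. Applied to the error
  parameter \<epsilon> = a/b this is 1/\<epsilon> rounded up. The cost is linear in the quotient, so
  an error parameter given by a fraction with huge terms does no harm.\<close>

lemma computes_CeilDiv:
  assumes a: "0 < a"
  obtains e where "computes CeilDiv (Cell (Num a) (Num b)) (Num e) (e * 30 + 20)"
    "b \<le> e * a" "e * a < b + a"
proof
  define e where "e = (LEAST e. b \<le> e * a)"
  have ex: "b \<le> b * a" using a by simp
  show eb: "b \<le> e * a" unfolding e_def by (rule LeastI, rule ex)
  have less: "i * a < b" if "i < e" for i using not_less_Least[of i "\<lambda>e. b \<le> e * a"] that unfolding e_def by auto
  show "e * a < b + a"
  proof (cases e)
    case (Suc e')
    then show ?thesis using less[of e'] by simp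
  qed (use a in simp)
  let ?p = "Fork (Seq (Fork Fst (Seq Snd Fst)) Sub) (Fork (Seq Snd Fst) (Seq (Fork (Seq Snd Snd) (Const (Num 1))) Add))"
  let ?s = "\<lambda>i. Cell (Num (b - i * a)) (Cell (Num a) (Num i))"
  have "computes (While Fst ?p) (?s 0) (?s e) (e * (1 + 19 + 1) + 1 + 1)"
  proof (rule computes_While)
    show "computes ?p (?s i) (?s (Suc i)) 19" for i
      by (rule computes_weaken, (rule computes_intros)+) auto
    show "Num (b - i * a) \<noteq> Num 0" if "i < e" for i
      using less[OF that] by simp
    show "computes Fst (?s e) (Num 0) 1"
      by (rule computes_weaken, (rule computes_intros)+) (use eb in auto)
  qed (rule computes_Fst)
  then have W: "computes (While Fst ?p) (Cell (Num b) (Cell (Num a) (Num 0))) (?s e) (e * (1 + 19 + 1) + 1 + 1)"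
    by simp
  show "computes CeilDiv (Cell (Num a) (Num b)) (Num e) (e * 30 + 20)"
    unfolding CeilDiv_def
    by (rule computes_weaken, (rule W computes_intros)+) auto
qed

section \<open>Estimating probabilities\<close>

text \<open>A union bound along one random step: the second step has to be controlled only after
  outcomes outside \<open>A\<close>.\<close>

lemma prob_bind_le:
  assumes D: "measure_pmf.prob D A \<le> a" and E: "\<And>x. x \<in> set_pmf D \<Longrightarrow> x \<notin> A \<Longrightarrow> measure_pmf.prob (E x) B \<le> b"
    and b: "0 \<le> b"
  shows "measure_pmf.prob (bind_pmf D E) B \<le> a + b"
proof -
  have "measure_pmf.prob (bind_pmf D E) B = (\<integral>x. measure_pmf.prob (E x) B \<partial>measure_pmf D)"
    by (simp add: measure_pmf_bind measure_pmf.measure_bind[where N = "count_space UNIV"] measure_pmf_in_subprob_algebra)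
  also have "\<dots> \<le> (\<integral>x. indicator A x + b \<partial>measure_pmf D)"
  proof (rule integral_mono_AE)
    show "AE x in measure_pmf D. measure_pmf.prob (E x) B \<le> indicator A x + b"
      using E b by (auto simp: AE_measure_pmf_iff indicator_def intro: order_trans[OF measure_pmf.prob_le_1])
    show "integrable (measure_pmf D) (\<lambda>x. measure_pmf.prob (E x) B)"
      by (rule measure_pmf.integrable_const_bound[where B = 1]) auto
    show "integrable (measure_pmf D) (\<lambda>x. indicator A x + b)"
      by (rule measure_pmf.integrable_const_bound[where B = "1 + b"]) (use b in \<open>auto simp: indicator_def\<close>)
  qed
  also have "\<dots> = measure_pmf.prob D A + b"
    by (subst Bochner_Integration.integral_add)
       (auto intro!: measure_pmf.integrable_const_bound[where B = 1] simp: indicator_def)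
  finally show ?thesis using D by simp
qed

lemma prob_diff_le_tv_dist: "\<bar>measure_pmf.prob p A - measure_pmf.prob q A\<bar> \<le> tv_dist p q"
  unfolding tv_dist_def
proof (rule cSUP_upper)
  show "bdd_above (range (\<lambda>A. \<bar>measure_pmf.prob p A - measure_pmf.prob q A\<bar>))"
  proof (rule bdd_aboveI2)
    fix A show "\<bar>measure_pmf.prob p A - measure_pmf.prob q A\<bar> \<le> 1"
      using measure_pmf.prob_le_1[of p A] measure_pmf.prob_le_1[of q A]
        measure_nonneg[of p A] measure_nonneg[of q A] by linarith
  qed
qed simp

lemma prob_Collect_not: "measure_pmf.prob D {v. P v} = 1 - measure_pmf.prob D {v. \<not> P v}"
proof -
  have "UNIV - {v. \<not> P v} = {v. P v}" by auto
  then show ?thesis using measure_pmf.prob_compl[of "{v. \<not> P v}" D] by simp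
qed

primrec count_pmf :: "'a pmf \<Rightarrow> 'a set \<Rightarrow> nat \<Rightarrow> nat \<Rightarrow> nat pmf" where
  "count_pmf \<Gamma> A 0 c = return_pmf c"
| "count_pmf \<Gamma> A (Suc n) c = bind_pmf \<Gamma> (\<lambda>x. count_pmf \<Gamma> A n (c + of_bool (x \<in> A)))"

text \<open>Of each sample only the membership in \<open>A\<close> matters, which is a Bernoulli
  variable. This makes Hoeffding's inequality for the binomial distribution available.\<close>

lemma count_pmf_binomial:
  "count_pmf \<Gamma> A n c = map_pmf (\<lambda>i. c + i) (binomial_pmf n (measure_pmf.prob \<Gamma> A))"
proof (induction n arbitrary: c)
  case 0
  show ?case by (simp add: binomial_pmf_0)
next
  case (Suc n)
  let ?q = "measure_pmf.prob \<Gamma> A"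
  have "pmf (map_pmf (\<lambda>x. x \<in> A) \<Gamma>) True = ?q"
    by (simp add: pmf_map vimage_def)
  moreover have "pmf (map_pmf (\<lambda>x. x \<in> A) \<Gamma>) False = 1 - ?q"
    by (simp add: pmf_map vimage_def measure_pmf.prob_compl[symmetric] Compl_eq_Diff_UNIV[symmetric] Compl_eq)
  ultimately have b: "map_pmf (\<lambda>x. x \<in> A) \<Gamma> = bernoulli_pmf ?q"
    by (intro pmf_eqI) (case_tac i; simp)
  have "count_pmf \<Gamma> A (Suc n) c = bind_pmf (map_pmf (\<lambda>x. x \<in> A) \<Gamma>) (\<lambda>b. count_pmf \<Gamma> A n (c + of_bool b))"
    by (simp add: bind_map_pmf)
  then show ?case
    unfolding b by (simp add: Suc binomial_pmf_Suc map_bind_pmf bind_map_pmf pair_pmf_def map_pmf_def bind_assoc_pmf bind_return_pmf of_bool_def algebra_simps)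
qed

lemma set_count_pmf: "c' \<in> set_pmf (count_pmf \<Gamma> A n c) \<Longrightarrow> c \<le> c' \<and> c' \<le> c + n"
proof (induction n arbitrary: c)
  case (Suc n)
  then obtain x where "c' \<in> set_pmf (count_pmf \<Gamma> A n (c + of_bool (x \<in> A)))" by auto
  from Suc.IH[OF this] show ?case by (cases "x \<in> A") auto
qed simp

text \<open>The count starts at 1 to keep it positive. This moves the relative frequency by 1/t,
  which is why the deviation is measured against \<open>y + 1 / real t\<close>.\<close>

lemma count_pmf_deviation:
  assumes t: "0 < t" and y: "0 \<le> y"
  shows "measure_pmf.prob (count_pmf \<Gamma> A t 1) {c. y + 1 / real t \<le> \<bar>real c / real t - measure_pmf.prob \<Gamma> A\<bar>}
    \<le> 2 * exp (- 2 * real t * y\<^sup>2)" (is "?L \<le> ?R")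
proof -
  let ?q = "measure_pmf.prob \<Gamma> A"
  interpret binomial_distribution t ?q by unfold_locales simp
  have "?L = measure_pmf.prob (binomial_pmf t ?q) {i. y + 1 / real t \<le> \<bar>real (1 + i) / real t - ?q\<bar>}"
    by (simp add: count_pmf_binomial vimage_def)
  also have "\<dots> \<le> measure_pmf.prob (binomial_pmf t ?q) {i. y \<le> \<bar>real i / real t - ?q\<bar>}"
  proof (rule measure_pmf.finite_measure_mono)
    show "{i. y + 1 / real t \<le> \<bar>real (1 + i) / real t - ?q\<bar>} \<subseteq> {i. y \<le> \<bar>real i / real t - ?q\<bar>}"
    proof clarify
      fix i assume "y + 1 / real t \<le> \<bar>real (1 + i) / real t - ?q\<bar>"
      moreover have "real (1 + i) / real t = 1 / real t + real i / real t" by (simp add: add_divide_distrib)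
      moreover have "0 \<le> 1 / real t" by simp
      ultimately show "y \<le> \<bar>real i / real t - ?q\<bar>" by linarith
    qed
  qed simp
  also have "\<dots> \<le> ?R" using prob_abs_ge'[OF t y] by simp
  finally show ?thesis .
qed

text \<open>
  One estimation step: a class \<open>b\<close> is read off one sample, and its probability under the uniform
  distribution is then estimated from \<open>t\<close> further samples. Classes of probability less than
  \<open>\<theta>\<close> cannot be estimated well, but are unlikely to be selected.
\<close>

lemma class_estimation:
  fixes pos :: "'a \<Rightarrow> 'b" and E :: "'a set"
  defines "p \<equiv> \<lambda>b. real (card {T \<in> E. pos T = b}) / real (card E)"
  assumes E: "finite E" "E \<noteq> {}" and \<Gamma>: "set_pmf \<Gamma> \<subseteq> E" "tv_dist \<Gamma> (pmf_of_set E) \<le> \<delta>"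
    and P: "pos ` E \<subseteq> P" "finite P" and t: "0 < t" and y: "0 \<le> y" and \<theta>: "0 < \<theta>" and \<eta>: "0 < \<eta>"
    and le: "y + 1 / real t + \<delta> \<le> \<eta> * \<theta>"
  shows "measure_pmf.prob (bind_pmf \<Gamma> (\<lambda>T. map_pmf (Pair (pos T)) (count_pmf \<Gamma> {T'. pos T' = pos T} t 1)))
    {(b, c). \<eta> * p b < \<bar>real c / real t - p b\<bar>} \<le> (real (card P) * \<theta> + \<delta>) + 2 * exp (- 2 * real t * y\<^sup>2)"
proof (rule prob_bind_le)
  have U: "measure_pmf.prob (pmf_of_set E) A = real (card (E \<inter> A)) / real (card E)" for A
    using E by (simp add: measure_pmf_of_set)
  have tv: "\<bar>measure_pmf.prob \<Gamma> A - measure_pmf.prob (pmf_of_set E) A\<bar> \<le> \<delta>" for A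
    using prob_diff_le_tv_dist[of \<Gamma> A "pmf_of_set E"] \<Gamma>(2) by linarith
  have cE: "0 < card E" using E by (simp add: card_gt_0_iff)
  let ?A = "{T. p (pos T) < \<theta>}"
  \<comment> \<open>There are at most \<open>card P\<close> rare classes and each has uniform mass
    below \<open>\<theta>\<close>; passing from the uniform distribution to \<open>\<Gamma>\<close>
    costs the bias \<open>\<delta>\<close>.\<close>
  show "measure_pmf.prob \<Gamma> ?A \<le> real (card P) * \<theta> + \<delta>"
  proof -
    have "E \<inter> ?A \<subseteq> (\<Union>b\<in>{b\<in>P. p b < \<theta>}. {T \<in> E. pos T = b})" using P(1) by auto
    then have "card (E \<inter> ?A) \<le> card (\<Union>b\<in>{b\<in>P. p b < \<theta>}. {T \<in> E. pos T = b})"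
      by (rule card_mono[rotated]) (use E P in auto)
    also have "\<dots> \<le> (\<Sum>b\<in>{b\<in>P. p b < \<theta>}. card {T \<in> E. pos T = b})"
      by (rule card_UN_le) (use P in auto)
    finally have "real (card (E \<inter> ?A)) \<le> (\<Sum>b\<in>{b\<in>P. p b < \<theta>}. real (card {T \<in> E. pos T = b}))"
      by (simp flip: of_nat_sum)
    also have "\<dots> \<le> (\<Sum>b\<in>{b\<in>P. p b < \<theta>}. \<theta> * real (card E))"
      using cE by (intro sum_mono) (auto simp: p_def field_simps)
    also have "\<dots> \<le> real (card P) * (\<theta> * real (card E))"
      using \<theta> P(2) by (auto intro!: mult_right_mono card_mono)
    finally have "measure_pmf.prob (pmf_of_set E) ?A \<le> real (card P) * \<theta>"
      unfolding U using cE by (simp add: field_simps)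
    then show ?thesis using tv[of ?A] by linarith
  qed
  fix T assume T: "T \<in> set_pmf \<Gamma>" "T \<notin> ?A"
  let ?q = "measure_pmf.prob \<Gamma> {T'. pos T' = pos T}"
  have q: "\<bar>?q - p (pos T)\<bar> \<le> \<delta>"
  proof -
    have "E \<inter> {T'. pos T' = pos T} = {T' \<in> E. pos T' = pos T}" by auto
    then show ?thesis using tv[of "{T'. pos T' = pos T}"] by (simp add: U p_def)
  qed
  have "measure_pmf.prob (map_pmf (Pair (pos T)) (count_pmf \<Gamma> {T'. pos T' = pos T} t 1))
      {(b, c). \<eta> * p b < \<bar>real c / real t - p b\<bar>}
    = measure_pmf.prob (count_pmf \<Gamma> {T'. pos T' = pos T} t 1) {c. \<eta> * p (pos T) < \<bar>real c / real t - p (pos T)\<bar>}"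
    by (simp add: vimage_def)
  \<comment> \<open>The samples estimate \<open>?q\<close>, the probability of the class under the
    biased sampler, which is within \<open>\<delta>\<close> of the wanted one. As the class is not
    rare, the admissible error is at least \<open>\<eta> * \<theta>\<close>, enough for the
    fluctuation \<open>y\<close>, the shift 1/t and the bias.\<close>
  also have "\<dots> \<le> measure_pmf.prob (count_pmf \<Gamma> {T'. pos T' = pos T} t 1) {c. y + 1 / real t \<le> \<bar>real c / real t - ?q\<bar>}"
  proof (rule measure_pmf.finite_measure_mono)
    have "\<eta> * \<theta> \<le> \<eta> * p (pos T)" using T(2) \<eta> by (intro mult_left_mono) auto
    then show "{c. \<eta> * p (pos T) < \<bar>real c / real t - p (pos T)\<bar>} \<subseteq> {c. y + 1 / real t \<le> \<bar>real c / real t - ?q\<bar>}"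
      using le q by auto
  qed simp
  also have "\<dots> \<le> 2 * exp (- 2 * real t * y\<^sup>2)"
    by (rule count_pmf_deviation[OF t y])
  finally show "measure_pmf.prob (map_pmf (Pair (pos T)) (count_pmf \<Gamma> {T'. pos T' = pos T} t 1))
      {(b, c). \<eta> * p b < \<bar>real c / real t - p b\<bar>} \<le> 2 * exp (- 2 * real t * y\<^sup>2)" .
qed simp

text \<open>The constants are found backwards from a failure budget of 1/(4k) per stage. With
  \<open>\<theta>\<close>, the at most k^2 boxes contribute 1/(16k). The product
  \<open>\<eta> * \<theta>\<close> is at least 1/(32 k^4 e); \<open>y\<close> is a quarter of this
  and leaves room for shift and bias. Then 2 t y^2 = 16k, and exp(-16k) is at most 1/(16k), so the
  Hoeffding term is at most 1/(8k).\<close>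

lemma sample_size_bound:
  fixes k e :: nat and \<epsilon> :: real
  assumes k: "1 \<le> k" and \<epsilon>: "0 < \<epsilon>" "1 \<le> \<epsilon> * real e"
  defines "t \<equiv> 131072 * k ^ 9 * e ^ 2" and "\<theta> \<equiv> 1 / (16 * real k ^ 3)" and "\<eta> \<equiv> \<epsilon> / (2 * real k)"
    and "y \<equiv> 1 / (128 * real k ^ 4 * real e)"
  shows "0 < t" "y + 1 / real t + 1 / real t \<le> \<eta> * \<theta>"
    "real (k * k) * \<theta> + 1 / real t + 2 * exp (- 2 * real t * y\<^sup>2) \<le> 1 / (4 * real k)"
proof -
  have e: "1 \<le> e" using \<epsilon> by (cases e) auto
  show t0: "0 < t" using k e by (simp add: t_def)
  have k1: "1 \<le> real k" "1 \<le> real e" using k e by auto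
  have "k ^ 4 * e ^ 1 \<le> k ^ 9 * e ^ 2"
    using k e by (intro mult_le_mono power_increasing) auto
  then have "131072 * (k ^ 4 * e) \<le> t" unfolding t_def by (simp add: mult.assoc)
  then have A: "131072 * (real k ^ 4 * real e) \<le> real t"
    using of_nat_mono[where 'a = real] by fastforce
  \<comment> \<open>Everything is measured in the units \<open>a\<close> = 1/(k^4 e) and
    \<open>b\<close> = 1/k, so that the two final estimates become linear.\<close>
  define Q where "Q = real k ^ 4"
  have Q: "0 < Q" "real k \<le> Q" unfolding Q_def using k1 by (auto intro: self_le_power)
  define a where "a = 1 / (Q * real e)"
  have "1 / real t \<le> 1 / (131072 * (Q * real e))"
    by (rule divide_left_mono[OF A[folded Q_def]]) (use Q k1 t0 in auto)
  then have inv: "1 / real t \<le> a / 131072" by (simp add: a_def)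
  define b where "b = 1 / real k"
  have "real k * 1 \<le> Q * real e" using Q k1 by (intro mult_mono) auto
  then have "a \<le> b" unfolding a_def b_def using k1 by (intro divide_left_mono) auto
  then have inv': "1 / real t \<le> b / 131072" using inv by linarith
  have y: "y = a / 128" by (simp add: y_def a_def Q_def)
  have a0: "0 < a" using Q k1 by (simp add: a_def)
  have Qk: "Q = real k * real k ^ 3" by (simp add: Q_def eval_nat_numeral)
  have "\<eta> * \<theta> = \<epsilon> / Q / 32"
    by (simp add: \<eta>_def \<theta>_def Qk)
  moreover have "a = 1 / real e / Q" by (simp add: a_def)
  moreover have "1 / real e / Q \<le> \<epsilon> / Q"
    using \<epsilon> Q k1 by (intro divide_right_mono) (auto simp: field_simps)
  ultimately have "a \<le> \<epsilon> / Q" by simp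
  then have "a / 32 \<le> \<epsilon> / Q / 32" by (rule divide_right_mono) simp
  with \<open>\<eta> * \<theta> = \<epsilon> / Q / 32\<close> have "a / 32 \<le> \<eta> * \<theta>" by simp
  then show "y + 1 / real t + 1 / real t \<le> \<eta> * \<theta>" using inv y a0 by linarith
  have "real k ^ 9 = Q * Q * real k" by (simp add: Q_def eval_nat_numeral)
  then have "real t * y\<^sup>2 = 131072 * (Q * Q * real k) * (real e)\<^sup>2 * (1 / (Q * real e) / 128)\<^sup>2"
    unfolding y a_def by (simp add: t_def)
  also have "\<dots> = 8 * real k"
    using k1 Q by (simp add: field_simps power2_eq_square)
  finally have "exp (- 2 * real t * y\<^sup>2) = 1 / exp (16 * real k)"
    by (simp add: exp_minus field_simps)
  also have "\<dots> \<le> 1 / (16 * real k)"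
  proof (rule divide_left_mono)
    show "16 * real k \<le> exp (16 * real k)" using exp_ge_add_one_self[of "16 * real k"] by linarith
  qed (use k1 in auto)
  finally have C: "2 * exp (- 2 * real t * y\<^sup>2) \<le> b / 8" by (simp add: b_def)
  have D: "real (k * k) * \<theta> = b / 16"
    using k1 by (simp add: \<theta>_def b_def field_simps power3_eq_cube)
  have "0 < b" using k1 by (simp add: b_def)
  then have "real (k * k) * \<theta> + 1 / real t + 2 * exp (- 2 * real t * y\<^sup>2) \<le> b / 4"
    using C D inv' by linarith
  then show "real (k * k) * \<theta> + 1 / real t + 2 * exp (- 2 * real t * y\<^sup>2) \<le> 1 / (4 * real k)"
    by (simp add: b_def)
qed

text \<open>The total error after k stages. Bernoulli's inequality gives (1 - \<eta>)^k \<ge> 1 -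
  \<epsilon>/2. The lower bound then follows from (1 - \<eta>)(1 + \<eta>) \<le> 1, and the upper
  one from (1 + \<epsilon>)(1 - \<epsilon>/2) \<ge> 1, which holds because \<epsilon> \<le>
  1.\<close>

lemma power_error_bounds:
  fixes \<epsilon> :: real and k :: nat
  assumes \<epsilon>: "0 < \<epsilon>" "\<epsilon> \<le> 1" and k: "1 \<le> k"
  defines "\<eta> \<equiv> \<epsilon> / (2 * real k)"
  shows "1 - \<epsilon> \<le> 1 / (1 + \<eta>) ^ k" "1 / (1 - \<eta>) ^ k \<le> 1 + \<epsilon>"
proof -
  have \<eta>: "0 < \<eta>" "\<eta> \<le> 1 / 2" "real k * \<eta> = \<epsilon> / 2"
    using \<epsilon> k by (auto simp: \<eta>_def field_simps)
  have "(1 - \<eta>) * (1 + \<eta>) \<le> 1" using \<eta> by (simp add: algebra_simps)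
  then have "(1 - \<eta>) ^ k * (1 + \<eta>) ^ k \<le> 1"
    unfolding power_mult_distrib[symmetric] using \<eta> by (intro power_le_one) auto
  moreover have B: "1 - \<epsilon> / 2 \<le> (1 - \<eta>) ^ k"
    using Bernoulli_inequality[of "- \<eta>" k] \<eta> by simp
  moreover have "(1 - \<epsilon> / 2) * (1 + \<eta>) ^ k \<le> (1 - \<eta>) ^ k * (1 + \<eta>) ^ k"
    using B \<eta>(1) by (intro mult_right_mono) auto
  ultimately have "(1 - \<epsilon> / 2) * (1 + \<eta>) ^ k \<le> 1" by linarith
  moreover have "(1 - \<epsilon>) * (1 + \<eta>) ^ k \<le> (1 - \<epsilon> / 2) * (1 + \<eta>) ^ k"
    using \<epsilon> \<eta>(1) by (intro mult_right_mono) auto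
  ultimately have "(1 - \<epsilon>) * (1 + \<eta>) ^ k \<le> 1" by linarith
  then show "1 - \<epsilon> \<le> 1 / (1 + \<eta>) ^ k" using \<eta>(1) by (simp add: field_simps)
  have "1 \<le> (1 + \<epsilon>) * (1 - \<epsilon> / 2)" using \<epsilon> by (simp add: algebra_simps)
  also have "\<dots> \<le> (1 + \<epsilon>) * (1 - \<eta>) ^ k" using B \<epsilon> by (intro mult_left_mono) auto
  finally show "1 / (1 - \<eta>) ^ k \<le> 1 + \<epsilon>" using \<eta> by (simp add: field_simps)
qed

section \<open>Extensions of pre-tableaux\<close>

lemma diagram_down:
  assumes "partition lam" "(r, c) \<in> diagram lam" "1 \<le> r'" "r' \<le> r" "1 \<le> c'" "c' \<le> c"
  shows "(r', c') \<in> diagram lam"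
proof -
  have "lam ! (r - 1) \<le> lam ! (r' - 1)"
  proof (cases "r' = r")
    case False
    then have "r' - 1 < r - 1" "r - 1 < length lam" using assms by (auto simp: diagram_def)
    then show ?thesis using assms(1) unfolding partition_def sorted_wrt_iff_nth_less by auto
  qed simp
  then show ?thesis using assms by (auto simp: diagram_def)
qed

lemma finite_diagram: "finite (diagram lam)"
proof (rule finite_subset)
  show "diagram lam \<subseteq> {..length lam} \<times> {..Max (set lam)}"
    by (auto simp: diagram_def intro!: order_trans[OF _ Max_ge])
qed simp

lemma finite_SVT: "finite (SVT lam N)"
proof (rule finite_subset)
  show "SVT lam N \<subseteq> {T. \<forall>b. (b \<in> diagram lam \<longrightarrow> T b \<in> Pow {1..N}) \<and> (b \<notin> diagram lam \<longrightarrow> T b = {})}"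
    by (auto simp: SVT_def)
  show "finite {T. \<forall>b. (b \<in> diagram lam \<longrightarrow> T b \<in> Pow {1..N}) \<and> (b \<notin> diagram lam \<longrightarrow> T b = {})}"
    by (rule finite_set_of_finite_funs) (auto simp: finite_diagram)
qed

lemma finite_SVT_ext: "finite (SVT_ext lam N S)"
  using finite_SVT by (auto simp: SVT_ext_def)

lemma
  assumes "T \<in> SVT lam N"
  shows SVT_outside: "b \<notin> diagram lam \<Longrightarrow> T b = {}"
    and SVT_nonempty: "b \<in> diagram lam \<Longrightarrow> \<exists>x. x \<in> T b"
    and SVT_values: "v \<in> T b \<Longrightarrow> 1 \<le> v \<and> v \<le> N"
    and SVT_box: "v \<in> T b \<Longrightarrow> b \<in> diagram lam"
    and SVT_ex1: "v \<in> {1..N} \<Longrightarrow> \<exists>!b. b \<in> diagram lam \<and> v \<in> T b"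
proof -
  note T' = assms[unfolded SVT_def mem_Collect_eq]
  note T = T'[THEN conjunct1] T'[THEN conjunct2, THEN conjunct1] T'[THEN conjunct2, THEN conjunct2, THEN conjunct1]
  show "b \<notin> diagram lam \<Longrightarrow> T b = {}" using T(1) by blast
  show "v \<in> {1..N} \<Longrightarrow> \<exists>!b. b \<in> diagram lam \<and> v \<in> T b" using T(3) by (rule bspec)
  show "b \<in> diagram lam \<Longrightarrow> \<exists>x. x \<in> T b" using T by blast
  show box: "v \<in> T b \<Longrightarrow> b \<in> diagram lam" using T(1) by blast
  show "v \<in> T b \<Longrightarrow> 1 \<le> v \<and> v \<le> N" using T(2) box by fastforce
qed

lemma SVT_unique:
  assumes T: "T \<in> SVT lam N" and v: "v \<in> T b" "v \<in> T b'"
  shows "b = b'"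
  using SVT_ex1[OF T, of v] SVT_box[OF T v(1)] SVT_box[OF T v(2)] SVT_values[OF T v(1)] v by auto

text \<open>The definition speaks of selections from all boxes at once. Two given values are
  compared by a selection through both of them that is arbitrary elsewhere.\<close>

lemma SVT_col:
  assumes T: "T \<in> SVT lam N" and b: "(r, c) \<in> diagram lam" "(r', c) \<in> diagram lam" "r < r'"
    and v: "v \<in> T (r, c)" "w \<in> T (r', c)"
  shows "v < w"
proof -
  define g where "g = (\<lambda>b. SOME x. x \<in> T b)((r, c) := v, (r', c) := w)"
  have "\<forall>b\<in>diagram lam. g b \<in> T b"
  proof
    fix b assume "b \<in> diagram lam"
    from someI_ex[OF SVT_nonempty[OF T this]] v show "g b \<in> T b" by (simp add: g_def)
  qed
  then have "g (r, c) < g (r', c)" using T b unfolding SVT_def by blast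
  then show ?thesis using b by (simp add: g_def)
qed

text \<open>Selections increase only weakly along rows; strictness comes from the fact that no value
  occurs in two boxes. Pre-tableaux demand it in this strict form.\<close>

lemma SVT_row:
  assumes T: "T \<in> SVT lam N" and b: "(r, c) \<in> diagram lam" "(r, c') \<in> diagram lam" "c < c'"
    and v: "v \<in> T (r, c)" "w \<in> T (r, c')"
  shows "v < w"
proof -
  define g where "g = (\<lambda>b. SOME x. x \<in> T b)((r, c) := v, (r, c') := w)"
  have "\<forall>b\<in>diagram lam. g b \<in> T b"
  proof
    fix b assume "b \<in> diagram lam"
    from someI_ex[OF SVT_nonempty[OF T this]] v show "g b \<in> T b" by (simp add: g_def)
  qed
  then have "g (r, c) \<le> g (r, c')" using T b unfolding SVT_def by blast
  then have "v \<le> w" using b by (simp add: g_def)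
  moreover have "v \<noteq> w" using SVT_unique[OF T v(1)] v(2) b(3) by auto
  ultimately show ?thesis by simp
qed

text \<open>All boxes above and to the left are nonempty, and values increase strictly from at least
  1 on the way to \<open>(r, c)\<close>. This confines the search for a value to a corner of that
  size.\<close>

lemma SVT_box_le:
  assumes lam: "partition lam" and T: "T \<in> SVT lam N"
  shows "(r, c) \<in> diagram lam \<Longrightarrow> v \<in> T (r, c) \<Longrightarrow> r \<le> v \<and> c \<le> v"
proof -
  have r: "(r, c) \<in> diagram lam \<Longrightarrow> v \<in> T (r, c) \<Longrightarrow> r \<le> v" for r c v
  proof (induction r arbitrary: v)
    case (Suc r)
    show ?case
    proof (cases "r = 0")
      case True
      then show ?thesis using SVT_values[OF T Suc.prems(2)] by simp
    next
      case False
      then have b: "(r, c) \<in> diagram lam"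
        using diagram_down[OF lam Suc.prems(1), of r c] Suc.prems(1) by (auto simp: diagram_def)
      then obtain w where w: "w \<in> T (r, c)" using SVT_nonempty[OF T] by blast
      have "w < v" by (rule SVT_col[OF T b Suc.prems(1) _ w Suc.prems(2)]) simp
      then show ?thesis using Suc.IH[OF b w] by simp
    qed
  qed simp
  have c: "(r, c) \<in> diagram lam \<Longrightarrow> v \<in> T (r, c) \<Longrightarrow> c \<le> v" for r c v
  proof (induction c arbitrary: v)
    case (Suc c)
    show ?case
    proof (cases "c = 0")
      case True
      then show ?thesis using SVT_values[OF T Suc.prems(2)] by simp
    next
      case False
      then have b: "(r, c) \<in> diagram lam"
        using diagram_down[OF lam Suc.prems(1), of r c] Suc.prems(1) by (auto simp: diagram_def)
      then obtain w where w: "w \<in> T (r, c)" using SVT_nonempty[OF T] by blast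
      have "w < v" by (rule SVT_row[OF T b Suc.prems(1) _ w Suc.prems(2)]) simp
      then show ?thesis using Suc.IH[OF b w] by simp
    qed
  qed simp
  show "(r, c) \<in> diagram lam \<Longrightarrow> v \<in> T (r, c) \<Longrightarrow> r \<le> v \<and> c \<le> v" using r c by simp
qed

section \<open>Pre-tableaux as restrictions of tableaux\<close>

lemma Max_less_Min_iff:
  fixes A B :: "nat set"
  assumes "finite A" "finite B" "A \<noteq> {}" "B \<noteq> {}"
  shows "Max A < Min B \<longleftrightarrow> (\<forall>x\<in>A. \<forall>y\<in>B. x < y)"
  using assms by (auto simp: Max_less_iff Min_gr_iff)

text \<open>Conditions (ii) and (iii) for one pair of adjacent boxes, merged and stated elementwise,
  so that \<open>Max\<close> and \<open>Min\<close> of possibly empty sets disappear.\<close>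

definition before :: "filling \<Rightarrow> nat list \<Rightarrow> nat \<times> nat \<Rightarrow> nat \<times> nat \<Rightarrow> bool" where
  "before S lam b b' \<longleftrightarrow> (b \<in> diagram lam \<longrightarrow> b' \<in> diagram lam \<longrightarrow> S b \<noteq> {} \<longrightarrow>
     S b' \<noteq> {} \<and> (\<forall>x\<in>S b. \<forall>y\<in>S b'. x < y))"

lemma pretableau_iff:
  "pretableau lam N k S \<longleftrightarrow>
     (\<forall>b. b \<notin> diagram lam \<longrightarrow> S b = {}) \<and>
     (\<forall>b\<in>diagram lam. S b \<subseteq> {k+1..N}) \<and>
     (\<forall>v\<in>{k+1..N}. \<exists>!b. b \<in> diagram lam \<and> v \<in> S b) \<and>
     (\<forall>r c. before S lam (r, c) (r + 1, c) \<and> before S lam (r, c) (r, c + 1)) \<and>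
     card (empty_boxes lam S) \<le> k"
  (is "?L \<longleftrightarrow> ?R")
\<comment> \<open>The elementwise reading of \<open>Max\<close> and \<open>Min\<close> needs finite
  boxes. They are finite if the values lie in the prescribed interval, and otherwise both sides are
  false.\<close>
proof (cases "\<forall>b\<in>diagram lam. S b \<subseteq> {k+1..N}")
  case True
  then have fin: "b \<in> diagram lam \<Longrightarrow> finite (S b)" for b using finite_subset by blast
  then have iff: "Max (S b) < Min (S b') \<longleftrightarrow> (\<forall>x\<in>S b. \<forall>y\<in>S b'. x < y)"
    if "b \<in> diagram lam" "b' \<in> diagram lam" "S b \<noteq> {}" "S b' \<noteq> {}" for b b'
    using that by (intro Max_less_Min_iff) auto
  have "(\<forall>(r, c)\<in>diagram lam. S (r, c) \<noteq> {} \<longrightarrow>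
        ((r + 1, c) \<in> diagram lam \<longrightarrow> S (r + 1, c) \<noteq> {}) \<and>
        ((r, c + 1) \<in> diagram lam \<longrightarrow> S (r, c + 1) \<noteq> {})) \<and>
     (\<forall>(r, c)\<in>diagram lam. S (r, c) \<noteq> {} \<longrightarrow>
        ((r + 1, c) \<in> diagram lam \<longrightarrow> Max (S (r, c)) < Min (S (r + 1, c))) \<and>
        ((r, c + 1) \<in> diagram lam \<longrightarrow> Max (S (r, c)) < Min (S (r, c + 1)))) \<longleftrightarrow>
     (\<forall>r c. before S lam (r, c) (r + 1, c) \<and> before S lam (r, c) (r, c + 1))"
    (is "(\<forall>(r, c)\<in>_. ?A r c) \<and> (\<forall>(r, c)\<in>_. ?B r c) \<longleftrightarrow> (\<forall>r c. ?C r c)")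
  proof -
    have "(((r, c) \<in> diagram lam \<longrightarrow> ?A r c) \<and> ((r, c) \<in> diagram lam \<longrightarrow> ?B r c)) \<longleftrightarrow> ?C r c" for r c
      using iff[of "(r, c)" "(r + 1, c)"] iff[of "(r, c)" "(r, c + 1)"]
      unfolding before_def by meson
    then show ?thesis by fast
  qed
  then show ?thesis unfolding pretableau_def empty_boxes_def by argo
qed (auto simp: pretableau_def)

lemma pretableau_outside: "pretableau lam N k S \<Longrightarrow> b \<notin> diagram lam \<Longrightarrow> S b = {}"
  unfolding pretableau_def by blast

lemma pretableau_values:
  assumes "pretableau lam N k S" "v \<in> S b"
  shows "k < v" "v \<le> N"
proof -
  have "b \<in> diagram lam" using pretableau_outside[OF assms(1)] assms(2) by blast
  then have "v \<in> {k+1..N}" using assms unfolding pretableau_def by blast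
  then show "k < v" "v \<le> N" by auto
qed

definition restr :: "filling \<Rightarrow> nat \<Rightarrow> filling" where
  "restr T j = (\<lambda>b. T b \<inter> {j<..})"

text \<open>This supplies pre-tableaux without checking the local conditions by hand: cutting any
  tableau off at \<open>j\<close> leaves one.\<close>

lemma pretableau_restr:
  assumes lam: "partition lam" and T: "T \<in> SVT lam N" and j: "j \<le> N"
  shows "pretableau lam N j (restr T j)"
  unfolding pretableau_iff
proof (intro conjI allI ballI impI)
  show "restr T j b = {}" if "b \<notin> diagram lam" for b
    using SVT_outside[OF T that] by (simp add: restr_def)
  have le: "T b \<subseteq> {1..N}" for b
    using SVT_values[OF T, of _ b] by auto
  show "restr T j b \<subseteq> {j+1..N}" if "b \<in> diagram lam" for b
    using le[of b] by (auto simp: restr_def)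
  show "\<exists>!b. b \<in> diagram lam \<and> v \<in> restr T j b" if "v \<in> {j+1..N}" for v
  proof -
    have "\<exists>!b. b \<in> diagram lam \<and> v \<in> T b" by (rule SVT_ex1[OF T]) (use that in auto)
    then show ?thesis using that by (simp add: restr_def)
  qed
  have *: "before (restr T j) lam b b'"
    if less: "\<And>x y. b \<in> diagram lam \<Longrightarrow> b' \<in> diagram lam \<Longrightarrow> x \<in> T b \<Longrightarrow> y \<in> T b' \<Longrightarrow> x < y" for b b'
    unfolding before_def
  proof (intro impI conjI)
    assume b: "b \<in> diagram lam" "b' \<in> diagram lam" "restr T j b \<noteq> {}"
    then obtain x where "x \<in> T b" "j < x" by (auto simp: restr_def)
    moreover obtain y where "y \<in> T b'" using SVT_nonempty[OF T] b by blast
    ultimately show "restr T j b' \<noteq> {}" using less[OF b(1,2), of x y] by (fastforce simp: restr_def)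
    show "\<forall>x\<in>restr T j b. \<forall>y\<in>restr T j b'. x < y"
      using less[OF b(1,2)] by (auto simp: restr_def)
  qed
  show "before (restr T j) lam (r, c) (r + 1, c)" for r c
    by (rule *) (use SVT_col[OF T, of r c "r + 1"] in auto)
  show "before (restr T j) lam (r, c) (r, c + 1)" for r c
    by (rule *) (use SVT_row[OF T, of r c "c + 1"] in auto)
  \<comment> \<open>A box that the restriction empties holds only values up to \<open>j\<close>. One
    value from each such box gives an injection into \<open>{1..j}\<close>.\<close>
  define m where "m b = (SOME x. x \<in> T b)" for b
  have m: "m b \<in> T b" if "b \<in> diagram lam" for b
    unfolding m_def by (rule someI_ex[OF SVT_nonempty[OF T that]])
  have "card (empty_boxes lam (restr T j)) \<le> card {1..j}"
  proof (rule card_inj_on_le)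
    show "inj_on m (empty_boxes lam (restr T j))"
      by (rule inj_onI, rule SVT_unique[OF T m]) (use m in \<open>auto simp: empty_boxes_def\<close>)
    show "m ` empty_boxes lam (restr T j) \<subseteq> {1..j}"
    proof clarify
      fix r c assume "(r, c) \<in> empty_boxes lam (restr T j)"
      then have "m (r, c) \<in> T (r, c)" "restr T j (r, c) = {}" using m by (auto simp: empty_boxes_def)
      then show "m (r, c) \<in> {1..j}" using le[of "(r, c)"] by (auto simp: restr_def)
    qed
  qed simp
  then show "card (empty_boxes lam (restr T j)) \<le> j" by simp
qed

text \<open>All values above \<open>k\<close> already occur in \<open>S\<close>, and each occurs
  only once in \<open>T\<close>, so an extension can add only values up to \<open>k\<close>.\<close>

lemma restr_of_ext:
  assumes S: "pretableau lam N k S" and T: "T \<in> SVT_ext lam N S"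
  shows "restr T k = S"
proof
  fix b
  have T': "T \<in> SVT lam N" and le: "le_filling lam S T" using T by (auto simp: SVT_ext_def)
  show "restr T k b = S b"
  proof (cases "b \<in> diagram lam")
    case True
    have "S b \<subseteq> restr T k b"
      using S le True by (fastforce simp: restr_def pretableau_def le_filling_def)
    moreover have "v \<in> S b" if "v \<in> restr T k b" for v
    proof -
      have v: "v \<in> T b" "k < v" using that by (auto simp: restr_def)
      then have "v \<in> {k+1..N}" using SVT_values[OF T' v(1)] by simp
      then obtain b' where "b' \<in> diagram lam" "v \<in> S b'" using S unfolding pretableau_def by blast
      moreover from this have "v \<in> T b'" using le by (auto simp: le_filling_def)
      ultimately show ?thesis using SVT_unique[OF T' v(1)] by auto
    qed
    ultimately show ?thesis by auto
  next
    case False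
    then have "S b = {}" using S unfolding pretableau_def by blast
    then show ?thesis using SVT_outside[OF T' False] by (simp add: restr_def)
  qed
qed

lemma ext_pretableau_0:
  assumes S: "pretableau lam N 0 S" and ne: "SVT_ext lam N S \<noteq> {}"
  shows "num_SVT lam N S = 1"
proof -
  have "T = S" if "T \<in> SVT_ext lam N S" for T
  proof -
    have "restr T 0 = T"
    proof
      fix b
      have "T \<in> SVT lam N" using that by (simp add: SVT_ext_def)
      then show "restr T 0 b = T b" using SVT_values[of T lam N _ b] by (fastforce simp: restr_def)
    qed
    then show ?thesis using restr_of_ext[OF S that] by simp
  qed
  then have "SVT_ext lam N S = {S}" using ne by blast
  then show ?thesis by (simp add: num_SVT_def)
qed

text \<open>The new value is smaller than all present ones, so order can be violated only towards a
  neighbour that precedes \<open>b\<close> and is occupied, or by a neighbour that follows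
  \<open>b\<close> and is still empty.\<close>

lemma pretableau_insert:
  assumes S: "pretableau lam N (Suc k) S" and k: "Suc k \<le> N" and b: "b \<in> diagram lam"
    and succ: "\<And>r c b'. b = (r, c) \<Longrightarrow> b' \<in> {(r + 1, c), (r, c + 1)} \<Longrightarrow> b' \<in> diagram lam \<Longrightarrow> S b' \<noteq> {}"
    and pred: "\<And>r c. b \<in> {(r + 1, c), (r, c + 1)} \<Longrightarrow> (r, c) \<in> diagram lam \<Longrightarrow> S (r, c) = {}"
    and card: "card (empty_boxes lam S - {b}) \<le> k"
  shows "pretableau lam N k (S(b := insert (Suc k) (S b)))" (is "pretableau lam N k ?S")
  unfolding pretableau_iff
proof (intro conjI allI ballI impI)
  have S': "\<And>b'. b' \<notin> diagram lam \<Longrightarrow> S b' = {}" "\<And>b'. b' \<in> diagram lam \<Longrightarrow> S b' \<subseteq> {Suc k+1..N}"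
    "\<And>v. v\<in>{Suc k+1..N} \<Longrightarrow> \<exists>!b. b \<in> diagram lam \<and> v \<in> S b"
    "\<And>r c. before S lam (r, c) (r + 1, c)" "\<And>r c. before S lam (r, c) (r, c + 1)"
    using S unfolding pretableau_iff by blast+
  show "?S b' = {}" if "b' \<notin> diagram lam" for b'
    using that b S'(1)[OF that] by auto
  show "?S b' \<subseteq> {k+1..N}" if "b' \<in> diagram lam" for b'
    using that k S'(2)[OF that] by auto
  show "\<exists>!b. b \<in> diagram lam \<and> v \<in> ?S b" if "v \<in> {k+1..N}" for v
  proof (cases "v = Suc k")
    case True
    have "v \<notin> S b'" for b' using S'(1,2)[of b'] True by (cases "b' \<in> diagram lam") auto
    then show ?thesis using b True by (intro ex1I[of _ b]) (auto split: if_splits)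
  next
    case False
    then have "v \<in> ?S b' \<longleftrightarrow> v \<in> S b'" for b' by auto
    then show ?thesis using S'(3)[of v] that False by auto
  qed
  have *: "before ?S lam (r, c) b'" if "before S lam (r, c) b'" "b' \<in> {(r + 1, c), (r, c + 1)}" for r c b'
    unfolding before_def
  proof (intro impI)
    assume d: "(r, c) \<in> diagram lam" "b' \<in> diagram lam" "?S (r, c) \<noteq> {}"
    have ne: "b' \<noteq> (r, c)" using that(2) by auto
    show "?S b' \<noteq> {} \<and> (\<forall>x\<in>?S (r, c). \<forall>y\<in>?S b'. x < y)"
    proof (cases "b = (r, c)")
      case True
      have "S b' \<noteq> {}" by (rule succ[OF True that(2) d(2)])
      moreover have "Suc k < y" if "y \<in> S b'" for y using S'(2)[OF d(2)] that by auto
      ultimately show ?thesis using that(1) d ne True unfolding before_def by auto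
    next
      case False
      then have "S (r, c) \<noteq> {}" using d(3) by auto
      moreover have "b' \<noteq> b" using pred[of r c] that(2) d(1) calculation by auto
      ultimately show ?thesis using that(1) d False unfolding before_def by auto
    qed
  qed
  show "before ?S lam (r, c) (r + 1, c)" for r c by (rule *) (use S' in auto)
  show "before ?S lam (r, c) (r, c + 1)" for r c by (rule *) (use S' in auto)
  have "empty_boxes lam ?S = empty_boxes lam S - {b}" by (auto simp: empty_boxes_def)
  then show "card (empty_boxes lam ?S) \<le> k" using card by simp
qed

text \<open>With \<open>k = 0\<close> no box is empty, so the conditions on adjacent boxes propagate
  along whole columns and rows through the boxes in between.\<close>

lemma pretableau_0_SVT:
  assumes lam: "partition lam" and S: "pretableau lam N 0 S"
  shows "S \<in> SVT lam N"
proof -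
  have S': "\<And>b'. b' \<notin> diagram lam \<Longrightarrow> S b' = {}" "\<And>b'. b' \<in> diagram lam \<Longrightarrow> S b' \<subseteq> {1..N}"
    "\<And>v. v\<in>{1..N} \<Longrightarrow> \<exists>!b. b \<in> diagram lam \<and> v \<in> S b"
    "\<And>r c. before S lam (r, c) (r + 1, c)" "\<And>r c. before S lam (r, c) (r, c + 1)"
    "card (empty_boxes lam S) = 0"
    using S unfolding pretableau_iff by auto
  then have "empty_boxes lam S = {}" using finite_diagram by (simp add: empty_boxes_def)
  then have ne: "S b \<noteq> {}" if "b \<in> diagram lam" for b
    using that unfolding empty_boxes_def by blast
  have col: "(r, c) \<in> diagram lam \<Longrightarrow> x \<in> S (r, c) \<Longrightarrow> (r', c) \<in> diagram lam \<Longrightarrow> y \<in> S (r', c) \<Longrightarrow> r < r' \<Longrightarrow> x < y" for r c r' x y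
  proof (induction r' arbitrary: y)
    case (Suc d)
    show ?case
    proof (cases "d = r")
      case True
      then show ?thesis using S'(4)[of r c] Suc.prems by (auto simp: before_def)
    next
      case False
      then have d: "r < d" using Suc.prems by simp
      have b: "(d, c) \<in> diagram lam"
        by (rule diagram_down[OF lam Suc.prems(3)]) (use Suc.prems d in \<open>auto simp: diagram_def\<close>)
      obtain z where z: "z \<in> S (d, c)" using ne[OF b] by auto
      have "x < z" by (rule Suc.IH[OF Suc.prems(1,2) b z d])
      moreover have "z < y" using S'(4)[of d c] b Suc.prems(3,4) z by (auto simp: before_def)
      ultimately show ?thesis by simp
    qed
  qed simp
  have row: "(r, c) \<in> diagram lam \<Longrightarrow> x \<in> S (r, c) \<Longrightarrow> (r, c') \<in> diagram lam \<Longrightarrow> y \<in> S (r, c') \<Longrightarrow> c < c' \<Longrightarrow> x < y" for r c c' x y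
  proof (induction c' arbitrary: y)
    case (Suc d)
    show ?case
    proof (cases "d = c")
      case True
      then show ?thesis using S'(5)[of r c] Suc.prems by (auto simp: before_def)
    next
      case False
      then have d: "c < d" using Suc.prems by simp
      have b: "(r, d) \<in> diagram lam"
        by (rule diagram_down[OF lam Suc.prems(3)]) (use Suc.prems d in \<open>auto simp: diagram_def\<close>)
      obtain z where z: "z \<in> S (r, d)" using ne[OF b] by auto
      have "x < z" by (rule Suc.IH[OF Suc.prems(1,2) b z d])
      moreover have "z < y" using S'(5)[of r d] b Suc.prems(3,4) z by (auto simp: before_def)
      ultimately show ?thesis by simp
    qed
  qed simp
  show ?thesis
    unfolding SVT_def
  proof (intro CollectI conjI allI ballI impI)
    fix g r r' c assume "\<forall>b\<in>diagram lam. g b \<in> S b"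
      "(r, c) \<in> diagram lam \<and> (r', c) \<in> diagram lam \<and> r < r'"
    then show "g (r, c) < g (r', c)" using col by blast
  next
    fix g r c c' assume "\<forall>b\<in>diagram lam. g b \<in> S b"
      "(r, c) \<in> diagram lam \<and> (r, c') \<in> diagram lam \<and> c < c'"
    then show "g (r, c) \<le> g (r, c')" using row by (meson less_imp_le)
  qed (use S'(1,2,3) ne in blast)+
qed

lemma pretableau_extends:
  assumes S: "pretableau lam N (Suc k) S" and k: "Suc k \<le> N" and lam: "partition lam" "lam \<noteq> []"
  obtains S' where "pretableau lam N k S'" "le_filling lam S S'"
proof -
  let ?D = "diagram lam" and ?E = "empty_boxes lam S"
  have S': "\<And>r c. before S lam (r, c) (r + 1, c)" "\<And>r c. before S lam (r, c) (r, c + 1)" "card ?E \<le> Suc k"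
    using S unfolding pretableau_iff by auto
  have fin: "finite ?E" using finite_diagram by (auto simp: empty_boxes_def)
  let ?h = "\<lambda>b. fst b + snd b :: nat"
  have "\<exists>b. b \<in> ?D \<and>
    (\<forall>r c b'. b = (r, c) \<longrightarrow> b' \<in> {(r + 1, c), (r, c + 1)} \<longrightarrow> b' \<in> ?D \<longrightarrow> S b' \<noteq> {}) \<and>
    (\<forall>r c. b \<in> {(r + 1, c), (r, c + 1)} \<longrightarrow> (r, c) \<in> ?D \<longrightarrow> S (r, c) = {}) \<and>
    card (?E - {b}) \<le> k"
  \<comment> \<open>If some box is occupied and the bound on empty boxes has slack, the value joins
    an occupied box with minimal r + c, whose predecessors are empty. Otherwise it goes into an
    empty box with maximal r + c, whose successors are occupied, and the number of empty boxes
    drops.\<close>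
  proof (cases "?E \<noteq> ?D \<and> card ?E \<le> k")
    case True
    then have "\<exists>b. b \<in> ?D - ?E" by (auto simp: empty_boxes_def)
    then obtain b where b: "b \<in> ?D - ?E" "\<And>b'. ?h b' < ?h b \<Longrightarrow> b' \<notin> ?D - ?E"
      using exists_least_iff[of "\<lambda>n. \<exists>b. b \<in> ?D - ?E \<and> ?h b = n"] by metis
    have "S b' \<noteq> {}" if "b = (r, c)" "b' \<in> {(r + 1, c), (r, c + 1)}" "b' \<in> ?D" for r c b'
      using S'(1)[of r c] S'(2)[of r c] b(1) that by (auto simp: before_def empty_boxes_def)
    moreover have "S (r, c) = {}" if "b \<in> {(r + 1, c), (r, c + 1)}" "(r, c) \<in> ?D" for r c
      using b(2)[of "(r, c)"] that by (auto simp: empty_boxes_def)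
    moreover have "card (?E - {b}) \<le> k" using True card_mono[OF fin, of "?E - {b}"] by fastforce
    ultimately show ?thesis using b(1) by blast
  next
    case False
    have "(1, 1) \<in> ?D" using lam by (cases lam) (auto simp: diagram_def partition_def)
    then have "?E \<noteq> {}" using False S'(3) by auto
    then obtain b where b: "b \<in> ?E" "\<And>b'. b' \<in> ?E \<Longrightarrow> ?h b' \<le> ?h b"
      using Max_in[of "?h ` ?E"] Max_ge[of "?h ` ?E"] fin by fastforce
    have "S b' \<noteq> {}" if "b = (r, c)" "b' \<in> {(r + 1, c), (r, c + 1)}" "b' \<in> ?D" for r c b'
      using b(2)[of b'] that by (auto simp: empty_boxes_def)
    moreover have "S (r, c) = {}" if "b \<in> {(r + 1, c), (r, c + 1)}" "(r, c) \<in> ?D" for r c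
      using S'(1)[of r c] S'(2)[of r c] b(1) that by (auto simp: before_def empty_boxes_def)
    moreover have "card (?E - {b}) \<le> k" using b(1) S'(3) fin by simp
    moreover have "b \<in> ?D" using b(1) by (simp add: empty_boxes_def)
    ultimately show ?thesis by blast
  qed
  then obtain b where b: "b \<in> ?D"
    "\<And>r c b'. b = (r, c) \<Longrightarrow> b' \<in> {(r + 1, c), (r, c + 1)} \<Longrightarrow> b' \<in> ?D \<Longrightarrow> S b' \<noteq> {}"
    "\<And>r c. b \<in> {(r + 1, c), (r, c + 1)} \<Longrightarrow> (r, c) \<in> ?D \<Longrightarrow> S (r, c) = {}"
    "card (?E - {b}) \<le> k"
    by metis
  show ?thesis
    by (rule that[OF pretableau_insert[OF S k b]]) (auto simp: le_filling_def)
qed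

lemma SVT_ext_mono: "le_filling lam S S' \<Longrightarrow> SVT_ext lam N S' \<subseteq> SVT_ext lam N S"
  by (fastforce simp: SVT_ext_def le_filling_def)

text \<open>A sampler owes nothing on instances without extensions. Filling in the values from
  \<open>k\<close> downwards shows that every instance with a nonempty shape is covered.\<close>

lemma SVT_ext_nonempty:
  assumes "pretableau lam N k S" "k \<le> N" "partition lam" "lam \<noteq> []"
  shows "SVT_ext lam N S \<noteq> {}"
  using assms(1,2)
proof (induction k arbitrary: S)
  case 0
  then have "S \<in> SVT_ext lam N S"
    using pretableau_0_SVT[OF assms(3)] by (auto simp: SVT_ext_def le_filling_def)
  then show ?case by blast
next
  case (Suc k)
  obtain S' where "pretableau lam N k S'" "le_filling lam S S'"
    using pretableau_extends[OF Suc.prems assms(3,4)] .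
  then show ?case using Suc.IH[of S'] Suc.prems SVT_ext_mono by fastforce
qed

text \<open>The scheme must also answer for the empty shape, where the sampler may be of no help.
  The truncated difference is 1 for \<open>N = 0\<close> and 0 otherwise.\<close>

lemma SVT_ext_Nil:
  assumes "pretableau [] N k S" "k \<le> N"
  shows "k = N" "num_SVT [] N S = 1 - N"
proof -
  have D: "diagram [] = {}" by (auto simp: diagram_def)
  show "k = N"
  proof (rule ccontr)
    assume "k \<noteq> N"
    then have "N \<in> {k+1..N}" using assms(2) by auto
    then show False using assms(1) D unfolding pretableau_def by blast
  qed
  have "SVT [] N = (if N = 0 then {\<lambda>_. {}} else {})"
    unfolding SVT_def D by (auto simp: fun_eq_iff)
  then show "num_SVT [] N S = 1 - N"
    unfolding num_SVT_def SVT_ext_def le_filling_def D by auto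
qed

text \<open>The new filling is \<open>T\<close> cut off at \<open>k\<close>, hence a pre-tableau.
  The last claim is the self-reduction: extensions of \<open>S'\<close> are the extensions of
  \<open>S\<close> with \<open>Suc k\<close> in \<open>b\<close>, so their share is the probability
  of this box.\<close>

lemma insert_position:
  assumes S: "pretableau lam N (Suc k) S" and k: "Suc k \<le> N" and lam: "partition lam"
    and T: "T \<in> SVT_ext lam N S" and b: "Suc k \<in> T b"
  defines "S' \<equiv> S(b := insert (Suc k) (S b))"
  shows "pretableau lam N k S'" "le_filling lam S S'" "T \<in> SVT_ext lam N S'"
    "SVT_ext lam N S' = {T' \<in> SVT_ext lam N S. Suc k \<in> T' b}"
proof -
  have T': "T \<in> SVT lam N" using T by (simp add: SVT_ext_def)
  have bD: "b \<in> diagram lam" by (rule SVT_box[OF T' b])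
  have S_eq: "S = restr T (Suc k)" using restr_of_ext[OF S T] by simp
  have "restr T k = S'"
  proof
    fix b'
    show "restr T k b' = S' b'"
    proof (cases "b' = b")
      case True
      then show ?thesis using b unfolding S'_def S_eq restr_def by (auto simp: Suc_lessI)
    next
      case False
      then have "Suc k \<notin> T b'" using SVT_unique[OF T' b, of b'] by blast
      then show ?thesis using False unfolding S'_def S_eq restr_def by (auto simp: Suc_lessI) (metis Suc_lessI)
    qed
  qed
  then show "pretableau lam N k S'" using pretableau_restr[OF lam T', of k] k by simp
  show le: "le_filling lam S S'" by (auto simp: le_filling_def S'_def)
  show ext: "SVT_ext lam N S' = {T' \<in> SVT_ext lam N S. Suc k \<in> T' b}"
    using bD by (auto simp: SVT_ext_def le_filling_def S'_def)
  then show "T \<in> SVT_ext lam N S'" using T b by simp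
qed

lemma downwardly_stableD:
  assumes "downwardly_stable F" "(lam, N, S) \<in> F" "k \<le> N" "pretableau lam N k S'" "le_filling lam S S'"
  shows "(lam, N, S') \<in> F"
  using bspec[OF assms(1)[unfolded downwardly_stable_def] assms(2)] assms(3-5) by simp

definition box_of :: "nat \<Rightarrow> filling \<Rightarrow> nat \<times> nat" where
  "box_of k T = (THE b. k \<in> T b)"

lemma box_of_eq: "T \<in> SVT lam N \<Longrightarrow> k \<in> T b \<Longrightarrow> box_of k T = b"
  unfolding box_of_def using SVT_unique by blast

lemma box_of_cases:
  assumes lam: "partition lam" and T: "T \<in> SVT lam N" and k: "1 \<le> k" "k \<le> N"
  obtains r c where "box_of k T = (Suc r, Suc c)" "r < k" "c < k" "k \<in> T (Suc r, Suc c)" "(Suc r, Suc c) \<in> diagram lam"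
proof -
  obtain b where b: "b \<in> diagram lam" "k \<in> T b" using SVT_ex1[OF T, of k] k by auto
  then obtain r c where "b = (Suc r, Suc c)" by (auto simp: diagram_def dest!: Suc_le_D)
  then show ?thesis using that[of r c] b SVT_box_le[OF lam T, of "Suc r" "Suc c" k] box_of_eq[OF T b(2)] by auto
qed

lemma box_of_mem:
  assumes lam: "partition lam" and T: "T \<in> SVT lam N" and k: "1 \<le> k" "k \<le> N"
  shows "k \<in> T (box_of k T)" "box_of k T \<in> {1..k} \<times> {1..k}"
  by (rule box_of_cases[OF assms], simp)+

section \<open>Fillings as values\<close>

lemma drop_val_enc_list: "drop_val i (enc_list xs) = enc_list (drop i xs)"
proof (induction i arbitrary: xs)
  case (Suc i)
  show ?case by (cases xs; cases i) (use Suc[of "tl xs"] in \<open>auto simp: drop_val_Suc(2) enc_list_def\<close>)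
qed (simp add: drop_val_def)

lemma nth_val_enc_list: "nth_val i (enc_list xs) = (if i < length xs then xs ! i else Num 0)"
  unfolding nth_val_def drop_val_enc_list
  by (auto simp: Cons_nth_drop_Suc[symmetric] enc_list_def)

lemma put_val_enc_list: "i < length xs \<Longrightarrow> put_val i (enc_list xs) x = enc_list (xs[i := x])"
proof (induction i arbitrary: xs)
  case 0
  then show ?case by (cases xs) (auto simp: enc_list_def)
next
  case (Suc i)
  then show ?case by (cases xs) (auto simp: enc_list_def)
qed

definition enc_set :: "nat set \<Rightarrow> val" where
  "enc_set A = enc_list (map Num (sorted_list_of_set A))"

definition enc_row :: "nat list \<Rightarrow> filling \<Rightarrow> nat \<Rightarrow> val" where
  "enc_row lam T r = enc_list (map (\<lambda>c. enc_set (T (Suc r, Suc c))) [0..<lam ! r])"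

lemma enc_filling_rows: "enc_filling lam T = enc_list (map (enc_row lam T) [0..<length lam])"
proof -
  have eq: "[1..<Suc n] = map Suc [0..<n]" for n by (simp add: map_Suc_upt)
  show ?thesis
    unfolding enc_filling_def enc_row_def enc_set_def eq by (simp add: comp_def)
qed

lemma nth_row_enc_filling: "r < length lam \<Longrightarrow> nth_val r (enc_filling lam T) = enc_row lam T r"
  by (simp add: enc_filling_rows nth_val_enc_list)

text \<open>Valid for all \<open>r\<close> and \<open>c\<close>: outside the diagram reading yields
  \<open>Num 0\<close>, which is also the code of the empty set. This is why \<open>Find\<close> can
  scan a square without consulting the shape.\<close>

lemma nth_box_enc_filling:
  assumes "\<And>b. b \<notin> diagram lam \<Longrightarrow> T b = {}"
  shows "nth_val c (nth_val r (enc_filling lam T)) = enc_set (T (Suc r, Suc c))"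
proof (cases "(Suc r, Suc c) \<in> diagram lam")
  case True
  then show ?thesis by (simp add: diagram_def nth_row_enc_filling enc_row_def nth_val_enc_list)
next
  case False
  have "nth_val c (Num 0) = Num 0" using nth_val_enc_list[of c "[]"] by (simp add: enc_list_def)
  moreover have "nth_val r (enc_filling lam T) = Num 0 \<or> lam ! r \<le> c \<and> nth_val r (enc_filling lam T) = enc_row lam T r"
    using False by (auto simp: diagram_def nth_row_enc_filling enc_filling_rows nth_val_enc_list)
  ultimately show ?thesis using assms[OF False]
    by (auto simp: enc_row_def nth_val_enc_list enc_set_def) (auto simp: enc_list_def)
qed

lemma sorted_list_of_set_nth_ge:
  assumes "\<And>x. x \<in> A \<Longrightarrow> 1 \<le> x" "i < length (sorted_list_of_set A)"
  shows "i < sorted_list_of_set A ! i"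
  using assms(2)
proof (induction i)
  case 0
  then have "sorted_list_of_set A ! 0 \<in> set (sorted_list_of_set A)" using nth_mem by blast
  then show ?case using assms(1) by (cases "finite A") force+
next
  case (Suc i)
  then have "sorted_list_of_set A ! i < sorted_list_of_set A ! Suc i"
    using strict_sorted_list_of_set[of A] by (auto simp: sorted_wrt_iff_nth_less)
  then show ?case using Suc by simp
qed

lemma member_val_enc_filling:
  assumes out: "\<And>b. b \<notin> diagram lam \<Longrightarrow> T b = {}" and T: "\<And>b. T b \<subseteq> {1..N}" and j: "1 \<le> j"
  shows "member_val j (enc_filling lam T) r c \<longleftrightarrow> j \<in> T (Suc r, Suc c)"
proof -
  let ?A = "T (Suc r, Suc c)" let ?l = "sorted_list_of_set ?A"
  have fin: "finite ?A" using T finite_subset by blast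
  \<comment> \<open>The default 0 for a missing entry is never mistaken for \<open>j\<close>,
    because \<open>1 \<le> j\<close>.\<close>
  have nth: "num_of (nth_val i (enc_set ?A)) = (if i < length ?l then ?l ! i else 0)" for i
    by (simp add: enc_set_def nth_val_enc_list)
  have "(\<exists>i<j. num_of (nth_val i (enc_set ?A)) = j) \<longleftrightarrow> j \<in> set ?l"
  proof
    assume "j \<in> set ?l"
    then obtain i where "i < length ?l" "?l ! i = j" by (auto simp: in_set_conv_nth)
    then show "\<exists>i<j. num_of (nth_val i (enc_set ?A)) = j"
      using sorted_list_of_set_nth_ge[of ?A i] T[of "(Suc r, Suc c)"] nth by force
  qed (use nth j in \<open>auto split: if_splits\<close>)
  then show ?thesis
    using fin nth_box_enc_filling[of lam T c r] out unfolding member_val_def by simp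
qed

lemma insert_val_enc_filling:
  assumes S: "\<And>b. b \<notin> diagram lam \<Longrightarrow> S b = {}" and b: "(Suc r, Suc c) \<in> diagram lam"
    and k: "\<And>x. x \<in> S (Suc r, Suc c) \<Longrightarrow> k < x" and fin: "finite (S (Suc r, Suc c))"
  shows "insert_val r c k (enc_filling lam S) =
    enc_filling lam (S((Suc r, Suc c) := insert k (S (Suc r, Suc c))))" (is "_ = enc_filling lam ?S")
proof -
  have r: "r < length lam" "c < lam ! r" using b by (auto simp: diagram_def)
  have "k \<notin> S (Suc r, Suc c)" using k by blast
  then have "sorted_list_of_set (insert k (S (Suc r, Suc c))) = k # sorted_list_of_set (S (Suc r, Suc c))"
    using fin k by (simp add: sorted_list_of_set_insert_remove insort_is_Cons less_imp_le)
  then have box: "Cell (Num k) (enc_set (S (Suc r, Suc c))) = enc_set (?S (Suc r, Suc c))"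
    by (simp add: enc_set_def enc_list_def)
  have row: "put_val c (enc_row lam S r) (enc_set (?S (Suc r, Suc c))) = enc_row lam ?S r"
    unfolding enc_row_def using r
    by (subst put_val_enc_list) (auto intro!: arg_cong[of _ _ enc_list] nth_equalityI simp: nth_list_update)
  have "put_val r (enc_filling lam S) (enc_row lam ?S r) = enc_filling lam ?S"
    unfolding enc_filling_rows using r
    by (subst put_val_enc_list) (auto intro!: arg_cong[of _ _ enc_list] nth_equalityI simp: nth_list_update enc_row_def)
  moreover have "nth_val c (nth_val r (enc_filling lam S)) = enc_set (S (Suc r, Suc c))"
    by (rule nth_box_enc_filling) (rule S)
  ultimately show ?thesis
    unfolding insert_val_def by (simp only: box nth_row_enc_filling[OF r(1)] row)
qed

lemma enc_filling_inj: "inj_on (enc_filling lam) (SVT lam N)"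
proof (rule inj_onI)
  fix T T' assume T: "T \<in> SVT lam N" "T' \<in> SVT lam N" and eq: "enc_filling lam T = enc_filling lam T'"
  have mem: "j \<in> T (Suc r, Suc c) \<longleftrightarrow> j \<in> T' (Suc r, Suc c)" if "1 \<le> j" for j r c
    using member_val_enc_filling[of lam T N j r c] member_val_enc_filling[of lam T' N j r c]
      SVT_outside[OF T(1)] SVT_outside[OF T(2)] SVT_values[OF T(1)] SVT_values[OF T(2)] that
    unfolding eq by (metis atLeastAtMost_iff subsetI)
  show "T = T'"
  proof
    fix b
    show "T b = T' b"
    proof (cases "b \<in> diagram lam")
      case True
      then obtain r c where b: "b = (Suc r, Suc c)" by (auto simp: diagram_def dest!: Suc_le_D)
      have "j \<in> T b \<longleftrightarrow> j \<in> T' b" for j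
        using SVT_values[OF T(1), of j b] SVT_values[OF T(2), of j b] mem[of j r c] unfolding b by blast
      then show ?thesis by blast
    qed (simp add: SVT_outside[OF T(1)] SVT_outside[OF T(2)])
  qed
qed

section \<open>The approximation scheme\<close>

text \<open>A program sees the code \<open>g T\<close> of a sample, while the analysis describes the
  continuation in terms of \<open>T\<close>. Injectivity of \<open>g\<close> allows reading
  \<open>h\<close> as a function of the code. The input \<open>v\<close> is kept beside the sample
  for later use.\<close>

lemma realizes_sample:
  assumes r: "computes r v X B0" and s: "realizes s X (map_pmf g \<Gamma>) B" and inj: "inj_on g (set_pmf \<Gamma>)"
    and q: "\<And>T. T \<in> set_pmf \<Gamma> \<Longrightarrow> realizes q (Cell (g T) v) (h T) C"
  shows "realizes (Seq (Fork (Seq r s) Skip) q) v (bind_pmf \<Gamma> h) (B0 + B + C + 4)"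
proof -
  have "realizes (Fork (Seq r s) Skip) v (bind_pmf (map_pmf g \<Gamma>) (\<lambda>x. map_pmf (Cell x) (return_pmf v))) ((B0 + B + 1) + 1 + 1)"
    by (rule realizes_Fork[OF computes_Seq[OF r s] computes_Skip])
  then have F: "realizes (Fork (Seq r s) Skip) v (map_pmf (\<lambda>T. Cell (g T) v) \<Gamma>) (B0 + B + 3)"
    by (rule realizes_weaken) (auto simp: map_pmf_def bind_assoc_pmf bind_return_pmf)
  define R where "R x = h (the_inv_into (set_pmf \<Gamma>) g (fst_val x))" for x
  have R: "R (Cell (g T) v) = h T" if "T \<in> set_pmf \<Gamma>" for T
    using that by (simp add: R_def the_inv_into_f_f[OF inj])
  have "realizes (Seq (Fork (Seq r s) Skip) q) v (bind_pmf (map_pmf (\<lambda>T. Cell (g T) v) \<Gamma>) R) (B0 + B + 3 + C + 1)"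
    by (rule realizes_Seq[OF F]) (use q R in auto)
  then show ?thesis
    by (rule realizes_weaken) (auto simp: bind_map_pmf R intro!: bind_pmf_cong)
qed

definition Count :: "prog \<Rightarrow> prog" where
  "Count s = Seq (Fork Fst (Fork Snd (Const (Num 1)))) (Seq
     (For (Seq (Fork (Seq (Seq Snd (Seq Fst Fst)) s) Skip)
       (Fork (Seq Snd (Seq Snd Fst))
         (Seq (Fork (Seq (Fork (Seq Snd (Seq Snd (Seq Fst (Seq Snd Fst))))
                (Fork (Seq Snd (Seq Snd (Seq Fst (Seq Snd Snd)))) Fst)) Member)
              (Seq Snd (Seq Snd Snd))) Add))))
     (Seq Snd Snd))"

lemma realizes_Count:
  assumes s: "realizes s X (map_pmf g \<Gamma>) B" and inj: "inj_on g (set_pmf \<Gamma>)"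
    and A: "\<And>T. T \<in> set_pmf \<Gamma> \<Longrightarrow> member_val k (g T) r c \<longleftrightarrow> T \<in> A"
    and m: "r \<le> m" "c \<le> m" "k \<le> m" "1 \<le> m" "t < m"
  shows "realizes (Count s) (Cell (Num t) (Cell X (Cell (Cell (Num r) (Num c)) (Num k))))
    (map_pmf Num (count_pmf \<Gamma> A t 1)) (m * (B + 300 * m ^ 2))"
proof -
  let ?ctx = "Cell X (Cell (Cell (Num r) (Num c)) (Num k))"
  let ?add = "Fork (Seq Snd (Seq Snd Fst))
         (Seq (Fork (Seq (Fork (Seq Snd (Seq Snd (Seq Fst (Seq Snd Fst))))
                (Fork (Seq Snd (Seq Snd (Seq Fst (Seq Snd Snd)))) Fst)) Member)
              (Seq Snd (Seq Snd Snd))) Add)"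
  let ?body = "Seq (Fork (Seq (Seq Snd (Seq Fst Fst)) s) Skip) ?add"
  let ?B = "B + 200 * m ^ 2 + 50"
  have body: "realizes ?body (Cell (Num i) (Cell ?ctx (Num n)))
     (bind_pmf \<Gamma> (\<lambda>T. return_pmf (Cell ?ctx (Num (n + of_bool (T \<in> A)))))) ?B" for i n
  proof -
    have "computes ?add (Cell (g T) (Cell (Num i) (Cell ?ctx (Num n))))
      (Cell ?ctx (Num (n + of_bool (T \<in> A)))) (200 * m ^ 2 + 37)" if T: "T \<in> set_pmf \<Gamma>" for T
    proof -
      have "(if member_val k (g T) r c then Num 1 else Num 0) = Num (of_bool (T \<in> A))"
        using A[OF T] by simp
      then have M: "computes Member (Cell (Cell (Num r) (Num c)) (Cell (Num k) (g T))) (Num (of_bool (T \<in> A))) (200 * m ^ 2)"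
        using computes_Member[OF m(1-4), of "g T"] by simp
      show ?thesis
        by (rule computes_weaken, (rule M computes_intros)+) auto
    qed
    note R = realizes_sample[OF _ s inj this]
    show ?thesis
      by (rule realizes_weaken, rule R, (rule computes_intros)+) auto
  qed
  have "realizes (For ?body) (Cell (Num n) (Cell ?ctx (Num a)))
     (map_pmf (\<lambda>c. Cell (Num 0) (Cell ?ctx (Num c))) (count_pmf \<Gamma> A n a)) (n * (?B + 12) + 2)" for n a
  proof (induction n arbitrary: a)
    case 0
    show ?case by (rule realizes_weaken[OF realizes_For_0]) auto
  next
    case (Suc n)
    have "realizes (For ?body) (Cell (Num (Suc n)) (Cell ?ctx (Num a)))
      (bind_pmf (bind_pmf \<Gamma> (\<lambda>T. return_pmf (Cell ?ctx (Num (a + of_bool (T \<in> A))))))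
         (\<lambda>s. map_pmf (\<lambda>c. Cell (Num 0) (Cell ?ctx (Num c))) (count_pmf \<Gamma> A n (num_of (snd_val s)))))
      (?B + (n * (?B + 12) + 2) + 12)"
      by (rule realizes_For_Suc[OF body]) (use Suc.IH in auto)
    then show ?case
      by (rule realizes_weaken) (simp_all add: bind_assoc_pmf bind_return_pmf map_bind_pmf)
  qed
  then have "realizes (Seq (For ?body) (Seq Snd Snd)) (Cell (Num t) (Cell ?ctx (Num 1)))
    (bind_pmf (map_pmf (\<lambda>c. Cell (Num 0) (Cell ?ctx (Num c))) (count_pmf \<Gamma> A t 1)) (\<lambda>x. return_pmf (snd_val (snd_val x))))
    ((t * (?B + 12) + 2) + 3 + 1)"
  proof (rule realizes_Seq)
    fix x assume "x \<in> set_pmf (map_pmf (\<lambda>c. Cell (Num 0) (Cell ?ctx (Num c))) (count_pmf \<Gamma> A t 1))"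
    then obtain c where "x = Cell (Num 0) (Cell ?ctx (Num c))" by auto
    then show "computes (Seq Snd Snd) x (snd_val (snd_val x)) 3"
      by simp (rule computes_weaken, (rule computes_intros)+, simp_all)
  qed
  note F = this
  have "t * (?B + 12) + 30 \<le> (t + 1) * (?B + 12)" by simp
  also have "\<dots> \<le> m * (?B + 12)" using m by (intro mult_right_mono) auto
  also have "\<dots> \<le> m * (B + 300 * m ^ 2)"
  proof (rule mult_left_mono)
    have "1 \<le> m ^ 2" using m by simp
    then show "?B + 12 \<le> B + 300 * m ^ 2" by linarith
  qed simp
  finally have T: "t * (?B + 12) + 30 \<le> m * (B + 300 * m ^ 2)" .
  have "realizes (Count s) (Cell (Num t) ?ctx)
    (bind_pmf (map_pmf (\<lambda>c. Cell (Num 0) (Cell ?ctx (Num c))) (count_pmf \<Gamma> A t 1)) (\<lambda>x. return_pmf (snd_val (snd_val x))))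
    (1 + (1 + 1 + 1) + 1 + (t * (?B + 12) + 2 + 3 + 1) + 1)"
    unfolding Count_def by (rule F computes_intros)+
  then show ?thesis
    by (rule realizes_weaken) (use T in \<open>auto simp: map_pmf_def bind_assoc_pmf bind_return_pmf\<close>)
qed

lemma computes_Suc: "computes (Seq (Fork Fst (Const (Num 1))) Add) (Cell (Num i) v) (Num (Suc i)) 5"
  by (rule computes_weaken, (rule computes_intros)+) auto

text \<open>The loop index \<open>i\<close> belongs to the value \<open>Suc i\<close>, hence the
  initial increment. Then a sample is drawn, the box of this value is located in it, further samples
  are counted, and the new state is assembled; the long chains of \<open>Fst\<close> and
  \<open>Snd\<close> only route data.\<close>

definition Stage :: "prog \<Rightarrow> prog" where
  "Stage s = Seq (Fork (Seq (Fork Fst (Const (Num 1))) Add) Snd)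
     (Seq (Fork (Seq (Seq Snd Fst) s) Skip)
     (Seq (Fork (Seq (Fork (Seq Snd Fst) Fst) Find) Snd)
     (Seq (Fork (Seq (Fork (Seq Snd (Seq Snd (Seq Fst (Seq Snd Snd))))
                   (Fork (Seq Snd (Seq Snd Fst)) (Fork Fst (Seq Snd Fst)))) (Count s)) Skip)
       (Seq (Fork Skip (Seq Snd (Seq Snd Snd)))
         (Fork (Fork (Fork (Seq Snd (Seq Fst (Seq Fst Fst)))
            (Fork (Seq Snd (Seq Fst (Seq Fst (Seq Snd Fst))))
               (Seq (Fork (Seq Fst (Seq Snd Fst)) (Fork (Seq Fst (Seq Snd (Seq Snd Fst))) (Seq Snd (Seq Fst (Seq Fst (Seq Snd Snd))))))
                 Insert))) (Seq Snd (Seq Fst Snd)))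
           (Fork (Seq (Fork (Seq Snd (Seq Fst (Seq Snd Snd))) (Seq Snd (Seq Snd Fst))) Mul)
             (Seq (Fork (Seq Fst Fst) (Seq Snd (Seq Snd Snd))) Mul)))))))"

text \<open>The first half is literally an input of the sampler, the instance with bias 1/t, and can
  be passed on as it is; t is read from there as well. The second half is the running fraction a/b.
  The number of extensions of \<open>S\<close> times a/b stays approximately constant.\<close>

definition stage_val :: "nat list \<Rightarrow> nat \<Rightarrow> nat \<Rightarrow> filling \<Rightarrow> nat \<Rightarrow> nat \<Rightarrow> val" where
  "stage_val lam N t S a b = Cell (Cell (enc_inst (lam, N, S)) (Cell (Num 1) (Num t))) (Cell (Num a) (Num b))"

lemma realizes_Stage:
  assumes lam: "partition lam" and S: "pretableau lam N (Suc i) S" and i: "Suc i \<le> N"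
    and \<Gamma>: "set_pmf \<Gamma> \<subseteq> SVT_ext lam N S"
    and s: "realizes s (Cell (enc_inst (lam, N, S)) (Cell (Num 1) (Num t))) (map_pmf (enc_filling lam) \<Gamma>) B"
    and m: "i + 2 \<le> m" "t + 2 \<le> m"
  shows "realizes (Stage s) (Cell (Num i) (stage_val lam N t S a b))
    (bind_pmf \<Gamma> (\<lambda>T. map_pmf (\<lambda>c. stage_val lam N t (S(box_of (Suc i) T := insert (Suc i) (S (box_of (Suc i) T)))) (a * t) (b * c))
      (count_pmf \<Gamma> {T'. box_of (Suc i) T' = box_of (Suc i) T} t 1))) (m * (2 * B + 2000 * m ^ 4))"
proof -
  let ?k = "Suc i"
  let ?X = "Cell (enc_inst (lam, N, S)) (Cell (Num 1) (Num t))"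
  let ?ab = "Cell (Num a) (Num b)"
  let ?S' = "\<lambda>T. S(box_of ?k T := insert ?k (S (box_of ?k T)))"
  have \<Gamma>': "set_pmf \<Gamma> \<subseteq> SVT lam N" using \<Gamma> by (auto simp: SVT_ext_def)
  have inj: "inj_on (enc_filling lam) (set_pmf \<Gamma>)" by (rule inj_on_subset[OF enc_filling_inj \<Gamma>'])
  have mem: "member_val ?k (enc_filling lam T) r c \<longleftrightarrow> box_of ?k T = (Suc r, Suc c)" if T: "T \<in> set_pmf \<Gamma>" for T r c
  proof -
    have T': "T \<in> SVT lam N" using T \<Gamma>' by auto
    obtain r0 c0 where "box_of ?k T = (Suc r0, Suc c0)" "?k \<in> T (Suc r0, Suc c0)"
      by (rule box_of_cases[OF lam T', of ?k]) (use i in auto)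
    moreover have "member_val ?k (enc_filling lam T) r c \<longleftrightarrow> ?k \<in> T (Suc r, Suc c)"
      by (rule member_val_enc_filling[of lam T N]) (use SVT_outside[OF T'] SVT_values[OF T'] in auto)
    ultimately show ?thesis using box_of_eq[OF T'] by metis
  qed
  let ?q1 = "Fork (Seq (Fork (Seq Snd Fst) Fst) Find) Snd"
  let ?build = "Seq (Fork Skip (Seq Snd (Seq Snd Snd)))
         (Fork (Fork (Fork (Seq Snd (Seq Fst (Seq Fst Fst)))
            (Fork (Seq Snd (Seq Fst (Seq Fst (Seq Snd Fst))))
               (Seq (Fork (Seq Fst (Seq Snd Fst)) (Fork (Seq Fst (Seq Snd (Seq Snd Fst))) (Seq Snd (Seq Fst (Seq Fst (Seq Snd Snd))))))
                 Insert))) (Seq Snd (Seq Fst Snd)))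
           (Fork (Seq (Fork (Seq Snd (Seq Fst (Seq Snd Snd))) (Seq Snd (Seq Snd Fst))) Mul)
             (Seq (Fork (Seq Fst Fst) (Seq Snd (Seq Snd Snd))) Mul)))"
  let ?cnt = "Seq (Fork (Seq (Fork (Seq Snd (Seq Snd (Seq Fst (Seq Snd Snd))))
                   (Fork (Seq Snd (Seq Snd Fst)) (Fork Fst (Seq Snd Fst)))) (Count s)) Skip) ?build"
  have main: "realizes (Seq ?q1 ?cnt) (Cell (enc_filling lam T) (Cell (Num ?k) (Cell ?X ?ab)))
    (map_pmf (\<lambda>c. stage_val lam N t (?S' T) (a * t) (b * c)) (count_pmf \<Gamma> {T'. box_of ?k T' = box_of ?k T} t 1))
    (m * B + 1300 * m ^ 5 + 40 * m + 200)" if T: "T \<in> set_pmf \<Gamma>" for T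
  proof -
    have T': "T \<in> SVT lam N" using T \<Gamma>' by auto
    obtain r c where rc: "box_of ?k T = (Suc r, Suc c)" "r < ?k" "c < ?k" "(Suc r, Suc c) \<in> diagram lam"
      by (rule box_of_cases[OF lam T', of ?k]) (use i in auto)
    have "computes Find (Cell (Num ?k) (enc_filling lam T))
      (if r < ?k \<and> c < ?k \<and> member_val ?k (enc_filling lam T) r c then Cell (Num r) (Num c) else Num 0) (400 * m ^ 4)"
      by (rule computes_Find) (use m rc mem[OF T] in auto)
    then have F: "computes Find (Cell (Num ?k) (enc_filling lam T)) (Cell (Num r) (Num c)) (400 * m ^ 4)"
      using rc mem[OF T] by simp
    have q1: "computes ?q1 (Cell (enc_filling lam T) (Cell (Num ?k) (Cell ?X ?ab)))
       (Cell (Cell (Num r) (Num c)) (Cell (Num ?k) (Cell ?X ?ab))) (400 * m ^ 4 + 10)"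
      by (rule computes_weaken, (rule F computes_intros)+) auto
    let ?Z = "Cell (Cell (Num r) (Num c)) (Cell (Num ?k) (Cell ?X ?ab))"
    have C: "realizes (Count s) (Cell (Num t) (Cell ?X (Cell (Cell (Num r) (Num c)) (Num ?k))))
      (map_pmf Num (count_pmf \<Gamma> {T'. box_of ?k T' = box_of ?k T} t 1)) (m * (B + 300 * m ^ 2))"
      by (rule realizes_Count[OF s inj]) (use mem rc m in auto)
    have I: "computes Insert (Cell (Cell (Num r) (Num c)) (Cell (Num ?k) (enc_filling lam S))) (enc_filling lam (?S' T)) (300 * m ^ 2)"
    proof -
      have "insert_val r c ?k (enc_filling lam S) = enc_filling lam (?S' T)"
        unfolding rc(1)
      proof (rule insert_val_enc_filling)
        have sub: "S (Suc r, Suc c) \<subseteq> {Suc ?k..N}" using S rc(4) unfolding pretableau_iff by auto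
        then show "finite (S (Suc r, Suc c))" by (rule finite_subset) simp
        show "?k < x" if "x \<in> S (Suc r, Suc c)" for x using sub that by auto
        show "S b' = {}" if "b' \<notin> diagram lam" for b' using S that unfolding pretableau_iff by blast
      qed (rule rc(4))
      then show ?thesis using computes_Insert[of r m c ?k "enc_filling lam S"] rc m by simp
    qed
    \<comment> \<open>A count is at most t + 1, and both products have t or the count as first
      factor, so the cost does not depend on \<open>a\<close> and \<open>b\<close>.\<close>
    have build: "computes ?build (Cell (Num n) ?Z) (stage_val lam N t (?S' T) (a * t) (b * n)) (300 * m ^ 2 + 40 * m + 130)"
      if "n \<le> t + 1" for n
      unfolding stage_val_def enc_inst.simps
      by (rule computes_weaken, (rule I computes_Mul computes_intros)+) (use that m in auto)
    have "realizes ?cnt ?Z (bind_pmf (count_pmf \<Gamma> {T'. box_of ?k T' = box_of ?k T} t 1)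
       (\<lambda>c. return_pmf (stage_val lam N t (?S' T) (a * t) (b * c))))
       (30 + m * (B + 300 * m ^ 2) + (300 * m ^ 2 + 40 * m + 130) + 4)"
    proof (rule realizes_sample[OF _ C])
      show "computes (Fork (Seq Snd (Seq Snd (Seq Fst (Seq Snd Snd))))
          (Fork (Seq Snd (Seq Snd Fst)) (Fork Fst (Seq Snd Fst)))) ?Z (Cell (Num t) (Cell ?X (Cell (Cell (Num r) (Num c)) (Num ?k)))) 30"
        by (rule computes_weaken, (rule computes_intros)+) auto
      show "inj_on Num (set_pmf (count_pmf \<Gamma> {T'. box_of ?k T' = box_of ?k T} t 1))" by (auto simp: inj_on_def)
    qed (use build set_count_pmf in fastforce)
    from computes_Seq[OF q1 this] show ?thesis
    proof (rule realizes_weaken)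
      have "m ^ 4 \<le> m ^ 5" "m ^ 2 \<le> m ^ 5" "m ^ 3 \<le> m ^ 5"
        using m by (auto intro!: power_increasing)
      moreover have "m * m ^ 2 = m ^ 3" by (simp add: eval_nat_numeral)
      moreover have "m * (B + 300 * m ^ 2) = m * B + 300 * (m * m ^ 2)" by (simp add: algebra_simps)
      ultimately show "400 * m ^ 4 + 10 + (30 + m * (B + 300 * m ^ 2) + (300 * m ^ 2 + 40 * m + 130) + 4) + 1
        \<le> m * B + 1300 * m ^ 5 + 40 * m + 200" by linarith
    qed (simp add: map_pmf_def)
  qed
  have "realizes (Seq (Fork (Seq (Seq Snd Fst) s) Skip) (Seq ?q1 ?cnt)) (Cell (Num ?k) (Cell ?X ?ab))
    (bind_pmf \<Gamma> (\<lambda>T. map_pmf (\<lambda>c. stage_val lam N t (?S' T) (a * t) (b * c)) (count_pmf \<Gamma> {T'. box_of ?k T' = box_of ?k T} t 1)))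
    (3 + B + (m * B + 1300 * m ^ 5 + 40 * m + 200) + 4)"
  proof (rule realizes_sample[OF _ s inj main])
    show "computes (Seq Snd Fst) (Cell (Num ?k) (Cell ?X ?ab)) ?X 3"
      by (rule computes_weaken, (rule computes_intros)+) auto
  qed
  note R = this
  have "realizes (Stage s) (Cell (Num i) (stage_val lam N t S a b))
     (bind_pmf \<Gamma> (\<lambda>T. map_pmf (\<lambda>c. stage_val lam N t (?S' T) (a * t) (b * c)) (count_pmf \<Gamma> {T'. box_of ?k T' = box_of ?k T} t 1)))
    (5 + 1 + 1 + (3 + B + (m * B + 1300 * m ^ 5 + 40 * m + 200) + 4) + 1)"
    unfolding Stage_def stage_val_def[of _ _ _ S]
    by (rule computes_Suc R computes_intros)+
  then show ?thesis
  proof (rule realizes_weaken)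
    have "1 * B \<le> m * B" using m by (intro mult_right_mono) auto
    moreover have "m \<le> m ^ 5" "1 \<le> m ^ 5" "m * m ^ 4 = m ^ 5" using m by (auto intro: self_le_power simp: eval_nat_numeral)
    moreover have "m * (2 * B + 2000 * m ^ 4) = 2 * (m * B) + 2000 * (m * m ^ 4)" by (simp add: algebra_simps)
    ultimately show "5 + 1 + 1 + (3 + B + (m * B + 1300 * m ^ 5 + 40 * m + 200) + 4) + 1 \<le> m * (2 * B + 2000 * m ^ 4)" by linarith
  qed simp
qed

text \<open>The comparison of the candidate with \<open>N\<close> is for the case
  \<open>k = N\<close>, in which \<open>S\<close> has no values and the search would never
  succeed.\<close>

definition FindK :: prog where
  "FindK = Seq (Fork (Const (Num 0)) Skip) (Seq (While
     (Cond (Seq (Fork (Seq Snd Fst) Fst) Sub)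
       (Cond (Seq (Fork (Seq (Fork Fst (Const (Num 1))) Add) (Seq Snd Snd)) Find) (Const (Num 0)) (Const (Num 1)))
       (Const (Num 0)))
     (Fork (Seq (Fork Fst (Const (Num 1))) Add) Snd)) Fst)"

lemma computes_FindK:
  assumes lam: "partition lam" and S: "pretableau lam N k S" and k: "k \<le> N" and T: "T \<in> SVT_ext lam N S" and m: "k + 1 \<le> m"
  shows "computes FindK (Cell (Num N) (enc_filling lam S)) (Num k) (m * (600 * m ^ 4))"
proof -
  let ?F = "enc_filling lam S"
  let ?find = "Cond (Seq (Fork (Seq (Fork Fst (Const (Num 1))) Add) (Seq Snd Snd)) Find) (Const (Num 0)) (Const (Num 1))"
  let ?test = "Cond (Seq (Fork (Seq Snd Fst) Fst) Sub) ?find (Const (Num 0))"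
  let ?incr = "Fork (Seq (Fork Fst (Const (Num 1))) Add) Snd"
  let ?s = "\<lambda>j. Cell (Num j) (Cell (Num N) ?F)"
  have S': "S b \<subseteq> {k+1..N}" for b
    using pretableau_values[OF S, of _ b] by (auto simp: Suc_le_eq)
  have T': "T \<in> SVT lam N" and le: "le_filling lam S T" using T by (auto simp: SVT_ext_def)
  have mem: "member_val (Suc j) ?F r c \<longleftrightarrow> Suc j \<in> S (Suc r, Suc c)" for j r c
  proof (rule member_val_enc_filling[of lam S N])
    show "S b = {}" if "b \<notin> diagram lam" for b by (rule pretableau_outside[OF S that])
    show "S b \<subseteq> {1..N}" for b using S'[of b] by auto
  qed simp
  have test: "computes ?test (?s j) (Num 1) (400 * m ^ 4 + 40)" if j: "j < k" for j
  proof -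
    have "\<not> member_val (Suc j) ?F r c" for r c
      unfolding mem using S'[of "(Suc r, Suc c)"] j by auto
    then have F: "computes Find (Cell (Num (Suc j)) ?F) (Num 0) (400 * m ^ 4)"
      using computes_Find[of "Suc j" m 0 0 ?F] j m by simp
    show ?thesis
      by (rule computes_weaken, (rule computes_Suc F computes_Cond computes_intros)+) (use j k in auto)
  qed
  have stop: "computes ?test (?s k) (Num 0) (400 * m ^ 4 + 40)"
  proof (cases "k = N")
    case True
    have "computes (Seq (Fork (Seq Snd Fst) Fst) Sub) (?s k) (Num 0) 10"
      by (rule computes_weaken, (rule computes_intros)+) (use True in auto)
    from realizes_Cond[OF this, of "Const (Num 0)" ?find "return_pmf (Num 0)" 1] show ?thesis
      by (rule computes_weaken) (auto simp: computes_Const[simplified])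
  next
    case False
    then have "Suc k \<in> {k+1..N}" using k by simp
    then obtain b where b: "b \<in> diagram lam" "Suc k \<in> S b"
      using S unfolding pretableau_def by blast
    then have "Suc k \<in> T b" using le by (auto simp: le_filling_def)
    \<comment> \<open>The position is bounded through the extension \<open>T\<close>: there
      \<open>Suc k\<close> occupies the same box, and \<open>T\<close> is a full tableau.\<close>
    moreover obtain r c where rc: "b = (Suc r, Suc c)" "r < Suc k" "c < Suc k"
    proof (rule box_of_cases[OF lam T', of "Suc k"])
      fix r c assume "box_of (Suc k) T = (Suc r, Suc c)" "r < Suc k" "c < Suc k"
      then show thesis by (intro that[of r c]) (auto simp: box_of_eq[OF T' \<open>Suc k \<in> T b\<close>])
    qed (use k False in auto)
    have uniq: "member_val (Suc k) ?F r' c' \<longleftrightarrow> r' = r \<and> c' = c" for r' c'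
    proof -
      have "Suc k \<in> S b' \<Longrightarrow> b' = b" for b'
        using SVT_unique[OF T' \<open>Suc k \<in> T b\<close>, of b'] le pretableau_outside[OF S, of b'] unfolding le_filling_def by blast
      from this[of "(Suc r', Suc c')"] show ?thesis unfolding mem using b(2) rc(1) by auto
    qed
    have F: "computes Find (Cell (Num (Suc k)) ?F) (Cell (Num r) (Num c)) (400 * m ^ 4)"
      using computes_Find[of "Suc k" m r c ?F] rc m uniq by auto
    show ?thesis
      by (rule computes_weaken, (rule computes_Suc F computes_Cond computes_intros)+) auto
  qed
  have W: "computes (While ?test ?incr) (?s 0) (?s k) (k * (400 * m ^ 4 + 40 + 10 + 1) + (400 * m ^ 4 + 40) + 1)"
  proof (rule computes_While[where s = ?s and x = "\<lambda>_. Num 1" and n = k])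
    show "computes ?incr (?s i) (?s (Suc i)) 10" for i
      by (rule computes_weaken, (rule computes_Suc computes_intros)+) auto
  qed (use test stop in auto)
  have "k * (400 * m ^ 4 + 40 + 10 + 1) + (400 * m ^ 4 + 40) + 1 + 10 \<le> (k + 1) * (400 * m ^ 4 + 51)" by simp
  also have "\<dots> \<le> m * (400 * m ^ 4 + 51)" using m by (intro mult_right_mono) auto
  also have "\<dots> \<le> m * (600 * m ^ 4)"
  proof (rule mult_left_mono)
    have "1 \<le> m ^ 4" using m by simp
    then show "400 * m ^ 4 + 51 \<le> 600 * m ^ 4" by linarith
  qed simp
  finally have T: "k * (400 * m ^ 4 + 40 + 10 + 1) + (400 * m ^ 4 + 40) + 1 + 10 \<le> m * (600 * m ^ 4)" .
  show ?thesis
    unfolding FindK_def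
    by (rule computes_weaken, (rule W computes_intros)+, rule refl) (use T in linarith)
qed

definition Cube :: prog where
  "Cube = Seq (Fork Skip (Seq (Fork Skip Skip) Mul)) Mul"

lemma computes_Cube: "computes Cube (Num x) (Num (x ^ 3)) (x * 40 + 40)"
  unfolding Cube_def
  by (rule computes_weaken, (rule computes_Mul computes_intros)+) (auto simp: power3_eq_cube)

text \<open>The ninth power is the cube of the cube. Its computation takes time proportional to a
  power of the result's parameters, which is affordable since that many samples are drawn
  anyway.\<close>

definition SampleSize :: prog where
  "SampleSize = Seq (Fork (Const (Num 131072))
     (Seq (Fork (Seq Fst (Seq Cube Cube)) (Seq (Seq Snd (Fork Skip Skip)) Mul)) Mul)) Mul"

lemma computes_SampleSize:
  assumes m: "131072 * (k + 1) ^ 9 * (e + 1) ^ 2 \<le> m"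
  shows "computes SampleSize (Cell (Num k) (Num e)) (Num (131072 * k ^ 9 * e ^ 2)) (200 * m)"
proof -
  have k9: "(k ^ 3) ^ 3 = k ^ 9" by (simp flip: power_mult)
  have K: "k ^ 9 \<le> (k + 1) ^ 9" "1 \<le> (k + 1) ^ 9" "k ^ 3 \<le> (k + 1) ^ 9" "k \<le> (k + 1) ^ 9"
    using order_trans[OF power_mono[of k "k + 1" 3] power_increasing[of 3 9 "k + 1"]]
      order_trans[of k "k + 1", OF _ self_le_power[of "k + 1" 9]] power_mono[of k "k + 1" 9]
    by simp_all
  have E: "1 \<le> (e + 1) ^ 2" "e \<le> (e + 1) ^ 2" by (auto simp: power2_eq_square)
  have *: "x * y \<le> (k + 1) ^ 9 * (e + 1) ^ 2" if "x \<le> (k + 1) ^ 9" "y \<le> (e + 1) ^ 2" for x y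
    using that by (rule mult_le_mono)
  have m': "131072 * ((k + 1) ^ 9 * (e + 1) ^ 2) \<le> m" using m by (simp add: mult.assoc)
  note ineqs = *[OF K(1) E(1)] *[OF K(3) E(1)] *[OF K(4) E(1)] *[OF K(2) E(1)] *[OF K(2) E(2)]
  have "x \<le> m div 131072" if "x * 1 \<le> (k + 1) ^ 9 * (e + 1) ^ 2 \<or> 1 * x \<le> (k + 1) ^ 9 * (e + 1) ^ 2" for x
    using that m' by (auto simp: less_eq_div_iff_mult_less_eq)
  then have "k ^ 9 \<le> m div 131072" "k ^ 3 \<le> m div 131072" "k \<le> m div 131072" "1 \<le> m div 131072" "e \<le> m div 131072"
    using ineqs by blast+
  then have b: "131072 * k ^ 9 \<le> m" "131072 * k ^ 3 \<le> m" "131072 * k \<le> m" "131072 \<le> m" "131072 * e \<le> m"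
    by auto
  show ?thesis
    unfolding SampleSize_def
    by (rule computes_weaken, (rule computes_Mul computes_Cube computes_intros)+, simp only: k9 power2_eq_square mult.assoc)
      (use b k9 in \<open>simp add: algebra_simps\<close>)
qed

text \<open>If c/t were exactly f'/f, then f a/b would equal f' (a t)/(b c). The ratio of these two
  numbers is the true probability divided by its estimate, which gives the two factors.\<close>

lemma estimate_step:
  fixes f f' \<eta> :: real and a b c t :: nat
  assumes pos: "0 < f" "0 < f'" "0 < a" "0 < b" "0 < c" "0 < t" and \<eta>: "0 < \<eta>" "\<eta> < 1"
    and dev: "\<bar>real c / real t - f' / f\<bar> \<le> \<eta> * (f' / f)"
  shows "f * real a / real b / (1 + \<eta>) \<le> f' * real (a * t) / real (b * c)"
    "f' * real (a * t) / real (b * c) \<le> f * real a / real b / (1 - \<eta>)"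
proof -
  define x where "x = real c / real t"
  define p where "p = f' / f"
  have xp: "0 < x" "0 < p" using pos by (auto simp: x_def p_def)
  have "\<bar>x - p\<bar> \<le> \<eta> * p" using dev unfolding x_def p_def .
  then have "x - p \<le> \<eta> * p" "p - x \<le> \<eta> * p" unfolding abs_le_iff by simp_all
  then have xp': "x \<le> p * (1 + \<eta>)" "p * (1 - \<eta>) \<le> x" by (simp_all add: algebra_simps)
  have eq: "f' * real (a * t) / real (b * c) = (f * real a / real b) * (p / x)"
    using pos by (simp add: x_def p_def field_simps)
  have W: "0 \<le> f * real a / real b" using pos by simp
  have "1 / (1 + \<eta>) \<le> p / x" "p / x \<le> 1 / (1 - \<eta>)"
    using xp xp' \<eta> by (auto simp: field_simps)
  from mult_left_mono[OF this(1) W] mult_left_mono[OF this(2) W]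
  show "f * real a / real b / (1 + \<eta>) \<le> f' * real (a * t) / real (b * c)"
    "f' * real (a * t) / real (b * c) \<le> f * real a / real b / (1 - \<eta>)"
    unfolding eq by simp_all
qed

text \<open>An instance of \<open>class_estimation\<close> in which the class of a tableau is its
  box of \<open>Suc k\<close>. The budget refers to a common bound \<open>K\<close>, so the same
  \<open>t\<close>, \<open>\<theta>\<close> and \<open>y\<close> serve every stage.\<close>

lemma stage_error:
  fixes K :: nat and \<eta> \<theta> y \<beta> :: real
  assumes lam: "partition lam" and S: "pretableau lam N (Suc k) S" and k: "Suc k \<le> N" "Suc k \<le> K"
    and ne: "SVT_ext lam N S \<noteq> {}"
    and \<Gamma>: "set_pmf \<Gamma> \<subseteq> SVT_ext lam N S" "tv_dist \<Gamma> (pmf_of_set (SVT_ext lam N S)) \<le> 1 / real t"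
    and t: "0 < t" "0 \<le> y" "0 < \<theta>" "0 < \<eta>" "y + 1 / real t + 1 / real t \<le> \<eta> * \<theta>"
    and \<beta>: "real (K * K) * \<theta> + 1 / real t + 2 * exp (- 2 * real t * y\<^sup>2) \<le> \<beta>"
  shows "measure_pmf.prob (bind_pmf \<Gamma> (\<lambda>T. map_pmf (\<lambda>c. stage_val lam N t (S(box_of (Suc k) T := insert (Suc k) (S (box_of (Suc k) T)))) (a * t) (b * c))
      (count_pmf \<Gamma> {T'. box_of (Suc k) T' = box_of (Suc k) T} t 1)))
    {v. \<not> (\<exists>S' c. v = stage_val lam N t S' (a * t) (b * c) \<and> 0 < c \<and> pretableau lam N k S' \<and> le_filling lam S S' \<and>
       SVT_ext lam N S' \<noteq> {} \<and>
       \<bar>real c / real t - real (num_SVT lam N S') / real (num_SVT lam N S)\<bar> \<le> \<eta> * (real (num_SVT lam N S') / real (num_SVT lam N S)))}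
    \<le> \<beta>" (is "measure_pmf.prob ?D ?bad \<le> _")
proof -
  let ?E = "SVT_ext lam N S" and ?pos = "box_of (Suc k)"
  let ?ins = "\<lambda>b'. S(b' := insert (Suc k) (S b'))"
  let ?p = "\<lambda>b'. real (card {T \<in> ?E. ?pos T = b'}) / real (card ?E)"
  let ?P = "{1..Suc k} \<times> {1..Suc k}"
  let ?B = "bind_pmf \<Gamma> (\<lambda>T. map_pmf (Pair (?pos T)) (count_pmf \<Gamma> {T'. ?pos T' = ?pos T} t 1))"
  have D: "?D = map_pmf (\<lambda>(b', c). stage_val lam N t (?ins b') (a * t) (b * c)) ?B"
    by (simp add: map_bind_pmf pmf.map_comp comp_def)
  have P: "?pos ` ?E \<subseteq> ?P"
  proof (rule image_subsetI)
    fix T assume "T \<in> ?E"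
    then have "T \<in> SVT lam N" by (simp add: SVT_ext_def)
    then show "?pos T \<in> ?P" by (rule box_of_mem(2)[OF lam]) (use k in auto)
  qed
  \<comment> \<open>By the self-reduction the class probability is the ratio of the two numbers of
    extensions. All other parts of the good event hold for every outcome, so failure can only mean a
    large deviation.\<close>
  have good: "stage_val lam N t (?ins (fst z)) (a * t) (b * snd z) \<in> ?bad \<longrightarrow> \<eta> * ?p (fst z) < \<bar>real (snd z) / real t - ?p (fst z)\<bar>"
    if z: "z \<in> set_pmf ?B" for z
  proof -
    obtain T c where T: "T \<in> set_pmf \<Gamma>" and c: "c \<in> set_pmf (count_pmf \<Gamma> {T'. ?pos T' = ?pos T} t 1)" and z: "z = (?pos T, c)"
      using z by auto
    have TE: "T \<in> ?E" and T': "T \<in> SVT lam N" using T \<Gamma>(1) by (auto simp: SVT_ext_def)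
    have b: "Suc k \<in> T (?pos T)"
      by (rule box_of_mem(1)[OF lam T']) (use k in auto)
    note ins = insert_position[OF S k(1) lam TE b]
    have "SVT_ext lam N (?ins (?pos T)) = {T' \<in> ?E. ?pos T' = ?pos T}"
      unfolding ins(4)
    proof (intro Collect_cong conj_cong refl)
      fix T'' assume "T'' \<in> ?E"
      then have T'': "T'' \<in> SVT lam N" by (simp add: SVT_ext_def)
      then have "Suc k \<in> T'' (?pos T'')"
        by (intro box_of_mem(1)[OF lam]) (use k in auto)
      then show "Suc k \<in> T'' (?pos T) \<longleftrightarrow> ?pos T'' = ?pos T" using box_of_eq[OF T''] by metis
    qed
    then have p: "?p (?pos T) = real (num_SVT lam N (?ins (?pos T))) / real (num_SVT lam N S)"
      by (simp add: num_SVT_def)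
    have "stage_val lam N t (?ins (?pos T)) (a * t) (b * c) \<notin> ?bad"
      if "\<bar>real c / real t - ?p (?pos T)\<bar> \<le> \<eta> * ?p (?pos T)"
      unfolding mem_Collect_eq not_not
    proof (intro exI[of _ "?ins (?pos T)"] exI[of _ c] conjI refl)
      show "0 < c" using set_count_pmf[OF c] by simp
      show "SVT_ext lam N (?ins (?pos T)) \<noteq> {}" using ins(3) by blast
    qed (use ins that[unfolded p] in auto)
    then show ?thesis unfolding z fst_conv snd_conv by (meson not_less)
  qed
  have "measure_pmf.prob ?D ?bad = measure_pmf.prob ?B ((\<lambda>(b', c). stage_val lam N t (?ins b') (a * t) (b * c)) -` ?bad)"
    unfolding D by simp
  also have "\<dots> \<le> measure_pmf.prob ?B {(b', c). \<eta> * ?p b' < \<bar>real c / real t - ?p b'\<bar>}"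
    by (rule measure_pmf.finite_measure_mono_AE) (use good in \<open>auto simp: AE_measure_pmf_iff case_prod_beta\<close>)
  also have "\<dots> \<le> (real (card ?P) * \<theta> + 1 / real t) + 2 * exp (- 2 * real t * y\<^sup>2)"
    by (rule class_estimation[OF finite_SVT_ext ne \<Gamma> P]) (use t in auto)
  also have "\<dots> \<le> \<beta>"
  proof -
    have "real (card ?P) * \<theta> \<le> real (K * K) * \<theta>"
      using k t by (intro mult_right_mono) (auto simp: card_cartesian_product simp flip: of_nat_mult intro: mult_le_mono simp del: mult_Suc mult_Suc_right of_nat_Suc)
    then show ?thesis using \<beta> by linarith
  qed
  finally show ?thesis .
qed

text \<open>The test looks at the code of the list of parts, which is \<open>Num 0\<close> exactly
  for the empty shape. The fraction starts as 1/1; once all values are placed a single extension is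
  left, so a/b then approximates the original number.\<close>

definition Estimate :: "prog \<Rightarrow> prog" where
  "Estimate s = Cond (Seq Fst Fst)
     (Seq (Fork (Fork (Seq (Seq Fst Snd) FindK) (Seq Snd CeilDiv)) Skip)
     (Seq (Fork (Seq Fst SampleSize) Skip)
     (Seq (Fork (Seq Snd (Seq Fst Fst)) (Fork (Fork (Seq Snd (Seq Snd Fst)) (Fork (Const (Num 1)) Fst)) (Const (Cell (Num 1) (Num 1)))))
     (Seq (For (Stage s)) (Seq Snd Snd)))))
     (Fork (Seq (Fork (Const (Num 1)) (Seq Fst (Seq Snd Fst))) Sub) (Const (Num 1)))"

lemma computes_Estimate_Nil:
  "computes (Estimate s) (Cell (enc_inst ([], N, S)) v) (Cell (Num (1 - N)) (Num 1)) 30"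
proof -
  have b: "computes (Seq Fst Fst) (Cell (enc_inst ([], N, S)) v) (Num 0) 3"
    by (simp only: enc_inst.simps enc_list_def list.map foldr.simps id_apply) (rule computes_weaken, (rule computes_intros)+, auto)
  have "computes (Fork (Seq (Fork (Const (Num 1)) (Seq Fst (Seq Snd Fst))) Sub) (Const (Num 1)))
    (Cell (enc_inst ([], N, S)) v) (Cell (Num (1 - N)) (Num 1)) 20"
    unfolding enc_inst.simps by (rule computes_weaken, (rule computes_intros)+) auto
  then show ?thesis
    unfolding Estimate_def by (intro realizes_weaken[OF realizes_Cond[OF b]]) auto
qed

lemma realizes_Estimate:
  assumes lam: "partition lam" "lam \<noteq> []" and S: "pretableau lam N k S" and k: "k \<le> N" and T: "T \<in> SVT_ext lam N S"
    and e: "computes CeilDiv v (Num e) (e * 30 + 20)"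
    and m: "131072 * (k + 1) ^ 9 * (e + 1) ^ 2 \<le> m"  "k + 1 \<le> m" "e \<le> m"
    and loop: "realizes (For (Stage s)) (Cell (Num k) (stage_val lam N (131072 * k ^ 9 * e ^ 2) S 1 1)) D L"
    and out: "\<And>v. v \<in> set_pmf D \<Longrightarrow> \<exists>S' a b. v = Cell (Num 0) (stage_val lam N t S' a b)"
  shows "realizes (Estimate s) (Cell (enc_inst (lam, N, S)) v) (map_pmf (\<lambda>v. snd_val (snd_val v)) D)
    (L + m * (600 * m ^ 4) + 230 * m + 100)"
proof -
  have "realizes (Seq (For (Stage s)) (Seq Snd Snd)) (Cell (Num k) (stage_val lam N (131072 * k ^ 9 * e ^ 2) S 1 1))
    (bind_pmf D (\<lambda>v. return_pmf (snd_val (snd_val v)))) (L + 3 + 1)"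
  proof (rule realizes_Seq[OF loop])
    fix v assume "v \<in> set_pmf D"
    then obtain S' a b where v: "v = Cell (Num 0) (stage_val lam N t S' a b)" using out by blast
    show "computes (Seq Snd Snd) v (snd_val (snd_val v)) 3"
      unfolding v stage_val_def by (rule computes_weaken, (rule computes_intros)+) auto
  qed
  note L = this[unfolded stage_val_def enc_inst.simps]
  obtain x y where xy: "enc_list (map Num lam) = Cell x y" using lam(2) by (cases lam) (auto simp: enc_list_def)
  note rules = computes_FindK[OF lam(1) S k T m(2)] e computes_SampleSize[OF m(1)] L
  have b: "computes (Seq Fst Fst) (Cell (enc_inst (lam, N, S)) v) (Cell x y) 3"
    unfolding enc_inst.simps xy by (rule computes_weaken, (rule computes_intros)+) auto
  have "realizes (Seq (Fork (Fork (Seq (Seq Fst Snd) FindK) (Seq Snd CeilDiv)) Skip)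
     (Seq (Fork (Seq Fst SampleSize) Skip)
     (Seq (Fork (Seq Snd (Seq Fst Fst)) (Fork (Fork (Seq Snd (Seq Snd Fst)) (Fork (Const (Num 1)) Fst)) (Const (Cell (Num 1) (Num 1)))))
     (Seq (For (Stage s)) (Seq Snd Snd))))) (Cell (enc_inst (lam, N, S)) v)
     (bind_pmf D (\<lambda>v. return_pmf (snd_val (snd_val v)))) (L + m * (600 * m ^ 4) + 230 * m + 90)"
    unfolding enc_inst.simps
    by (rule realizes_weaken, (rule rules computes_intros)+, rule refl) (use m in linarith)
  then show ?thesis
    unfolding Estimate_def by (intro realizes_weaken[OF realizes_Cond[OF b]]) (auto simp: map_pmf_def)
qed

text \<open>Errors multiply and failure probabilities add up over the stages. The form of the output
  with a positive denominator is claimed for the whole support, the accuracy only with high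
  probability.\<close>

lemma estimate_loop:
  fixes \<eta> \<theta> y \<beta> :: real
  assumes lam: "partition lam" and F: "downwardly_stable F" and m: "K + 1 \<le> m" "t + 2 \<le> m"
    and sampler: "\<And>k S. 1 \<le> k \<Longrightarrow> k \<le> K \<Longrightarrow> k \<le> N \<Longrightarrow> pretableau lam N k S \<Longrightarrow> (lam, N, S) \<in> F \<Longrightarrow> SVT_ext lam N S \<noteq> {} \<Longrightarrow>
      \<exists>\<Gamma>. set_pmf \<Gamma> \<subseteq> SVT_ext lam N S \<and> tv_dist \<Gamma> (pmf_of_set (SVT_ext lam N S)) \<le> 1 / real t \<and>
        realizes s (Cell (enc_inst (lam, N, S)) (Cell (Num 1) (Num t))) (map_pmf (enc_filling lam) \<Gamma>) B"
    and t: "0 < t" "0 \<le> y" "0 < \<theta>" "0 < \<eta>" "\<eta> < 1" "y + 1 / real t + 1 / real t \<le> \<eta> * \<theta>"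
    and \<beta>: "real (K * K) * \<theta> + 1 / real t + 2 * exp (- 2 * real t * y\<^sup>2) \<le> \<beta>" "0 \<le> \<beta>"
  shows "k \<le> K \<Longrightarrow> k \<le> N \<Longrightarrow> pretableau lam N k S \<Longrightarrow> (lam, N, S) \<in> F \<Longrightarrow> SVT_ext lam N S \<noteq> {} \<Longrightarrow> 0 < a \<Longrightarrow> 0 < b \<Longrightarrow>
    \<exists>D. realizes (For (Stage s)) (Cell (Num k) (stage_val lam N t S a b)) D (k * (m * (2 * B + 2000 * m ^ 4) + 12) + 2) \<and>
      (\<forall>v\<in>set_pmf D. \<exists>S' a' b'. 0 < b' \<and> v = Cell (Num 0) (stage_val lam N t S' a' b')) \<and>
      measure_pmf.prob D {v. \<not> (\<exists>S' a' b'. 0 < b' \<and> v = Cell (Num 0) (stage_val lam N t S' a' b') \<and>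
        real (num_SVT lam N S) * real a / real b / (1 + \<eta>) ^ k \<le> real a' / real b' \<and>
        real a' / real b' \<le> real (num_SVT lam N S) * real a / real b / (1 - \<eta>) ^ k)} \<le> real k * \<beta>"
proof (induction k arbitrary: S a b)
  case 0
  have f: "num_SVT lam N S = 1" by (rule ext_pretableau_0) (use 0 in auto)
  let ?v = "Cell (Num 0) (stage_val lam N t S a b)"
  have "computes (For (Stage s)) ?v ?v 2" by (rule realizes_For_0)
  moreover have "?v \<notin> {v. \<not> (\<exists>S' a' b'. 0 < b' \<and> v = Cell (Num 0) (stage_val lam N t S' a' b') \<and>
        real (num_SVT lam N S) * real a / real b / (1 + \<eta>) ^ 0 \<le> real a' / real b' \<and>
        real a' / real b' \<le> real (num_SVT lam N S) * real a / real b / (1 - \<eta>) ^ 0)}"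
    using 0 f by auto
  ultimately have "measure_pmf.prob (return_pmf ?v) {v. \<not> (\<exists>S' a' b'. 0 < b' \<and> v = Cell (Num 0) (stage_val lam N t S' a' b') \<and>
        real (num_SVT lam N S) * real a / real b / (1 + \<eta>) ^ 0 \<le> real a' / real b' \<and>
        real a' / real b' \<le> real (num_SVT lam N S) * real a / real b / (1 - \<eta>) ^ 0)} \<le> real 0 * \<beta>"
    "computes (For (Stage s)) ?v ?v (0 * (m * (2 * B + 2000 * m ^ 4) + 12) + 2)"
    by (simp_all only: measure_return_pmf indicator_simps mult_0 add_0) simp
  then show ?case
    using 0 by (intro exI[of _ "return_pmf ?v"] conjI) (assumption | force)+
next
  case (Suc k)
  note prems = Suc.prems
  let ?f = "\<lambda>S. real (num_SVT lam N S)"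
  let ?good = "\<lambda>k S a b v. \<exists>S' a' b'. 0 < b' \<and> v = Cell (Num 0) (stage_val lam N t S' a' b') \<and>
        ?f S * real a / real b / (1 + \<eta>) ^ k \<le> real a' / real b' \<and>
        real a' / real b' \<le> ?f S * real a / real b / (1 - \<eta>) ^ k"
  let ?out = "\<lambda>v. \<exists>S' a' b'. 0 < b' \<and> v = Cell (Num 0) (stage_val lam N t S' a' b')"
  let ?T = "k * (m * (2 * B + 2000 * m ^ 4) + 12) + 2"
  obtain \<Gamma> where \<Gamma>: "set_pmf \<Gamma> \<subseteq> SVT_ext lam N S" "tv_dist \<Gamma> (pmf_of_set (SVT_ext lam N S)) \<le> 1 / real t"
    and s: "realizes s (Cell (enc_inst (lam, N, S)) (Cell (Num 1) (Num t))) (map_pmf (enc_filling lam) \<Gamma>) B"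
    using sampler[of "Suc k" S] prems by auto
  let ?ins = "\<lambda>T. S(box_of (Suc k) T := insert (Suc k) (S (box_of (Suc k) T)))"
  define D where "D = bind_pmf \<Gamma> (\<lambda>T. map_pmf (\<lambda>c. stage_val lam N t (?ins T) (a * t) (b * c))
      (count_pmf \<Gamma> {T'. box_of (Suc k) T' = box_of (Suc k) T} t 1))"
  have R: "realizes (Stage s) (Cell (Num k) (stage_val lam N t S a b)) D (m * (2 * B + 2000 * m ^ 4))"
    unfolding D_def by (rule realizes_Stage[OF lam prems(3,2) \<Gamma>(1) s]) (use m prems in auto)
  let ?next = "\<lambda>v S' c. v = stage_val lam N t S' (a * t) (b * c) \<and> 0 < c \<and> pretableau lam N k S' \<and> le_filling lam S S' \<and> SVT_ext lam N S' \<noteq> {}"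
  define A where "A = {v. \<not> (\<exists>S' c. v = stage_val lam N t S' (a * t) (b * c) \<and> 0 < c \<and> pretableau lam N k S' \<and> le_filling lam S S' \<and>
       SVT_ext lam N S' \<noteq> {} \<and> \<bar>real c / real t - ?f S' / ?f S\<bar> \<le> \<eta> * (?f S' / ?f S))}"
  have A: "measure_pmf.prob D A \<le> \<beta>"
    unfolding A_def D_def by (rule stage_error[OF lam prems(3,2,1,5) \<Gamma> _ _ _ _ _ \<beta>(1)]) (use t in auto)
  \<comment> \<open>Outcomes in \<open>A\<close> are included: even a bad estimate leaves a valid
    state, so the induction hypothesis still yields running time and output form.\<close>
  have successor: "\<exists>S' c. ?next v S' c" if v: "v \<in> set_pmf D" for v
  proof -
    obtain T c where T: "T \<in> set_pmf \<Gamma>" and c: "c \<in> set_pmf (count_pmf \<Gamma> {T'. box_of (Suc k) T' = box_of (Suc k) T} t 1)"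
      and v: "v = stage_val lam N t (?ins T) (a * t) (b * c)"
      using v unfolding D_def by auto
    have TE: "T \<in> SVT_ext lam N S" "T \<in> SVT lam N" using T \<Gamma>(1) by (auto simp: SVT_ext_def)
    have "Suc k \<in> T (box_of (Suc k) T)" by (rule box_of_mem(1)[OF lam TE(2)]) (use prems in auto)
    note ins = insert_position[OF prems(3,2) lam TE(1) this]
    show ?thesis
      using ins(1-3) set_count_pmf[OF c] v by (intro exI[of _ "?ins T"] exI[of _ c]) auto
  qed
  have IH: "\<exists>E. realizes (For (Stage s)) (Cell (Num k) v) E ?T \<and> (\<forall>w\<in>set_pmf E. ?out w) \<and>
      measure_pmf.prob E {w. \<not> ?good k S' (a * t) (b * c) w} \<le> real k * \<beta>" if "?next v S' c" for v S' c
  proof -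
    \<comment> \<open>Downward stability enters here and keeps the next instance within the domain
      of the sampler.\<close>
    have "(lam, N, S') \<in> F" by (rule downwardly_stableD[OF F prems(4), of k]) (use prems(2) that in auto)
    moreover have "v = stage_val lam N t S' (a * t) (b * c)" using that by blast
    ultimately show ?thesis
      by (simp only:) (rule Suc.IH, use prems(1,2,6,7) t(1) that in simp_all)
  qed
  have "\<exists>E. realizes (For (Stage s)) (Cell (Num k) v) E ?T \<and> (\<forall>w\<in>set_pmf E. ?out w) \<and>
      (v \<notin> A \<longrightarrow> measure_pmf.prob E {w. \<not> ?good (Suc k) S a b w} \<le> real k * \<beta>)" if v: "v \<in> set_pmf D" for v
  proof (cases "v \<in> A")
    case True
    then show ?thesis using successor[OF v] IH by blast
  next
    case False
    then obtain S' c where n: "?next v S' c" and dev: "\<bar>real c / real t - ?f S' / ?f S\<bar> \<le> \<eta> * (?f S' / ?f S)"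
      unfolding A_def by blast
    obtain E where E: "realizes (For (Stage s)) (Cell (Num k) v) E ?T" "\<forall>w\<in>set_pmf E. ?out w"
      "measure_pmf.prob E {w. \<not> ?good k S' (a * t) (b * c) w} \<le> real k * \<beta>"
      using IH[OF n] by blast
    have fpos: "0 < ?f S" "0 < ?f S'"
      using prems(5) n finite_SVT_ext by (auto simp: num_SVT_def card_gt_0_iff)
    note step = estimate_step[OF fpos prems(6,7) _ t(1,4,5) dev]
    have "{w. \<not> ?good (Suc k) S a b w} \<subseteq> {w. \<not> ?good k S' (a * t) (b * c) w}"
    proof (intro Collect_mono impI, elim contrapos_nn)
      fix w assume "?good k S' (a * t) (b * c) w"
      then obtain S'' a' b' where w: "0 < b'" "w = Cell (Num 0) (stage_val lam N t S'' a' b')"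
        "?f S' * real (a * t) / real (b * c) / (1 + \<eta>) ^ k \<le> real a' / real b'"
        "real a' / real b' \<le> ?f S' * real (a * t) / real (b * c) / (1 - \<eta>) ^ k" by blast
      have "?f S * real a / real b / (1 + \<eta>) / (1 + \<eta>) ^ k \<le> ?f S' * real (a * t) / real (b * c) / (1 + \<eta>) ^ k"
        using step(1) n t by (intro divide_right_mono) auto
      moreover have "?f S' * real (a * t) / real (b * c) / (1 - \<eta>) ^ k \<le> ?f S * real a / real b / (1 - \<eta>) / (1 - \<eta>) ^ k"
        using step(2) n t by (intro divide_right_mono) auto
      ultimately have "?f S * real a / real b / (1 + \<eta>) ^ Suc k \<le> real a' / real b'"
        "real a' / real b' \<le> ?f S * real a / real b / (1 - \<eta>) ^ Suc k"
        using w(3,4) unfolding power_Suc divide_divide_eq_left by linarith+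
      then show "?good (Suc k) S a b w" using w(1,2) by blast
    qed
    then have "measure_pmf.prob E {w. \<not> ?good (Suc k) S a b w} \<le> measure_pmf.prob E {w. \<not> ?good k S' (a * t) (b * c) w}"
      by (intro measure_pmf.finite_measure_mono) auto
    then show ?thesis using E by (intro exI[of _ E]) linarith
  qed
  note ex = this
  have "\<exists>E. \<forall>v\<in>set_pmf D. realizes (For (Stage s)) (Cell (Num k) v) (E v) ?T \<and>
      (\<forall>w\<in>set_pmf (E v). ?out w) \<and>
      (v \<notin> A \<longrightarrow> measure_pmf.prob (E v) {w. \<not> ?good (Suc k) S a b w} \<le> real k * \<beta>)"
    by (rule bchoice, rule ballI, rule ex)
  then obtain E where E': "\<forall>v\<in>set_pmf D. realizes (For (Stage s)) (Cell (Num k) v) (E v) ?T \<and>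
      (\<forall>w\<in>set_pmf (E v). ?out w) \<and>
      (v \<notin> A \<longrightarrow> measure_pmf.prob (E v) {w. \<not> ?good (Suc k) S a b w} \<le> real k * \<beta>)" ..
  note E = E'[THEN bspec, THEN conjunct1] E'[THEN bspec, THEN conjunct2, THEN conjunct1]
    E'[THEN bspec, THEN conjunct2, THEN conjunct2, THEN mp]
  have "realizes (For (Stage s)) (Cell (Num (Suc k)) (stage_val lam N t S a b)) (bind_pmf D E)
    (Suc k * (m * (2 * B + 2000 * m ^ 4) + 12) + 2)"
    by (rule realizes_weaken[OF realizes_For_Suc[OF R E(1)]]) auto
  moreover have "measure_pmf.prob (bind_pmf D E) {w. \<not> ?good (Suc k) S a b w} \<le> \<beta> + real k * \<beta>"
    by (rule prob_bind_le[OF A E(3)]) (use \<beta> in auto)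
  moreover have "\<forall>v\<in>set_pmf (bind_pmf D E). ?out v" using E(2) by auto
  ultimately show ?case
    by (intro exI[of _ "bind_pmf D E"]) (simp add: distrib_right)
qed

section \<open>Polynomial time bounds\<close>

lemma poly3_le:
  assumes "0 \<le> x" "x \<le> M" "0 \<le> y" "y \<le> M" "0 \<le> z" "z \<le> M"
  shows "poly3 a n x y z \<le> (\<Sum>i\<le>n. \<Sum>j\<le>n. \<Sum>l\<le>n. \<bar>a i j l\<bar>) * (1 + M) ^ (3 * n)"
  unfolding poly3_def sum_distrib_right
proof (intro sum_mono)
  fix i j l assume ijl: "i \<in> {..n}" "j \<in> {..n}" "l \<in> {..n}"
  have p: "0 \<le> u ^ i \<and> u ^ i \<le> (1 + M) ^ n" if "0 \<le> u" "u \<le> M" "i \<le> n" for u i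
    using that power_mono[of u "1 + M" i] power_increasing[of i n "1 + M"] by force
  \<comment> \<open>Coefficients may be negative, so \<open>poly3\<close> need not be monotone;
    absolute values turn it into a bound that fits all stages.\<close>
  have "a i j l * x ^ i * y ^ j * z ^ l \<le> \<bar>a i j l\<bar> * (x ^ i * y ^ j * z ^ l)"
    using assms by (simp add: mult.assoc) (intro mult_right_mono, auto)
  also have "\<dots> \<le> \<bar>a i j l\<bar> * ((1 + M) ^ n * (1 + M) ^ n * (1 + M) ^ n)"
    using assms ijl p by (intro mult_left_mono mult_mono) auto
  also have "(1 + M) ^ n * (1 + M) ^ n * (1 + M) ^ n = (1 + M) ^ (3 * n)"
    by (simp flip: power_add add: mult.commute numeral_3_eq_3)
  finally show "a i j l * x ^ i * y ^ j * z ^ l \<le> \<bar>a i j l\<bar> * (1 + M) ^ (3 * n)" .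
qed

text \<open>The binomial theorem in each variable brings a product bound into the prescribed
  polynomial form.\<close>

lemma poly3_product:
  "poly3 (\<lambda>i j l. C * (real (n choose i) * real (n choose j) * real (n choose l))) n x y z
    = C * ((1 + x) ^ n * ((1 + y) ^ n * (1 + z) ^ n))"
proof -
  have b: "(1 + u) ^ n = (\<Sum>i\<le>n. real (n choose i) * u ^ i)" for u :: real
    using binomial_ring[of u 1 n] by (simp add: add.commute)
  show ?thesis
    unfolding poly3_def b unfolding sum_product unfolding sum_distrib_left
    by (intro sum.cong refl) (simp add: mult_ac)
qed

lemma FPRAS_run:
  assumes lam: "partition lam" "lam \<noteq> []" and F: "downwardly_stable F" and S: "pretableau lam N k S" "k \<le> N" "(lam, N, S) \<in> F"
    and \<epsilon>: "0 < \<epsilon>" "\<epsilon> \<le> 1" "represents v \<epsilon>"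
    and p: "\<And>k S. k \<le> N \<Longrightarrow> pretableau lam N k S \<Longrightarrow> (lam, N, S) \<in> F \<Longrightarrow> SVT_ext lam N S \<noteq> {} \<Longrightarrow>
     (\<forall>\<delta> d. 0 < \<delta> \<and> \<delta> < 1 \<and> represents d \<delta> \<longrightarrow>
        runs_within p (Cell (enc_inst (lam, N, S)) d)
          (poly3 a n (real k) (real (card (empty_boxes lam S))) (ln (1 / \<delta>))) \<and>
        (\<exists>\<Gamma>. set_pmf \<Gamma> \<subseteq> SVT_ext lam N S \<and>
           tv_dist \<Gamma> (pmf_of_set (SVT_ext lam N S)) \<le> \<delta> \<and>
           output_dist p (Cell (enc_inst (lam, N, S)) d) =
             spmf_of_pmf (map_pmf (enc_filling lam) \<Gamma>)))"
    and A: "(\<Sum>i\<le>n. \<Sum>j\<le>n. \<Sum>l\<le>n. \<bar>a i j l\<bar>) \<le> real A"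
  obtains D B where "realizes (Estimate p) (Cell (enc_inst (lam, N, S)) v) D B"
    "real B \<le> 3000 * (real A + 1) * (2 ^ 20) ^ (3 * n + 6) * ((1 + real k) * (1 + 1 / \<epsilon>)) ^ (9 * (3 * n + 6))"
    "\<And>y. y \<in> set_pmf D \<Longrightarrow> \<exists>x. represents y x"
    "3 / 4 \<le> measure_pmf.prob D {y. \<exists>x. represents y x \<and>
       (1 - \<epsilon>) * real (num_SVT lam N S) \<le> x \<and> x \<le> (1 + \<epsilon>) * real (num_SVT lam N S)}"
proof -
  obtain ea eb where v: "v = Cell (Num ea) (Num eb)" "0 < eb" "\<epsilon> = real ea / real eb"
    using \<epsilon>(3) by (auto simp: represents_def)
  have ea: "0 < ea" using v \<epsilon>(1) by (cases ea) auto
  obtain e where e: "computes CeilDiv v (Num e) (e * 30 + 20)" "eb \<le> e * ea" "e * ea < eb + ea"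
    using computes_CeilDiv[OF ea, of eb] unfolding v(1) .
  have "real eb \<le> real e * real ea" using e(2) by (simp flip: of_nat_mult)
  then have "1 \<le> real ea / real eb * real e" using v(2) by (simp add: field_simps)
  then have \<epsilon>e: "1 \<le> \<epsilon> * real e" using v(3) by simp
  have "real e * real ea < real eb + real ea" using e(3) by (simp flip: of_nat_mult of_nat_add)
  then have "real e \<le> real eb / real ea + 1" using ea by (simp add: field_simps)
  then have e_le: "real e \<le> 1 / \<epsilon> + 1" using v(3) by simp
  define t where "t = 131072 * k ^ 9 * e ^ 2"
  \<comment> \<open>One quantity that dominates k + 1, e and t + 2 simultaneously, also for
    \<open>k = 0\<close>, where t vanishes.\<close>
  define m where "m = 131072 * (k + 1) ^ 9 * (e + 1) ^ 2"
  have K9: "k ^ 9 \<le> (k + 1) ^ 9" "k + 1 \<le> (k + 1) ^ 9"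
    using power_mono[of k "k + 1" 9] self_le_power[of "k + 1" 9] by auto
  have E2: "e ^ 2 + 1 \<le> (e + 1) ^ 2" "e + 1 \<le> (e + 1) ^ 2" by (auto simp: power2_eq_square)
  have "k ^ 9 * e ^ 2 + 1 \<le> (k + 1) ^ 9 * (e + 1) ^ 2"
  proof -
    have "k ^ 9 * e ^ 2 \<le> (k + 1) ^ 9 * e ^ 2" using K9 by (intro mult_right_mono) auto
    moreover have "(k + 1) ^ 9 * (e ^ 2 + 1) \<le> (k + 1) ^ 9 * (e + 1) ^ 2" using E2 by (intro mult_left_mono) auto
    moreover have "(k + 1) ^ 9 * (e ^ 2 + 1) = (k + 1) ^ 9 * e ^ 2 + (k + 1) ^ 9" by (simp only: distrib_left mult_1_right)
    ultimately show ?thesis using K9(2) by linarith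
  qed
  then have tm: "t + 2 \<le> m" unfolding t_def m_def mult.assoc by linarith
  define w where "w = (k + 1) ^ 9 * (e + 1) ^ 2"
  have "(k + 1) * 1 \<le> w" "1 * (e + 1) \<le> w"
    unfolding w_def using K9 E2 by (intro mult_mono; simp)+
  moreover have "m = 131072 * w" by (simp add: m_def w_def mult.assoc)
  ultimately have km: "k + 1 \<le> m" "e \<le> m" by simp_all
  define B where "B = A * (1 + m) ^ (3 * n)"
  define L where "L = k * (m * (2 * B + 2000 * m ^ 4) + 12) + 2"
  have ne: "SVT_ext lam N S \<noteq> {}" by (rule SVT_ext_nonempty[OF S(1,2) lam])
  let ?f = "real (num_SVT lam N S)"
  let ?good = "\<lambda>v. \<exists>S' a' b'. 0 < b' \<and> v = Cell (Num 0) (stage_val lam N t S' a' b') \<and>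
     (1 - \<epsilon>) * ?f \<le> real a' / real b' \<and> real a' / real b' \<le> (1 + \<epsilon>) * ?f"
  have "\<exists>D. realizes (For (Stage p)) (Cell (Num k) (stage_val lam N t S 1 1)) D L \<and>
      (\<forall>v\<in>set_pmf D. \<exists>S' a' b'. 0 < b' \<and> v = Cell (Num 0) (stage_val lam N t S' a' b')) \<and>
      measure_pmf.prob D {v. \<not> ?good v} \<le> 1 / 4"
  \<comment> \<open>For \<open>k = 0\<close> the parameters degenerate (t = 0, division by k), but
    there is only one extension and the initial fraction 1/1 is exact.\<close>
  proof (cases "k = 0")
    case True
    let ?v = "Cell (Num 0) (stage_val lam N t S 1 1)"
    have "?f = 1" using ext_pretableau_0[of lam N S] S(1) ne True by simp
    then have "?good ?v" using \<epsilon> by (intro exI[of _ S] exI[of _ 1]) auto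
    then have "?v \<notin> {v. \<not> ?good v}" by blast
    then have "measure_pmf.prob (return_pmf ?v) {v. \<not> ?good v} \<le> 1 / 4"
      by (simp only: measure_return_pmf indicator_simps) simp
    moreover have "computes (For (Stage p)) ?v ?v L"
      by (rule computes_weaken[OF realizes_For_0]) (auto simp: L_def)
    ultimately show ?thesis unfolding True
      by (intro exI[of _ "return_pmf ?v"]) auto
  next
    case False
    then have k1: "1 \<le> k" by simp
    define \<eta> where "\<eta> = \<epsilon> / (2 * real k)"
    note size = sample_size_bound[OF k1 \<epsilon>(1) \<epsilon>e, folded t_def \<eta>_def]
    note err = power_error_bounds[OF \<epsilon>(1,2) k1, folded \<eta>_def]
    have e1: "1 \<le> e" using \<epsilon>e by (cases e) auto
    have "\<epsilon> * 1 \<le> 1 * real k" using \<epsilon> k1 by (intro mult_mono) auto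
    then have \<eta>: "0 < \<eta>" "\<eta> < 1" using \<epsilon> k1 by (auto simp: \<eta>_def field_simps)
    \<comment> \<open>A bias parameter must be smaller than 1, so 1/t is admissible only from t = 2
      on.\<close>
    have t2: "2 \<le> t" using k1 e1 by (simp add: t_def)
    have sampler: "\<exists>\<Gamma>. set_pmf \<Gamma> \<subseteq> SVT_ext lam N S' \<and> tv_dist \<Gamma> (pmf_of_set (SVT_ext lam N S')) \<le> 1 / real t \<and>
        realizes p (Cell (enc_inst (lam, N, S')) (Cell (Num 1) (Num t))) (map_pmf (enc_filling lam) \<Gamma>) B"
      if j: "j \<le> k" "j \<le> N" and S': "pretableau lam N j S'" "(lam, N, S') \<in> F" "SVT_ext lam N S' \<noteq> {}" for j S'
    proof -
      have "represents (Cell (Num 1) (Num t)) (1 / real t)" using t2 by (auto simp: represents_def)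
      moreover have "0 < 1 / real t" "1 / real t < 1" using t2 by auto
      ultimately have "0 < 1 / real t \<and> 1 / real t < 1 \<and> represents (Cell (Num 1) (Num t)) (1 / real t)" by blast
      note conc = p[OF j(2) S', THEN spec, THEN spec, THEN mp, OF this]
      obtain \<Gamma> where \<Gamma>: "set_pmf \<Gamma> \<subseteq> SVT_ext lam N S'" "tv_dist \<Gamma> (pmf_of_set (SVT_ext lam N S')) \<le> 1 / real t"
        and out: "output_dist p (Cell (enc_inst (lam, N, S')) (Cell (Num 1) (Num t))) = spmf_of_pmf (map_pmf (enc_filling lam) \<Gamma>)"
        using conc[THEN conjunct2] by blast
      have "1 / (1 / real t) = real t" by simp
      note run = conc[THEN conjunct1, unfolded this]
      have "card (empty_boxes lam S') \<le> j" using S'(1) by (simp add: pretableau_iff)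
      \<comment> \<open>All three arguments are at most m: the stage index is at most k, at most
        that many boxes are empty, and ln t \<le> t. So one bound \<open>B\<close> serves all calls
        of the sampler.\<close>
      then have "poly3 a n (real j) (real (card (empty_boxes lam S'))) (ln (real t))
        \<le> (\<Sum>i\<le>n. \<Sum>j\<le>n. \<Sum>l\<le>n. \<bar>a i j l\<bar>) * (1 + real m) ^ (3 * n)"
        using j km tm t2 ln_bound[of "real t"] by (intro poly3_le) auto
      also have "\<dots> \<le> real A * (1 + real m) ^ (3 * n)" using A by (intro mult_right_mono) auto
      also have "\<dots> = real B" by (simp add: B_def)
      finally show ?thesis using realizes_of_runs_within[OF run out] \<Gamma> by blast
    qed
    have "\<exists>D. realizes (For (Stage p)) (Cell (Num k) (stage_val lam N t S 1 1)) D (k * (m * (2 * B + 2000 * m ^ 4) + 12) + 2) \<and>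
      (\<forall>v\<in>set_pmf D. \<exists>S' a' b'. 0 < b' \<and> v = Cell (Num 0) (stage_val lam N t S' a' b')) \<and>
      measure_pmf.prob D {v. \<not> (\<exists>S' a' b'. 0 < b' \<and> v = Cell (Num 0) (stage_val lam N t S' a' b') \<and>
        ?f * real 1 / real 1 / (1 + \<eta>) ^ k \<le> real a' / real b' \<and>
        real a' / real b' \<le> ?f * real 1 / real 1 / (1 - \<eta>) ^ k)} \<le> real k * (1 / (4 * real k))"
      by (rule estimate_loop[OF lam(1) F km(1) tm sampler size(1) _ _ \<eta> size(2,3)]) (use S ne k1 in auto)
    then obtain D where D: "realizes (For (Stage p)) (Cell (Num k) (stage_val lam N t S 1 1)) D L"
      "\<forall>v\<in>set_pmf D. \<exists>S' a' b'. 0 < b' \<and> v = Cell (Num 0) (stage_val lam N t S' a' b')"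
      "measure_pmf.prob D {v. \<not> (\<exists>S' a' b'. 0 < b' \<and> v = Cell (Num 0) (stage_val lam N t S' a' b') \<and>
        ?f / (1 + \<eta>) ^ k \<le> real a' / real b' \<and> real a' / real b' \<le> ?f / (1 - \<eta>) ^ k)} \<le> 1 / 4"
      unfolding L_def using k1 by auto
    have bounds: "(1 - \<epsilon>) * ?f \<le> ?f / (1 + \<eta>) ^ k" "?f / (1 - \<eta>) ^ k \<le> (1 + \<epsilon>) * ?f"
      using mult_left_mono[OF err(1), of ?f] mult_left_mono[OF err(2), of ?f] by (auto simp: mult.commute)
    have "measure_pmf.prob D {v. \<not> ?good v} \<le> measure_pmf.prob D {v. \<not> (\<exists>S' a' b'. 0 < b' \<and> v = Cell (Num 0) (stage_val lam N t S' a' b') \<and>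
        ?f / (1 + \<eta>) ^ k \<le> real a' / real b' \<and> real a' / real b' \<le> ?f / (1 - \<eta>) ^ k)}"
    proof (intro measure_pmf.finite_measure_mono Collect_mono impI, elim contrapos_nn)
      fix v assume "\<exists>S' a' b'. 0 < b' \<and> v = Cell (Num 0) (stage_val lam N t S' a' b') \<and>
        ?f / (1 + \<eta>) ^ k \<le> real a' / real b' \<and> real a' / real b' \<le> ?f / (1 - \<eta>) ^ k"
      then obtain S' a' b' where w: "0 < b'" "v = Cell (Num 0) (stage_val lam N t S' a' b')"
        "?f / (1 + \<eta>) ^ k \<le> real a' / real b'" "real a' / real b' \<le> ?f / (1 - \<eta>) ^ k" by blast
      show "?good v"
        using w(1,2) order_trans[OF bounds(1) w(3)] order_trans[OF w(4) bounds(2)] by blast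
    qed simp
    then show ?thesis using D by (intro exI[of _ D]) auto
  qed
  then obtain D where D: "realizes (For (Stage p)) (Cell (Num k) (stage_val lam N t S 1 1)) D L"
      "\<And>v. v \<in> set_pmf D \<Longrightarrow> \<exists>S' a' b'. 0 < b' \<and> v = Cell (Num 0) (stage_val lam N t S' a' b')"
      "measure_pmf.prob D {v. \<not> ?good v} \<le> 1 / 4" by blast
  obtain T where T: "T \<in> SVT_ext lam N S" using ne by blast
  let ?D = "map_pmf (\<lambda>v. snd_val (snd_val v)) D"
  let ?B = "L + m * (600 * m ^ 4) + 230 * m + 100"
  show ?thesis
  proof (rule that)
    show "realizes (Estimate p) (Cell (enc_inst (lam, N, S)) v) ?D ?B"
      by (rule realizes_Estimate[where t = t, OF lam S(1,2) T e(1) _ km D(1)[unfolded t_def]]) (simp add: m_def, use D(2) in blast)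
    have rep: "represents (snd_val (snd_val (Cell (Num 0) (stage_val lam N t S' a' b')))) (real a' / real b')"
      if "0 < b'" for S' a' b'
      using that by (simp add: represents_def stage_val_def)
    show "\<exists>x. represents y x" if y: "y \<in> set_pmf ?D" for y
    proof -
      obtain v where v: "v \<in> set_pmf D" "y = snd_val (snd_val v)" using y by auto
      show ?thesis using D(2)[OF v(1)] rep unfolding v(2) by blast
    qed
    have "{v. ?good v} \<subseteq> (\<lambda>v. snd_val (snd_val v)) -` {y. \<exists>x. represents y x \<and> (1 - \<epsilon>) * ?f \<le> x \<and> x \<le> (1 + \<epsilon>) * ?f}"
      using rep by blast
    then have "measure_pmf.prob D {v. ?good v} \<le> measure_pmf.prob ?D {y. \<exists>x. represents y x \<and> (1 - \<epsilon>) * ?f \<le> x \<and> x \<le> (1 + \<epsilon>) * ?f}"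
      unfolding measure_map_pmf by (rule measure_pmf.finite_measure_mono) simp
    moreover have "measure_pmf.prob D {v. ?good v} = 1 - measure_pmf.prob D {v. \<not> ?good v}"
      by (rule prob_Collect_not)
    ultimately show "3 / 4 \<le> measure_pmf.prob ?D {y. \<exists>x. represents y x \<and> (1 - \<epsilon>) * ?f \<le> x \<and> x \<le> (1 + \<epsilon>) * ?f}"
      using D(3) by linarith
    show "real ?B \<le> 3000 * (real A + 1) * (2 ^ 20) ^ (3 * n + 6) * ((1 + real k) * (1 + 1 / \<epsilon>)) ^ (9 * (3 * n + 6))"
    proof -
      have m1: "1 \<le> m" using km by simp
      have "L \<le> m * (m * (2 * B + 2000 * m ^ 4) + 12) + 2"
        unfolding L_def using km by (intro add_right_mono mult_right_mono) auto
      also have "\<dots> = 2 * (m ^ 2 * B) + 2000 * (m * (m * m ^ 4)) + 12 * m + 2"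
        by (simp add: algebra_simps power2_eq_square)
      also have "m * (m * m ^ 4) = m ^ 6" by (simp add: eval_nat_numeral)
      finally have "L \<le> 2 * (m ^ 2 * B) + 2000 * m ^ 6 + 12 * m + 2" .
      moreover have "m * m ^ 4 = m ^ 5" by (simp add: eval_nat_numeral)
      then have "m * (600 * m ^ 4) = 600 * m ^ 5" by simp
      ultimately have "?B \<le> 2 * (m ^ 2 * B) + 2000 * m ^ 6 + 12 * m + 2 + 600 * m ^ 5 + 230 * m + 100"
        by linarith
      moreover have "m ^ 2 * B \<le> m ^ 6 * B" using m1 by (intro mult_right_mono power_increasing) auto
      moreover have "m ^ 5 \<le> m ^ 6" "m \<le> m ^ 6" "1 \<le> m ^ 6"
        using m1 power_increasing[of 5 6 m] self_le_power[of m 6] by auto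
      ultimately have "?B \<le> 3000 * (m ^ 6 * B) + 3000 * m ^ 6" by linarith
      also have "\<dots> = 3000 * (m ^ 6 * (B + 1))" by simp
      also have "\<dots> \<le> 3000 * ((1 + m) ^ 6 * ((A + 1) * (1 + m) ^ (3 * n)))"
        by (intro mult_le_mono power_mono order_refl) (auto simp: B_def)
      also have "\<dots> = 3000 * (A + 1) * (1 + m) ^ (3 * n + 6)"
        by (simp only: power_add mult_ac)
      finally have "real ?B \<le> real (3000 * (A + 1) * (1 + m) ^ (3 * n + 6))" by (rule of_nat_mono)
      also have "\<dots> = 3000 * (real A + 1) * (1 + real m) ^ (3 * n + 6)" by simp
      also have "\<dots> \<le> 3000 * (real A + 1) * (2 ^ 20 * ((1 + real k) * (1 + 1 / \<epsilon>)) ^ 9) ^ (3 * n + 6)"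
      proof (intro mult_left_mono power_mono)
        \<comment> \<open>Here e + 1 \<le> 2d, so m \<le> 2^17 * 4 * P^9 = 2^19 P^9, after raising
          d^2 to d^9 for a common exponent. Adding 1 stays below 2^20 P^9.\<close>
        define d where "d = 1 + 1 / \<epsilon>"
        define P where "P = (1 + real k) * d"
        have "1 \<le> d" "real e \<le> d" using \<epsilon> e_le by (auto simp: d_def)
        then have d: "1 \<le> d" "real e + 1 \<le> 2 * d" by linarith+
        have "1 * 1 \<le> P" unfolding P_def using d by (intro mult_mono) auto
        then have P1: "1 \<le> P ^ 9" by (intro one_le_power) simp
        have "(real e + 1) ^ 2 \<le> (2 * d) ^ 2" using d by (intro power_mono) auto
        moreover have "d ^ 2 \<le> d ^ 9" using d by (intro power_increasing) auto
        ultimately have E: "(real e + 1) ^ 2 \<le> 4 * d ^ 9" by (simp add: power_mult_distrib)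
        have "real m = 131072 * ((1 + real k) ^ 9 * (real e + 1) ^ 2)" by (simp add: m_def add.commute)
        also have "\<dots> \<le> 131072 * ((1 + real k) ^ 9 * (4 * d ^ 9))"
          by (intro mult_left_mono E) auto
        also have "\<dots> = 524288 * P ^ 9"
          by (simp add: P_def power_mult_distrib)
        finally have "real m \<le> 524288 * P ^ 9" .
        then show "1 + real m \<le> 2 ^ 20 * ((1 + real k) * (1 + 1 / \<epsilon>)) ^ 9"
          using P1 unfolding d_def[symmetric] P_def[symmetric] by simp
      qed auto
      also have "\<dots> = 3000 * (real A + 1) * (2 ^ 20) ^ (3 * n + 6) * ((1 + real k) * (1 + 1 / \<epsilon>)) ^ (9 * (3 * n + 6))"
        by (simp only: power_mult_distrib power_mult mult.assoc)
      finally show ?thesis .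
    qed
  qed
qed

theorem theorem6p1:
  fixes F :: "inst set"
  assumes "F \<subseteq> SVT_triples"
    and "downwardly_stable F"
    and "\<exists>p. is_FPAUS p F"
  shows "\<exists>q. is_FPRAS q F"
proof -
  obtain p a n where p: "\<And>lam N k S. k \<le> N \<Longrightarrow> pretableau lam N k S \<Longrightarrow> (lam, N, S) \<in> F \<Longrightarrow> SVT_ext lam N S \<noteq> {} \<Longrightarrow>
     (\<forall>\<delta> d. 0 < \<delta> \<and> \<delta> < 1 \<and> represents d \<delta> \<longrightarrow>
        runs_within p (Cell (enc_inst (lam, N, S)) d)
          (poly3 a n (real k) (real (card (empty_boxes lam S))) (ln (1 / \<delta>))) \<and>
        (\<exists>\<Gamma>. set_pmf \<Gamma> \<subseteq> SVT_ext lam N S \<and>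
           tv_dist \<Gamma> (pmf_of_set (SVT_ext lam N S)) \<le> \<delta> \<and>
           output_dist p (Cell (enc_inst (lam, N, S)) d) =
             spmf_of_pmf (map_pmf (enc_filling lam) \<Gamma>)))"
    using assms(3) unfolding is_FPAUS_def by fast
  define A where "A = nat \<lceil>\<Sum>i\<le>n. \<Sum>j\<le>n. \<Sum>l\<le>n. \<bar>a i j l\<bar>\<rceil>"
  have A: "(\<Sum>i\<le>n. \<Sum>j\<le>n. \<Sum>l\<le>n. \<bar>a i j l\<bar>) \<le> real A"
    unfolding A_def by linarith
  define M where "M = 9 * (3 * n + 6)"
  define C where "C = 3000 * (real A + 1) * (2 ^ 20) ^ (3 * n + 6)"
  have C1: "1 \<le> (2 ^ 20 :: real) ^ (3 * n + 6)" by (rule one_le_power) simp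
  then have "3000 * 1 \<le> C" unfolding C_def by (intro mult_mono) auto
  then have C: "3000 \<le> C" by simp
  \<comment> \<open>The coefficients of C (1 + x)^M (1 + y)^M (1 + z)^M, a polynomial that dominates
    the bound of \<open>FPRAS_run\<close>.\<close>
  define coeff where "coeff = (\<lambda>i j l. C * (real (M choose i) * real (M choose j) * real (M choose l)))"
  have "\<exists>D B. realizes (Estimate p) (Cell (enc_inst (lam, N, S)) e) D B \<and>
      real B \<le> poly3 coeff M (real (card (empty_boxes lam S))) (real k) (1 / \<epsilon>) \<and>
      (\<forall>y\<in>set_pmf D. \<exists>x. represents y x) \<and>
      3 / 4 \<le> measure_pmf.prob D {y. \<exists>x. represents y x \<and>
        (1 - \<epsilon>) * real (num_SVT lam N S) \<le> x \<and> x \<le> (1 + \<epsilon>) * real (num_SVT lam N S)}"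
    if inst: "(lam, N, S) \<in> F" "k \<le> N" "pretableau lam N k S" and \<epsilon>: "0 < \<epsilon>" "\<epsilon> \<le> 1" "represents e \<epsilon>" for lam N S k \<epsilon> e
  proof (cases "lam = []")
    case True
    let ?y = "Cell (Num (1 - N)) (Num 1)"
    have "real 30 \<le> C * 1" using C by simp
    also have "\<dots> \<le> poly3 coeff M (real (card (empty_boxes lam S))) (real k) (1 / \<epsilon>)"
      unfolding coeff_def poly3_product using C \<epsilon>
      by (intro mult_left_mono mult_ge1_I one_le_power) auto
    finally have B: "real 30 \<le> poly3 coeff M (real (card (empty_boxes lam S))) (real k) (1 / \<epsilon>)" .
    have r: "represents ?y (real (num_SVT lam N S))"
      using SVT_ext_Nil(2)[of N k S] inst True by (auto simp: represents_def)
    moreover have "(1 - \<epsilon>) * real (num_SVT lam N S) \<le> real (num_SVT lam N S)"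
      "real (num_SVT lam N S) \<le> (1 + \<epsilon>) * real (num_SVT lam N S)"
      using \<epsilon> by (auto simp: algebra_simps)
    ultimately have "?y \<in> {y. \<exists>x. represents y x \<and>
        (1 - \<epsilon>) * real (num_SVT lam N S) \<le> x \<and> x \<le> (1 + \<epsilon>) * real (num_SVT lam N S)}" by blast
    then show ?thesis
      using computes_Estimate_Nil[of p N S e] B r unfolding True
      by (intro exI[of _ "return_pmf ?y"] exI[of _ 30]) (auto simp: indicator_def)
  next
    case False
    have lam: "partition lam" using assms(1) inst(1) by (auto simp: SVT_triples_def)
    \<comment> \<open>The factor 1 makes room for the variable counting the empty boxes, on which
      the bound obtained does not depend.\<close>
    have "C * ((1 + real k) * (1 + 1 / \<epsilon>)) ^ M = C * (1 * ((1 + real k) ^ M * (1 + 1 / \<epsilon>) ^ M))"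
      by (simp add: power_mult_distrib)
    also have "\<dots> \<le> poly3 coeff M (real (card (empty_boxes lam S))) (real k) (1 / \<epsilon>)"
      unfolding coeff_def poly3_product using C \<epsilon>
      by (intro mult_left_mono mult_right_mono one_le_power) auto
    finally have le: "C * ((1 + real k) * (1 + 1 / \<epsilon>)) ^ M \<le> poly3 coeff M (real (card (empty_boxes lam S))) (real k) (1 / \<epsilon>)" .
    show ?thesis
    proof (rule FPRAS_run[OF lam False assms(2) inst(3,2,1) \<epsilon>], erule (3) p, rule A)
      fix D B
      assume "realizes (Estimate p) (Cell (enc_inst (lam, N, S)) e) D B"
        "real B \<le> 3000 * (real A + 1) * (2 ^ 20) ^ (3 * n + 6) * ((1 + real k) * (1 + 1 / \<epsilon>)) ^ (9 * (3 * n + 6))"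
        "\<And>y. y \<in> set_pmf D \<Longrightarrow> \<exists>x. represents y x"
        "3 / 4 \<le> measure_pmf.prob D {y. \<exists>x. represents y x \<and>
          (1 - \<epsilon>) * real (num_SVT lam N S) \<le> x \<and> x \<le> (1 + \<epsilon>) * real (num_SVT lam N S)}"
      then show ?thesis
        using order_trans[OF _ le, unfolded C_def M_def] unfolding M_def by blast
    qed
  qed
  note run = this
  have "is_FPRAS (Estimate p) F"
    unfolding is_FPRAS_def
  proof (intro exI[of _ coeff] exI[of _ M] ballI, clarify)
    fix lam N S k \<epsilon> e
    assume "(lam, N, S) \<in> F" "k \<le> N" "pretableau lam N k S" "0 < \<epsilon>" "\<epsilon> \<le> 1" "represents e \<epsilon>"
    from run[OF this] obtain D B where DB: "realizes (Estimate p) (Cell (enc_inst (lam, N, S)) e) D B"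
      "real B \<le> poly3 coeff M (real (card (empty_boxes lam S))) (real k) (1 / \<epsilon>)"
      "\<forall>y\<in>set_pmf D. \<exists>x. represents y x"
      "3 / 4 \<le> measure_pmf.prob D {y. \<exists>x. represents y x \<and>
        (1 - \<epsilon>) * real (num_SVT lam N S) \<le> x \<and> x \<le> (1 + \<epsilon>) * real (num_SVT lam N S)}" by blast
    show "runs_within (Estimate p) (Cell (enc_inst (lam, N, S)) e)
          (poly3 coeff M (real (card (empty_boxes lam S))) (real k) (1 / \<epsilon>)) \<and>
        (\<forall>y\<in>set_spmf (output_dist (Estimate p) (Cell (enc_inst (lam, N, S)) e)). \<exists>A. represents y A) \<and>
        measure (measure_spmf (output_dist (Estimate p) (Cell (enc_inst (lam, N, S)) e)))
          {y. \<exists>A. represents y A \<and>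
             (1 - \<epsilon>) * real (num_SVT lam N S) \<le> A \<and> A \<le> (1 + \<epsilon>) * real (num_SVT lam N S)}
          \<ge> 3 / 4"
      using runs_within_of_realizes[OF DB(1,2)] DB(3,4) by simp
  qed
  then show ?thesis by blast
qed

end
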